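(* Suppose that $\mathcal X$ and $\mathcal Y$ are finite-dimensional and that $f,f_2,g,g_2$ are convex piecewise linear-quadratic. Then for all $\beta\in[0,+\infty)^2$ there exist a constant $\eta(\beta)>0$ and a region $\mathcal R(\beta)$ (an open set containing $\mathcal Z^*$) such that $$G_\beta(z;z^* )\ge\frac{\eta(\beta)}2\,\mathrm{dist}_V(z,\mathcal Z^* )^2\qquad\text{for all }z\in\mathcal R(\beta)\text{ and all }z^*\in\mathcal Z^* .$$
   Context: A function is piecewise linear-quadratic if its domain is a union of (finitely many) polyhedra on each of which it is a quadratic function. $\mathcal X,\mathcal Y$ are Euclidean spaces, $\mathcal Z=\mathcal X\times\mathcal Y$, $f,f_2:\mathcal X\to\mathbb R\cup\{+\infty\}$, $g,g_2:\mathcal Y\to\mathbb R\cup\{+\infty\}$ are proper lower semicontinuous convex, $A:\mathcal X\to\mathcal Y$ is linear, $f_2$ and $g_2^*$ are differentiable with Lipschitz gradients. The Lagrangian is $L(x,y)=f(x)+f_2(x)+\langle Ax,y\rangle-g^*(y)-g_2^*(y)$ and its set of saddle points $\mathcal Z^*$ is assumed nonempty. For fixed $\tau,\sigma>0$, $\|z\|_V=(\frac1\tau\|x\|^2+\frac1\sigma\|y\|^2)^{1/2}$ and $\mathrm{dist}_V$ is the associated distance. For $\beta=(\beta_x,\beta_y)$, $$G_\beta(z;z^* )=\sup_{(x',y')\in\mathcal Z}L(x,y')-L(x',y)-\frac{\beta_x}{2\tau}\|x'-x^*\|^2-\frac{\beta_y}{2\sigma}\|y'-y^*\|^2,$$ with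 value $+\infty$ when $x\notin\mathrm{dom}(f+f_2)$ or $y\notin\mathrm{dom}(g^*+g_2^* )$. *)

theory Defs
  imports "HOL-Analysis.Analysis"
begin

definition edom :: "('a \<Rightarrow> ereal) \<Rightarrow> 'a set" where
  "edom f = {x. f x < \<infinity>}"

definition proper :: "('a \<Rightarrow> ereal) \<Rightarrow> bool" where
  "proper f \<longleftrightarrow> (\<forall>x. f x \<noteq> -\<infinity>) \<and> edom f \<noteq> {}"

(* "at a" is the punctured neighbourhood filter, so a itself does not enter the Liminf *)
definition lsc :: "('a::topological_space \<Rightarrow> ereal) \<Rightarrow> bool" where
  "lsc f \<longleftrightarrow> (\<forall>a. f a \<le> Liminf (at a) f)"

(* only used for proper functions, where no sum of opposite infinities can occur;
   0 * \<infinity> = 0 in ereal, so the cases t = 0 and t = 1 are harmless *)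
definition convex_ereal :: "('a::real_vector \<Rightarrow> ereal) \<Rightarrow> bool" where
  "convex_ereal f \<longleftrightarrow>
    (\<forall>x y. \<forall>t\<in>{0..1::real}.
       f ((1 - t) *\<^sub>R x + t *\<^sub>R y) \<le> ereal (1 - t) * f x + ereal t * f y)"

definition proper_lsc_convex :: "('a::real_normed_vector \<Rightarrow> ereal) \<Rightarrow> bool" where
  "proper_lsc_convex f \<longleftrightarrow> proper f \<and> lsc f \<and> convex_ereal f"

definition quadratic_fun :: "('a::real_inner \<Rightarrow> real) \<Rightarrow> bool" where
  "quadratic_fun q \<longleftrightarrow>
    (\<exists>Q b c. linear Q \<and> (\<forall>x y. Q x \<bullet> y = x \<bullet> Q y) \<and>
             (\<forall>x. q x = 1/2 * (Q x \<bullet> x) + b \<bullet> x + c))"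

definition piecewise_linear_quadratic :: "('a::euclidean_space \<Rightarrow> ereal) \<Rightarrow> bool" where
  "piecewise_linear_quadratic f \<longleftrightarrow>
    (\<exists>\<P>. finite \<P> \<and> (\<forall>P\<in>\<P>. polyhedron P) \<and> edom f = \<Union>\<P> \<and>
         (\<forall>P\<in>\<P>. \<exists>q. quadratic_fun q \<and> (\<forall>x\<in>P. f x = ereal (q x))))"

definition conjugate :: "('a::real_inner \<Rightarrow> ereal) \<Rightarrow> 'a \<Rightarrow> ereal" where
  "conjugate f y = (SUP x. ereal (x \<bullet> y) - f x)"

(* differentiability on the whole space includes finiteness everywhere *)
definition lipschitz_gradient :: "('a::real_inner \<Rightarrow> ereal) \<Rightarrow> bool" where
  "lipschitz_gradient h \<longleftrightarrow>
    (\<forall>x. \<bar>h x\<bar> \<noteq> \<infinity>) \<and>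
    (\<exists>G K. (\<forall>x. GDERIV (\<lambda>x. real_of_ereal (h x)) x :> G x) \<and> K-lipschitz_on UNIV G)"

(* Since \<infinity> - \<infinity> = \<infinity> in ereal, the value is \<infinity> whenever f x + f2 x = \<infinity>, and it is -\<infinity>
   when f x + f2 x is finite but y lies outside the domain of the conjugate terms. With this
   convention a saddle point always lies in the two effective domains. *)
definition lagrangian ::
  "('a::real_inner \<Rightarrow> 'b::real_inner) \<Rightarrow> ('a \<Rightarrow> ereal) \<Rightarrow> ('a \<Rightarrow> ereal) \<Rightarrow>
   ('b \<Rightarrow> ereal) \<Rightarrow> ('b \<Rightarrow> ereal) \<Rightarrow> 'a \<Rightarrow> 'b \<Rightarrow> ereal" where
  "lagrangian A f f2 g g2 x y =
     f x + f2 x + ereal (A x \<bullet> y) - conjugate g y - conjugate g2 y"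

definition saddle_points :: "('a \<Rightarrow> 'b \<Rightarrow> ereal) \<Rightarrow> ('a \<times> 'b) set" where
  "saddle_points L =
     {(xs, ys). (\<forall>y. L xs y \<le> L xs ys) \<and> (\<forall>x. L xs ys \<le> L x ys)}"

definition norm_V :: "real \<Rightarrow> real \<Rightarrow> 'a::real_normed_vector \<times> 'b::real_normed_vector \<Rightarrow> real" where
  "norm_V \<tau> \<sigma> z = sqrt (1/\<tau> * (norm (fst z))\<^sup>2 + 1/\<sigma> * (norm (snd z))\<^sup>2)"

definition dist_V ::
  "real \<Rightarrow> real \<Rightarrow> 'a::real_normed_vector \<times> 'b::real_normed_vector \<Rightarrow> ('a \<times> 'b) set \<Rightarrow> real" where
  "dist_V \<tau> \<sigma> z S = (INF w\<in>S. norm_V \<tau> \<sigma> (z - w))"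

definition smoothed_gap ::
  "('a::real_inner \<Rightarrow> 'b::real_inner) \<Rightarrow> ('a \<Rightarrow> ereal) \<Rightarrow> ('a \<Rightarrow> ereal) \<Rightarrow>
   ('b \<Rightarrow> ereal) \<Rightarrow> ('b \<Rightarrow> ereal) \<Rightarrow> real \<Rightarrow> real \<Rightarrow> real \<times> real \<Rightarrow>
   'a \<times> 'b \<Rightarrow> 'a \<times> 'b \<Rightarrow> ereal" where
  "smoothed_gap A f f2 g g2 \<tau> \<sigma> = (\<lambda>(\<beta>x, \<beta>y) (x, y) (xs, ys).
     if x \<in> edom (\<lambda>u. f u + f2 u) \<and> y \<in> edom (\<lambda>v. conjugate g v + conjugate g2 v)
     then (SUP (x', y')\<in>UNIV.
             lagrangian A f f2 g g2 x y' - lagrangian A f f2 g g2 x' y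
             - ereal (\<beta>x / (2 * \<tau>) * (norm (x' - xs))\<^sup>2)
             - ereal (\<beta>y / (2 * \<sigma>) * (norm (y' - ys))\<^sup>2))
     else \<infinity>)"

end

theory Submission
  imports Defs
begin

text \<open>Write \<open>H = f + f2\<close> and \<open>K = g* + g2*\<close>. The saddle points form a product \<open>X \<times> Y\<close>, and the gap
  splits into a part that vanishes for \<open>x \<in> X\<close> and a part that vanishes for \<open>y \<in> Y\<close>. Fix a saddle
  point \<open>(x0, y0)\<close>. Since \<open>f2\<close> and \<open>g2*\<close> are differentiable, \<open>X\<close> is cut out by subdifferential
  inclusions for the separate functions \<open>f\<close>, \<open>f2\<close>, \<open>g*\<close>. A piecewise linear-quadratic function
  grows quadratically around the minimizers of any of its affine perturbations, and it has a
  quadratic upper bound in the directions normal to a subdifferential; conjugation exchanges these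
  two properties, so they hold for \<open>g*\<close> too. Hence the first part of the gap is bounded below by
  the squared distances to the three polyhedra that define \<open>X\<close>, and the bound of Hoffman turns
  these into the squared distance to \<open>X\<close>. Uniformity over the reference points \<open>y1 \<in> Y\<close> follows as
  this part of the gap is concave and nonnegative in \<open>y1\<close>, so that finitely many \<open>y1\<close> suffice.\<close>

section \<open>Polyhedra\<close>

text \<open>Two obstacles shape the argument. Growth away from minimizers is in general quadratic
  only nearby and linear far away, so every lower bound is stated with \<open>huber\<close>, the
  minimum of \<open>r\<close> and its square; the region consists of the points closer than 1 to
  both factors \<open>X\<close> and \<open>Y\<close>, where \<open>huber\<close> is the square.
  Moreover, conjugates enter only through the consequences collected in \<open>plq_like\<close>,
  which are transferred one by one by duality. The supremum in the gap is bounded below by a test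
  pair whose two components are chosen independently. A test step away from a reference saddle point
  gains an amount linear in its length and costs a quadratic amount, due partly to the curvature of
  the functions and partly to the penalty with \<beta>. A short enough step keeps half of the
  gain.\<close>

lemma polyhedron_finite_inequalities:
  fixes S :: "'a::euclidean_space set"
  shows "polyhedron S \<longleftrightarrow>
    (\<exists>F::('a \<times> real) set. finite F \<and> S = {x. \<forall>p\<in>F. fst p \<bullet> x \<le> snd p})"
proof
  assume "polyhedron S"
  then obtain H where H: "finite H" "S = \<Inter>H" "\<forall>h\<in>H. \<exists>a b. a \<noteq> 0 \<and> h = {x. a \<bullet> x \<le> b}"
    unfolding polyhedron_def by blast
  then obtain a b where ab: "\<And>h. h \<in> H \<Longrightarrow> h = {x. a h \<bullet> x \<le> b h}"
    by metis
  then have "S = {x. \<forall>p\<in>(\<lambda>h. (a h, b h)) ` H. fst p \<bullet> x \<le> snd p}"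
    unfolding H(2) by auto
  with \<open>finite H\<close> show "\<exists>F::('a \<times> real) set. finite F \<and> S = {x. \<forall>p\<in>F. fst p \<bullet> x \<le> snd p}"
    by blast
next
  assume "\<exists>F::('a \<times> real) set. finite F \<and> S = {x. \<forall>p\<in>F. fst p \<bullet> x \<le> snd p}"
  then obtain F :: "('a \<times> real) set"
    where F: "finite F" "S = (\<Inter>p\<in>F. {x. fst p \<bullet> x \<le> snd p})"
    by auto
  show "polyhedron S"
    unfolding F(2) using F(1) by (intro polyhedron_Inter) (auto simp: polyhedron_halfspace_le)
qed

lemma polyhedron_inequalitiesE:
  fixes S :: "'a::euclidean_space set"
  assumes "polyhedron S"
  obtains F :: "('a \<times> real) set" where "finite F" "S = {x. \<forall>p\<in>F. fst p \<bullet> x \<le> snd p}"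
  using assms polyhedron_finite_inequalities[of S] by blast

lemma polyhedron_affine_preimage:
  fixes B :: "'a::euclidean_space \<Rightarrow> 'b::euclidean_space"
  assumes "polyhedron C" "linear B"
  shows "polyhedron {x. B x + b \<in> C}"
proof -
  obtain F :: "('b \<times> real) set" where F: "finite F" "C = {x. \<forall>p\<in>F. fst p \<bullet> x \<le> snd p}"
    by (rule polyhedron_inequalitiesE[OF assms(1)])
  have "fst p \<bullet> (B x + b) \<le> snd p \<longleftrightarrow> adjoint B (fst p) \<bullet> x \<le> snd p - fst p \<bullet> b" for p x
    using adjoint_works[OF assms(2), of x "fst p"] by (auto simp: inner_add_right inner_commute)
  then have "{x. B x + b \<in> C} = (\<Inter>p\<in>F. {x. adjoint B (fst p) \<bullet> x \<le> snd p - fst p \<bullet> b})"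
    using F(2) by auto
  also have "polyhedron \<dots>"
    using F(1) by (intro polyhedron_Inter) (auto simp: polyhedron_halfspace_le)
  finally show ?thesis .
qed

text \<open>The residual \<open>e\<close> of the projection onto a polyhedron lies in the normal cone of the set
  \<open>J\<close> of active constraints, and on the unit vectors of this cone the violation of the
  constraints in \<open>J\<close> is bounded below by compactness. The bound depends on \<open>J\<close> only, whence
  the uniformity in the right-hand side \<open>b\<close>.\<close>

lemma hoffman:
  fixes a :: "'i \<Rightarrow> 'a::euclidean_space"
  assumes "finite I"
  shows "\<exists>\<kappa>>0. \<forall>b x. (\<exists>z. \<forall>i\<in>I. a i \<bullet> z \<le> b i) \<longrightarrow>
    (\<exists>z. (\<forall>i\<in>I. a i \<bullet> z \<le> b i) \<and> norm (x - z) \<le> \<kappa> * (\<Sum>i\<in>I. max 0 (a i \<bullet> x - b i)))"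
proof -
  \<comment> \<open>\<open>N J\<close> consists of the unit vectors in the polar of the cone of all
    \<open>d\<close> with \<open>a i \<bullet> d \<le> 0\<close> for \<open>i\<close> in
    \<open>J\<close>. Written with the polar, it is visibly closed.\<close>
  define N where "N J = sphere 0 1 \<inter> (\<Inter>d\<in>{d. \<forall>i\<in>J. a i \<bullet> d \<le> 0}. {e. d \<bullet> e \<le> 0})" for J
  have "\<exists>\<mu>>0. \<forall>e\<in>N J. \<mu> \<le> (\<Sum>i\<in>J. max 0 (a i \<bullet> e))" if "J \<subseteq> I" for J
  proof (cases "N J = {}")
    case True
    then show ?thesis by (intro exI[of _ 1]) auto
  next
    case False
    have "compact (N J)"
      unfolding N_def by (intro compact_Int_closed closed_INT ballI closed_halfspace_le) auto
    moreover have "continuous_on (N J) (\<lambda>e. \<Sum>i\<in>J. max 0 (a i \<bullet> e))"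
      by (intro continuous_intros)
    ultimately have "\<exists>e\<in>N J. \<forall>e'\<in>N J.
        (\<Sum>i\<in>J. max 0 (a i \<bullet> e)) \<le> (\<Sum>i\<in>J. max 0 (a i \<bullet> e'))"
      using False by (intro continuous_attains_inf)
    then obtain e where e: "e \<in> N J"
        "\<And>e'. e' \<in> N J \<Longrightarrow> (\<Sum>i\<in>J. max 0 (a i \<bullet> e)) \<le> (\<Sum>i\<in>J. max 0 (a i \<bullet> e'))"
      by blast
    have "finite J" using that assms finite_subset by blast
    \<comment> \<open>Otherwise \<open>e\<close> is itself one of the directions \<open>d\<close> in
      the definition of \<open>N J\<close>, and \<open>e \<bullet> e \<le> 0\<close> contradicts
      \<open>norm e = 1\<close>.\<close>
    have "\<exists>i\<in>J. a i \<bullet> e > 0"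
    proof (rule ccontr)
      assume "\<not> (\<exists>i\<in>J. a i \<bullet> e > 0)"
      then have "e \<bullet> e \<le> 0" using e(1) unfolding N_def by (auto simp: not_less)
      then show False using e(1) unfolding N_def by (auto simp: dot_square_norm)
    qed
    then have "(\<Sum>i\<in>J. max 0 (a i \<bullet> e)) > 0"
      using \<open>finite J\<close> by (auto intro: sum_pos2)
    with e(2) show ?thesis by blast
  qed
  then have "\<exists>\<mu>. \<forall>J\<in>Pow I. \<mu> J > 0 \<and> (\<forall>e\<in>N J. \<mu> J \<le> (\<Sum>i\<in>J. max 0 (a i \<bullet> e)))"
    by (intro bchoice) auto
  then obtain \<mu> where \<mu>: "\<And>J. J \<subseteq> I \<Longrightarrow> \<mu> J > 0"
      "\<And>J e. J \<subseteq> I \<Longrightarrow> e \<in> N J \<Longrightarrow> \<mu> J \<le> (\<Sum>i\<in>J. max 0 (a i \<bullet> e))"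
    by (metis PowI)
  \<comment> \<open>Which constraints are active at the projection depends on \<open>b\<close> and
    \<open>x\<close>; the sum over all subsets of \<open>I\<close> dominates every possible
    \<open>1 / \<mu> J\<close>.\<close>
  define \<kappa> where "\<kappa> = (\<Sum>J\<in>Pow I. 1 / \<mu> J)"
  have \<kappa>: "1 / \<mu> J \<le> \<kappa>" if "J \<subseteq> I" for J
    unfolding \<kappa>_def by (rule member_le_sum) (use that \<mu>(1) assms in \<open>auto intro: less_imp_le\<close>)
  have "\<kappa> > 0"
    using \<kappa>[of "{}"] \<mu>(1)[of "{}"] by (metis empty_subsetI less_le_trans zero_less_divide_1_iff)
  moreover have "\<exists>z. (\<forall>i\<in>I. a i \<bullet> z \<le> b i) \<and>
      norm (x - z) \<le> \<kappa> * (\<Sum>i\<in>I. max 0 (a i \<bullet> x - b i))"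
    if feasible: "\<exists>z. \<forall>i\<in>I. a i \<bullet> z \<le> b i" for b x
  proof -
    define S where "S = (\<Inter>i\<in>I. {z. a i \<bullet> z \<le> b i})"
    have "convex S" unfolding S_def by (intro convex_INT convex_halfspace_le)
    have "closed S" unfolding S_def by (intro closed_INT ballI closed_halfspace_le)
    have "S \<noteq> {}" using feasible unfolding S_def by auto
    define z where "z = closest_point S x"
    have "z \<in> S" unfolding z_def using \<open>closed S\<close> \<open>S \<noteq> {}\<close> by (rule closest_point_in_set)
    define J where "J = {i\<in>I. a i \<bullet> z = b i}"
    define e where "e = x - z"
    have "J \<subseteq> I" unfolding J_def by auto
    \<comment> \<open>Such a direction is feasible for a short while: active constraints do not
      increase along it and inactive ones stay slack for small \<open>t\<close>. The obtuse angle
      property of the projection then applies.\<close>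
    have normal: "e \<bullet> d \<le> 0" if d: "\<forall>i\<in>J. a i \<bullet> d \<le> 0" for d
    proof -
      have "\<forall>\<^sub>F t in at_right 0. \<forall>i\<in>I. a i \<bullet> (z + t *\<^sub>R d) \<le> b i"
      proof (intro eventually_ball_finite assms ballI)
        fix i assume "i \<in> I"
        show "\<forall>\<^sub>F t in at_right 0. a i \<bullet> (z + t *\<^sub>R d) \<le> b i"
        proof (cases "i \<in> J")
          case True
          have "\<forall>\<^sub>F t in at_right (0::real). 0 < t"
            by (rule eventually_at_right_less)
          then show ?thesis
          proof eventually_elim
            case (elim t)
            have "t * (a i \<bullet> d) \<le> 0" using d True elim by (simp add: mult_nonneg_nonpos)
            then show ?case using True unfolding J_def by (simp add: inner_add_right)
          qed
        next
          case False
          have "((\<lambda>t. a i \<bullet> (z + t *\<^sub>R d)) \<longlongrightarrow> a i \<bullet> (z + 0 *\<^sub>R d)) (at_right 0)"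
            by (intro tendsto_intros)
          moreover have "a i \<bullet> (z + 0 *\<^sub>R d) < b i"
            using False \<open>i \<in> I\<close> \<open>z \<in> S\<close> unfolding J_def S_def by force
          ultimately have "\<forall>\<^sub>F t in at_right 0. a i \<bullet> (z + t *\<^sub>R d) < b i"
            by (rule order_tendstoD(2))
          then show ?thesis by (rule eventually_mono) simp
        qed
      qed
      then have "\<forall>\<^sub>F t in at_right (0::real). 0 < t \<and> z + t *\<^sub>R d \<in> S"
        using eventually_at_right_less[of "0::real"] by eventually_elim (auto simp: S_def)
      then obtain t :: real where "t > 0" "z + t *\<^sub>R d \<in> S"
        using eventually_happens trivial_limit_at_right_real by blast
      then have "(x - z) \<bullet> (z + t *\<^sub>R d - z) \<le> 0"
        unfolding z_def using closest_point_dot[OF \<open>convex S\<close> \<open>closed S\<close>] by blast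
      then show ?thesis using \<open>t > 0\<close> unfolding e_def by (simp add: mult_le_0_iff)
    qed
    have "norm e \<le> \<kappa> * (\<Sum>i\<in>I. max 0 (a i \<bullet> x - b i))"
    proof (cases "e = 0")
      case True
      then show ?thesis using \<open>\<kappa> > 0\<close> by (auto intro!: mult_nonneg_nonneg sum_nonneg)
    next
      case False
      have "e /\<^sub>R norm e \<in> N J"
        using False normal unfolding N_def
        by (auto simp: inner_commute divide_simps mult_le_0_iff)
      then have "\<mu> J \<le> (\<Sum>i\<in>J. max 0 (a i \<bullet> (e /\<^sub>R norm e)))"
        using \<mu>(2) \<open>J \<subseteq> I\<close> by blast
      also have "\<dots> = (\<Sum>i\<in>J. max 0 (a i \<bullet> e)) / norm e"
        unfolding sum_divide_distrib using False
      by (intro sum.cong refl) (auto simp: max_def divide_simps mult_le_0_iff zero_le_mult_iff)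
      finally have "norm e \<le> (1 / \<mu> J) * (\<Sum>i\<in>J. max 0 (a i \<bullet> e))"
        using False \<mu>(1)[OF \<open>J \<subseteq> I\<close>] by (simp add: field_simps)
      also have "(\<Sum>i\<in>J. max 0 (a i \<bullet> e)) = (\<Sum>i\<in>J. max 0 (a i \<bullet> x - b i))"
        by (intro sum.cong refl) (auto simp: J_def e_def inner_diff_right)
      also have "(1 / \<mu> J) * (\<Sum>i\<in>J. max 0 (a i \<bullet> x - b i)) \<le>
          \<kappa> * (\<Sum>i\<in>I. max 0 (a i \<bullet> x - b i))"
        using \<kappa>[OF \<open>J \<subseteq> I\<close>] \<open>\<kappa> > 0\<close> assms \<open>J \<subseteq> I\<close>
        by (intro mult_mono sum_mono2 sum_nonneg) auto
      finally show ?thesis .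
    qed
    then show ?thesis using \<open>z \<in> S\<close> unfolding S_def e_def by (auto intro!: exI[of _ z])
  qed
  ultimately show ?thesis by blast
qed

section \<open>Distances to polyhedra and their intersections\<close>

lemma hoffman_infdist:
  fixes F :: "('a::euclidean_space \<times> real) set"
  assumes "finite F" "S = {x. \<forall>p\<in>F. fst p \<bullet> x \<le> snd p}" "S \<noteq> {}"
  shows "\<exists>\<kappa>>0. \<forall>x. infdist x S \<le> \<kappa> * (\<Sum>p\<in>F. max 0 (fst p \<bullet> x - snd p))"
proof -
  obtain \<kappa> where \<kappa>: "\<kappa> > 0" "\<And>b x. (\<exists>z. \<forall>i\<in>F. fst i \<bullet> z \<le> b i) \<Longrightarrow>
    \<exists>z. (\<forall>i\<in>F. fst i \<bullet> z \<le> b i) \<and> norm (x - z) \<le> \<kappa> * (\<Sum>i\<in>F. max 0 (fst i \<bullet> x - b i))"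
    using hoffman[OF assms(1), of fst] by blast
  have "infdist x S \<le> \<kappa> * (\<Sum>p\<in>F. max 0 (fst p \<bullet> x - snd p))" for x
  proof -
    have "\<exists>z. \<forall>p\<in>F. fst p \<bullet> z \<le> snd p" using assms(2,3) by auto
    from \<kappa>(2)[OF this, of x] obtain z where z: "\<forall>p\<in>F. fst p \<bullet> z \<le> snd p"
        "norm (x - z) \<le> \<kappa> * (\<Sum>i\<in>F. max 0 (fst i \<bullet> x - snd i))"
      by blast
    have "z \<in> S" using z(1) assms(2) by simp
    then show ?thesis using z(2) by (intro infdist_le2[of z]) (simp_all add: dist_norm)
  qed
  with \<kappa>(1) show ?thesis by blast
qed

text \<open>The elementary converse of the bound of Hoffman. Together they replace constraint
  violations by distances to sets, so that the estimates no longer mention a particular system of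
  inequalities.\<close>

lemma halfspace_violation_le_infdist:
  fixes a :: "'a::euclidean_space"
  assumes "C \<noteq> {}" "\<And>z. z \<in> C \<Longrightarrow> a \<bullet> z \<le> b" "closed C"
  shows "max 0 (a \<bullet> x - b) \<le> norm a * infdist x C"
proof -
  obtain z where z: "z \<in> C" "infdist x C = dist x z"
    using infdist_attains_inf assms(1,3) by blast
  have "a \<bullet> x - b \<le> a \<bullet> (x - z)" using assms(2)[OF z(1)] by (simp add: inner_diff_right)
  also have "\<dots> \<le> norm a * norm (x - z)" by (rule norm_cauchy_schwarz)
  finally show ?thesis using z(2) by (simp add: dist_norm)
qed

text \<open>Linear regularity. It fails for closed convex sets in general, as two discs touching in
  one point show; for polyhedra, the violation of the joint system is at most a multiple of the sum
  of the two distances, and Hoffman's bound applies to it.\<close>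

lemma polyhedron_Int_infdist:
  fixes C D :: "'a::euclidean_space set"
  assumes C: "polyhedron C" and D: "polyhedron D" and ne: "C \<inter> D \<noteq> {}"
  shows "\<exists>\<kappa>>0. \<forall>x. infdist x (C \<inter> D) \<le> \<kappa> * (infdist x C + infdist x D)"
proof -
  obtain F :: "('a \<times> real) set" where F: "finite F" "C = {x. \<forall>p\<in>F. fst p \<bullet> x \<le> snd p}"
    by (rule polyhedron_inequalitiesE[OF C])
  obtain G :: "('a \<times> real) set" where G: "finite G" "D = {x. \<forall>p\<in>G. fst p \<bullet> x \<le> snd p}"
    by (rule polyhedron_inequalitiesE[OF D])
  have CD: "C \<inter> D = {x. \<forall>p\<in>F \<union> G. fst p \<bullet> x \<le> snd p}" using F G by auto
  obtain \<kappa> where \<kappa>: "\<kappa> > 0"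
      "\<And>x. infdist x (C \<inter> D) \<le> \<kappa> * (\<Sum>p\<in>F \<union> G. max 0 (fst p \<bullet> x - snd p))"
    using hoffman_infdist[OF _ CD ne] F(1) G(1) by auto
  \<comment> \<open>The summand \<open>1\<close> keeps \<open>M\<close> positive when there are no
    nonzero normals.\<close>
  define M where "M = (\<Sum>p\<in>F \<union> G. norm (fst p)) + 1"
  have "M > 0" unfolding M_def by (simp add: add_nonneg_pos sum_nonneg)
  have "infdist x (C \<inter> D) \<le> \<kappa> * M * (infdist x C + infdist x D)" for x
  proof -
    let ?r = "infdist x C + infdist x D"
    have r: "?r \<ge> 0" by (simp add: infdist_nonneg)
    have "max 0 (fst p \<bullet> x - snd p) \<le> norm (fst p) * ?r" if "p \<in> F \<union> G" for p
    proof -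
      have "max 0 (fst p \<bullet> x - snd p) \<le> norm (fst p) * infdist x C \<or>
            max 0 (fst p \<bullet> x - snd p) \<le> norm (fst p) * infdist x D"
        using halfspace_violation_le_infdist[of C "fst p" "snd p" x]
          halfspace_violation_le_infdist[of D "fst p" "snd p" x]
          that F(2) G(2) ne C D polyhedron_imp_closed by blast
      moreover have "norm (fst p) * infdist x C \<le> norm (fst p) * ?r"
          "norm (fst p) * infdist x D \<le> norm (fst p) * ?r"
        by (auto intro!: mult_left_mono simp: infdist_nonneg)
      ultimately show ?thesis by linarith
    qed
    then have "(\<Sum>p\<in>F \<union> G. max 0 (fst p \<bullet> x - snd p)) \<le> (\<Sum>p\<in>F \<union> G. norm (fst p) * ?r)"
      by (rule sum_mono)
    also have "\<dots> \<le> M * ?r"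
      using r unfolding M_def sum_distrib_right[symmetric] by (simp add: distrib_right)
    finally show ?thesis
      using \<kappa>(2)[of x] \<kappa>(1) by (smt (verit) mult.assoc mult_left_mono)
  qed
  then show ?thesis using \<kappa>(1) \<open>M > 0\<close> by (intro exI[of _ "\<kappa> * M"]) simp
qed

text \<open>The constraints of the preimage are those of \<open>C\<close> pulled back by the
  adjoint, and by \<open>shift\<close> their violations at \<open>x\<close> and at
  \<open>B x + b\<close> agree. The system is indexed by \<open>p\<close>, since the adjoint may
  send different normals to the same vector.\<close>

lemma polyhedron_preimage_infdist:
  fixes B :: "'a::euclidean_space \<Rightarrow> 'b::euclidean_space"
  assumes C: "polyhedron C" and B: "linear B" and ne: "{x. B x + b \<in> C} \<noteq> {}"
  shows "\<exists>\<kappa>>0. \<forall>x. infdist x {x. B x + b \<in> C} \<le> \<kappa> * infdist (B x + b) C"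
proof -
  obtain F :: "('b \<times> real) set" where F: "finite F" "C = {x. \<forall>p\<in>F. fst p \<bullet> x \<le> snd p}"
    by (rule polyhedron_inequalitiesE[OF C])
  let ?S = "{x. B x + b \<in> C}"
  have shift: "adjoint B (fst p) \<bullet> x - (snd p - fst p \<bullet> b) = fst p \<bullet> (B x + b) - snd p" for p x
    using adjoint_works[OF B, of x "fst p"] by (auto simp: inner_add_right inner_commute)
  obtain \<kappa> where \<kappa>: "\<kappa> > 0" "\<And>\<beta> x. (\<exists>z. \<forall>p\<in>F. adjoint B (fst p) \<bullet> z \<le> \<beta> p) \<Longrightarrow>
    \<exists>z. (\<forall>p\<in>F. adjoint B (fst p) \<bullet> z \<le> \<beta> p) \<and>
        norm (x - z) \<le> \<kappa> * (\<Sum>p\<in>F. max 0 (adjoint B (fst p) \<bullet> x - \<beta> p))"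
    using hoffman[OF F(1), of "\<lambda>p. adjoint B (fst p)"] by blast
  define M where "M = (\<Sum>p\<in>F. norm (fst p)) + 1"
  have "M > 0" unfolding M_def by (simp add: add_nonneg_pos sum_nonneg)
  have "infdist x ?S \<le> \<kappa> * M * infdist (B x + b) C" for x
  proof -
    let ?r = "infdist (B x + b) C"
    have S: "z \<in> ?S \<longleftrightarrow> (\<forall>p\<in>F. adjoint B (fst p) \<bullet> z \<le> snd p - fst p \<bullet> b)" for z
    proof -
      have "adjoint B (fst p) \<bullet> z \<le> snd p - fst p \<bullet> b \<longleftrightarrow> fst p \<bullet> (B z + b) \<le> snd p" for p
        using shift[of p z] by linarith
      then show ?thesis using F(2) by simp
    qed
    have "\<exists>z. \<forall>p\<in>F. adjoint B (fst p) \<bullet> z \<le> snd p - fst p \<bullet> b" using ne S by blast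
    from \<kappa>(2)[OF this, of x] obtain z where z: "z \<in> ?S"
        "norm (x - z) \<le> \<kappa> * (\<Sum>p\<in>F. max 0 (adjoint B (fst p) \<bullet> x - (snd p - fst p \<bullet> b)))"
      using S by blast
    have "(\<Sum>p\<in>F. max 0 (adjoint B (fst p) \<bullet> x - (snd p - fst p \<bullet> b))) \<le>
        (\<Sum>p\<in>F. norm (fst p) * ?r)"
      unfolding shift using halfspace_violation_le_infdist[of C] F(2) ne polyhedron_imp_closed[OF C]
      by (intro sum_mono) blast
    also have "\<dots> \<le> M * ?r"
      unfolding M_def sum_distrib_right[symmetric] by (simp add: distrib_right infdist_nonneg)
    finally have "norm (x - z) \<le> \<kappa> * M * ?r"
      using z(2) \<kappa>(1) by (smt (verit) mult.assoc mult_left_mono)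
    then show ?thesis using z(1) by (metis dist_norm infdist_le2)
  qed
  then show ?thesis using \<kappa>(1) \<open>M > 0\<close> by (intro exI[of _ "\<kappa> * M"]) simp
qed

text \<open>This fails for closed convex sets in general (the region above a branch of a hyperbola,
  and its asymptote), because nearest pairs may escape to infinity. Here, pairs with difference
  \<open>Y n - X n\<close> solve a linear system whose normals do not depend on \<open>n\<close>;
  the uniformity of Hoffman's bound yields such pairs at bounded distance from \<open>X 0\<close>,
  and compactness produces a common point.\<close>

lemma disjoint_polyhedra_apart:
  fixes C D :: "'a::euclidean_space set"
  assumes C: "polyhedron C" and D: "polyhedron D" and disj: "C \<inter> D = {}"
  shows "\<exists>\<delta>>0. \<forall>x\<in>C. \<forall>y\<in>D. \<delta> \<le> dist x y"
proof (rule ccontr)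
  assume "\<not> ?thesis"
  then have "\<forall>n. \<exists>x\<in>C. \<exists>y\<in>D. dist x y < 1 / real (Suc n)"
    by (metis linorder_not_less of_nat_0_less_iff zero_less_Suc zero_less_divide_1_iff)
  then obtain X Y where XY: "\<And>n. X n \<in> C" "\<And>n. Y n \<in> D" "\<And>n. dist (X n) (Y n) < 1 / real (Suc n)"
    by metis
  have e0: "(\<lambda>n. Y n - X n) \<longlonglongrightarrow> 0"
  proof (rule tendsto_norm_zero_cancel, rule tendsto_sandwich[OF _ _ tendsto_const])
    show "\<forall>\<^sub>F n in sequentially. norm (Y n - X n) \<le> inverse (real (Suc n))"
      using XY(3) by (intro always_eventually allI)
        (metis dist_commute dist_norm less_imp_le inverse_eq_divide)
  qed (use LIMSEQ_inverse_real_of_nat in auto)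
  obtain F :: "('a \<times> real) set" where F: "finite F" "C = {x. \<forall>p\<in>F. fst p \<bullet> x \<le> snd p}"
    by (rule polyhedron_inequalitiesE[OF C])
  obtain G :: "('a \<times> real) set" where G: "finite G" "D = {x. \<forall>p\<in>G. fst p \<bullet> x \<le> snd p}"
    by (rule polyhedron_inequalitiesE[OF D])
  \<comment> \<open>The sum type keeps the constraints of \<open>C\<close> and the shifted
    constraints of \<open>D\<close> apart; only the right-hand sides \<open>b n\<close> vary with
    \<open>n\<close>.\<close>
  define I :: "('a \<times> real + 'a \<times> real) set" where "I = F <+> G"
  define a :: "'a \<times> real + 'a \<times> real \<Rightarrow> 'a" where "a = case_sum fst (fst :: 'a \<times> real \<Rightarrow> 'a)"
  define b where "b n = case_sum (snd :: 'a \<times> real \<Rightarrow> real) (\<lambda>p. snd p - fst p \<bullet> (Y n - X n))" for n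
  have "finite I" unfolding I_def using F G by simp
  have system: "(\<forall>i\<in>I. a i \<bullet> z \<le> b n i) \<longleftrightarrow> z \<in> C \<and> z + (Y n - X n) \<in> D" for z n
  proof -
    have "(\<forall>i\<in>I. a i \<bullet> z \<le> b n i) \<longleftrightarrow> (\<forall>p\<in>F. a (Inl p) \<bullet> z \<le> b n (Inl p)) \<and>
        (\<forall>p\<in>G. a (Inr p) \<bullet> z \<le> b n (Inr p))"
      unfolding I_def by blast
    also have "\<dots> \<longleftrightarrow> z \<in> C \<and> z + (Y n - X n) \<in> D"
      unfolding a_def b_def F(2) G(2) by (simp add: inner_add_right le_diff_eq)
    finally show ?thesis .
  qed
  obtain \<kappa> where \<kappa>: "\<kappa> > 0" "\<And>b x. (\<exists>z. \<forall>i\<in>I. a i \<bullet> z \<le> b i) \<Longrightarrow>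
    \<exists>z. (\<forall>i\<in>I. a i \<bullet> z \<le> b i) \<and> norm (x - z) \<le> \<kappa> * (\<Sum>i\<in>I. max 0 (a i \<bullet> x - b i))"
    using hoffman[OF \<open>finite I\<close>, of a] by blast
  have "\<exists>z. z \<in> C \<and> z + (Y n - X n) \<in> D \<and>
      norm (X 0 - z) \<le> \<kappa> * (\<Sum>i\<in>I. max 0 (a i \<bullet> X 0 - b n i))" for n
  proof -
    have "\<exists>z. \<forall>i\<in>I. a i \<bullet> z \<le> b n i" using system[of "X n" n] XY(1,2)[of n] by auto
    from \<kappa>(2)[OF this, of "X 0"] show ?thesis unfolding system by blast
  qed
  then have "\<forall>n. \<exists>z. z \<in> C \<and> z + (Y n - X n) \<in> D \<and>
      norm (X 0 - z) \<le> \<kappa> * (\<Sum>i\<in>I. max 0 (a i \<bullet> X 0 - b n i))" by blast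
  from choice[OF this] obtain Z where Z: "\<And>n. Z n \<in> C" "\<And>n. Z n + (Y n - X n) \<in> D"
      "\<And>n. norm (X 0 - Z n) \<le> \<kappa> * (\<Sum>i\<in>I. max 0 (a i \<bullet> X 0 - b n i))"
    by blast
  \<comment> \<open>Convergence of the right-hand sides makes the bounds on
    \<open>norm (X 0 - Z n)\<close> a bounded sequence.\<close>
  have "(\<lambda>n. a i \<bullet> X 0 - b n i) \<longlonglongrightarrow> a i \<bullet> X 0 - case_sum snd snd i" for i :: "'a \<times> real + 'a \<times> real"
  proof (cases i)
    case (Inr p)
    have "(\<lambda>n. fst p \<bullet> X 0 - (snd p - fst p \<bullet> (Y n - X n))) \<longlonglongrightarrow>
        fst p \<bullet> X 0 - (snd p - fst p \<bullet> 0)"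
      by (intro tendsto_intros e0)
    then show ?thesis unfolding Inr a_def b_def by simp
  qed (auto simp: a_def b_def)
  then have "(\<lambda>n. \<kappa> * (\<Sum>i\<in>I. max 0 (a i \<bullet> X 0 - b n i))) \<longlonglongrightarrow>
      \<kappa> * (\<Sum>i\<in>I. max 0 (a i \<bullet> X 0 - case_sum snd snd i))"
    by (intro tendsto_mult tendsto_sum tendsto_max tendsto_const)
  then have "Bseq (\<lambda>n. \<kappa> * (\<Sum>i\<in>I. max 0 (a i \<bullet> X 0 - b n i)))"
    by (intro convergent_imp_Bseq convergentI)
  then obtain K where K: "\<And>n. norm (\<kappa> * (\<Sum>i\<in>I. max 0 (a i \<bullet> X 0 - b n i))) \<le> K"
    unfolding Bseq_def by blast
  have "Z n \<in> cball (X 0) K" for n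
    using Z(3)[of n] K[of n] by (auto simp: dist_norm)
  then obtain l r where lr: "strict_mono r" "(Z \<circ> r) \<longlonglongrightarrow> l"
    using compact_cball[of "X 0" K] unfolding compact_def by metis
  have "l \<in> C"
    using closed_sequentially[OF polyhedron_imp_closed[OF C] _ lr(2)] Z(1) by auto
  moreover have "(\<lambda>n. (Z \<circ> r) n + ((\<lambda>n. Y n - X n) \<circ> r) n) \<longlonglongrightarrow> l + 0"
    by (intro tendsto_add lr LIMSEQ_subseq_LIMSEQ[OF e0])
  then have "l \<in> D"
    using closed_sequentially[OF polyhedron_imp_closed[OF D], of "\<lambda>n. Z (r n) + (Y (r n) - X (r n))"] Z(2)
    by (auto simp: o_def)
  ultimately show False using disj by blast
qed

text \<open>A face of a union of polyhedra \<open>P\<close> is determined by its intersections with the sets \<open>P\<close>,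
  which are faces of \<open>P\<close>.\<close>

lemma polyhedron_finite_Union:
  fixes \<P> :: "'a::euclidean_space set set"
  assumes "finite \<P>" "\<And>P. P \<in> \<P> \<Longrightarrow> polyhedron P" "convex (\<Union>\<P>)"
  shows "polyhedron (\<Union>\<P>)"
proof -
  let ?\<F> = "\<Union>P\<in>\<P>. {F. F face_of P}"
  have "F \<in> Union ` Pow ?\<F>" if "F face_of \<Union>\<P>" for F
  proof -
    have "F \<inter> P face_of P" if "P \<in> \<P>" for P
      using face_of_slice[OF \<open>F face_of \<Union>\<P>\<close>, of P] that assms(2) polyhedron_imp_convex
      by (metis Int_absorb1 Union_upper)
    then have "(\<lambda>P. F \<inter> P) ` \<P> \<in> Pow ?\<F>" by blast
    moreover have "F = \<Union>((\<lambda>P. F \<inter> P) ` \<P>)"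
      using face_of_imp_subset[OF that] by blast
    ultimately show ?thesis by blast
  qed
  then have "{F. F face_of \<Union>\<P>} \<subseteq> Union ` Pow ?\<F>" by blast
  moreover have "finite ?\<F>"
    using assms by (intro finite_UN_I finite_polyhedron_faces)
  ultimately have "finite {F. F face_of \<Union>\<P>}"
    by (meson finite_Pow_iff finite_imageI finite_subset)
  moreover have "closed (\<Union>\<P>)"
    using assms by (intro closed_Union) (auto intro: polyhedron_imp_closed)
  ultimately show ?thesis using assms(3) polyhedron_eq_finite_faces by blast
qed

section \<open>Tangent cones, dual cones and generators\<close>

lemma polyhedron_tangent_cone:
  fixes P :: "'a::euclidean_space set"
  assumes "polyhedron P" "p \<in> P"
  obtains T \<epsilon> where "polyhedron T" "cone T" "\<epsilon> > 0" "\<And>x. x \<in> P \<Longrightarrow> x - p \<in> T"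
    "\<And>d. d \<in> T \<Longrightarrow> norm d \<le> \<epsilon> \<Longrightarrow> p + d \<in> P"
proof -
  obtain F :: "('a \<times> real) set" where F: "finite F" "P = {x. \<forall>q\<in>F. fst q \<bullet> x \<le> snd q}"
    by (rule polyhedron_inequalitiesE[OF assms(1)])
  \<comment> \<open>Only the constraints active at \<open>p\<close> enter \<open>T\<close>; the
    others are slack near \<open>p\<close>, so \<open>P\<close> and \<open>p + T\<close> coincide in
    a small ball.\<close>
  define J where "J = {q\<in>F. fst q \<bullet> p = snd q}"
  define T where "T = (\<Inter>q\<in>J. {d. fst q \<bullet> d \<le> 0})"
  have "finite J" using F(1) unfolding J_def by simp
  have "\<forall>\<^sub>F d in nhds 0. \<forall>q\<in>F - J. fst q \<bullet> (p + d) \<le> snd q"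
  proof (intro eventually_ball_finite ballI)
    fix q assume q: "q \<in> F - J"
    have "((\<lambda>d. fst q \<bullet> (p + d)) \<longlongrightarrow> fst q \<bullet> (p + 0)) (nhds 0)"
      by (intro tendsto_intros filterlim_ident)
    moreover have "fst q \<bullet> (p + 0) < snd q"
      using q assms(2) unfolding J_def F(2) by force
    ultimately have "\<forall>\<^sub>F d in nhds 0. fst q \<bullet> (p + d) < snd q"
      by (rule order_tendstoD(2))
    then show "\<forall>\<^sub>F d in nhds 0. fst q \<bullet> (p + d) \<le> snd q"
      by (rule eventually_mono) simp
  qed (use F in auto)
  then obtain \<epsilon> where "\<epsilon> > 0" and \<epsilon>: "\<And>d. norm d < \<epsilon> \<Longrightarrow> \<forall>q\<in>F - J. fst q \<bullet> (p + d) \<le> snd q"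
    unfolding eventually_nhds_metric by (metis dist_0_norm dist_commute)
  show ?thesis
  proof
    show "polyhedron T" unfolding T_def using \<open>finite J\<close>
      by (intro polyhedron_Inter) (auto simp: polyhedron_halfspace_le)
    show "cone T" unfolding T_def cone_def by (auto simp: mult_nonneg_nonpos)
    show "\<epsilon> / 2 > 0" using \<open>\<epsilon> > 0\<close> by simp
    show "x - p \<in> T" if "x \<in> P" for x
      using that unfolding T_def J_def F(2) by (auto simp: inner_diff_right)
    show "p + d \<in> P" if "d \<in> T" "norm d \<le> \<epsilon> / 2" for d
    proof -
      have "\<forall>q\<in>F - J. fst q \<bullet> (p + d) \<le> snd q" using \<epsilon>[of d] that(2) \<open>\<epsilon> > 0\<close> by simp
      moreover have "\<forall>q\<in>J. fst q \<bullet> (p + d) \<le> snd q"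
        using that(1) unfolding T_def J_def by (auto simp: inner_add_right)
      ultimately show ?thesis unfolding F(2) by blast
    qed
  qed
qed

text \<open>By homogeneity, the inequality need only be tested on \<open>T\<close> cut off by a
  cube. This is a polytope, so finitely many generating points suffice. In \<open>plq_upper\<close>,
  \<open>l\<close> is the gradient of a quadratic piece at \<open>x0\<close> and \<open>T\<close>
  the tangent cone of that piece.\<close>

lemma polyhedron_dual_cone:
  fixes T :: "'a::euclidean_space set"
  assumes "polyhedron T" "cone T"
  shows "polyhedron {s. \<forall>d\<in>T. s \<bullet> d \<le> l \<bullet> d}"
proof -
  have "polytope (T \<inter> cbox (-One) One)"
    using assms(1) by (simp add: polytope_eq_bounded_polyhedron bounded_Int)
  then obtain V where V: "finite V" "T \<inter> cbox (-One) One = convex hull V"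
    unfolding polytope_def by blast
  have "{s. \<forall>d\<in>T. s \<bullet> d \<le> l \<bullet> d} = (\<Inter>v\<in>V. {s. v \<bullet> s \<le> v \<bullet> l})"
  proof (intro equalityI subsetI)
    fix s assume "s \<in> {s. \<forall>d\<in>T. s \<bullet> d \<le> l \<bullet> d}"
    moreover have "V \<subseteq> T" using V(2) hull_subset[of V convex] by blast
    ultimately show "s \<in> (\<Inter>v\<in>V. {s. v \<bullet> s \<le> v \<bullet> l})" by (auto simp: inner_commute)
  next
    fix s assume s: "s \<in> (\<Inter>v\<in>V. {s. v \<bullet> s \<le> v \<bullet> l})"
    have "V \<subseteq> {d. (s - l) \<bullet> d \<le> 0}"
      using s by (auto simp: inner_commute[of "s - l"] inner_diff_right)
    then have hull: "convex hull V \<subseteq> {d. (s - l) \<bullet> d \<le> 0}"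
      using convex_halfspace_le by (rule hull_minimal)
    have "s \<bullet> d \<le> l \<bullet> d" if "d \<in> T" for d
    proof -
      define t where "t = 1 / (norm d + 1)"
      have "t > 0" unfolding t_def by (simp add: add_nonneg_pos)
      have "norm (t *\<^sub>R d) \<le> 1"
        unfolding t_def using norm_ge_zero[of d] by (simp add: divide_le_eq add_nonneg_pos)
      then have "\<bar>(t *\<^sub>R d) \<bullet> i\<bar> \<le> 1" if "i \<in> Basis" for i
        using Basis_le_norm[OF that, of "t *\<^sub>R d"] by linarith
      then have "t *\<^sub>R d \<in> cbox (-One) One"
        unfolding mem_box by (simp add: abs_le_iff)
      moreover have "t *\<^sub>R d \<in> T"
        using assms(2) \<open>d \<in> T\<close> \<open>t > 0\<close> unfolding cone_def by simp
      ultimately have "(s - l) \<bullet> (t *\<^sub>R d) \<le> 0" using hull V(2) by blast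
      then show ?thesis using \<open>t > 0\<close> by (simp add: inner_diff_left mult_le_0_iff algebra_simps)
    qed
    then show "s \<in> {s. \<forall>d\<in>T. s \<bullet> d \<le> l \<bullet> d}" by blast
  qed
  also have "polyhedron \<dots>"
    using V(1) by (intro polyhedron_Inter) (auto simp: polyhedron_halfspace_le)
  finally show ?thesis .
qed


text \<open>A weak form of the Minkowski--Weyl theorem: the points of \<open>V\<close> and the recession directions
  generate \<open>S\<close>. A line through a point of \<open>S\<close> that leaves \<open>S\<close> meets proper faces
  on which the induction hypothesis applies.\<close>

lemma polyhedron_generated:
  fixes S :: "'a::euclidean_space set"
  assumes "polyhedron S"
  shows "\<exists>V. finite V \<and> V \<subseteq> S \<and> (\<forall>W. V \<subseteq> W \<longrightarrow> convex W \<longrightarrow>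
    (\<forall>p\<in>W \<inter> S. \<forall>d. (\<forall>t\<ge>0. p + t *\<^sub>R d \<in> S) \<longrightarrow> p + d \<in> W) \<longrightarrow> S \<subseteq> W)"
  using assms
\<comment> \<open>The empty set has affine dimension -1, whence the shift by 1.\<close>
proof (induction "nat (aff_dim S + 1)" arbitrary: S rule: less_induct)
  case less
  show ?case
  proof (cases "affine S")
    case True
    show ?thesis
    proof (cases "S = {}")
      case False
      then obtain v where "v \<in> S" by blast
      \<comment> \<open>In an affine set every \<open>y - v\<close> is a recession direction, so the
        single point \<open>v\<close> generates.\<close>
      have line: "v + t *\<^sub>R (y - v) \<in> S" if "y \<in> S" for t y
        using mem_affine[OF True \<open>v \<in> S\<close> that, of "1 - t" t] by (simp add: algebra_simps)
      show ?thesis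
      proof (intro exI[of _ "{v}"] conjI allI impI subsetI)
        fix W y
        assume W: "{v} \<subseteq> W" "y \<in> S"
          "\<forall>p\<in>W \<inter> S. \<forall>d. (\<forall>t\<ge>0. p + t *\<^sub>R d \<in> S) \<longrightarrow> p + d \<in> W"
        have "v + (y - v) \<in> W" using W \<open>v \<in> S\<close> line[OF \<open>y \<in> S\<close>] by blast
        then show "y \<in> W" by simp
      qed (use \<open>v \<in> S\<close> in auto)
    qed auto
  next
    case False
    let ?\<F> = "{F. F face_of S \<and> F \<noteq> S}"
    have "convex S" "closed S"
      using less.prems by (auto intro: polyhedron_imp_convex polyhedron_imp_closed)
    have "\<forall>F\<in>?\<F>. \<exists>V. finite V \<and> V \<subseteq> F \<and> (\<forall>W. V \<subseteq> W \<longrightarrow> convex W \<longrightarrow>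
      (\<forall>p\<in>W \<inter> F. \<forall>d. (\<forall>t\<ge>0. p + t *\<^sub>R d \<in> F) \<longrightarrow> p + d \<in> W) \<longrightarrow> F \<subseteq> W)"
    proof
      fix F assume F: "F \<in> ?\<F>"
      then have "aff_dim F < aff_dim S"
        using face_of_aff_dim_lt[OF \<open>convex S\<close>] by blast
      then have "nat (aff_dim F + 1) < nat (aff_dim S + 1)"
        using aff_dim_geq[of F] by linarith
      moreover have "polyhedron F"
        using F less.prems face_of_polyhedron_polyhedron by blast
      ultimately show "\<exists>V. finite V \<and> V \<subseteq> F \<and> (\<forall>W. V \<subseteq> W \<longrightarrow> convex W \<longrightarrow>
        (\<forall>p\<in>W \<inter> F. \<forall>d. (\<forall>t\<ge>0. p + t *\<^sub>R d \<in> F) \<longrightarrow> p + d \<in> W) \<longrightarrow> F \<subseteq> W)"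
        by (rule less.hyps)
    qed
    from bchoice[OF this] obtain V where V0: "\<forall>F\<in>?\<F>. finite (V F) \<and> V F \<subseteq> F \<and>
      (\<forall>W. V F \<subseteq> W \<longrightarrow> convex W \<longrightarrow>
      (\<forall>p\<in>W \<inter> F. \<forall>d. (\<forall>t\<ge>0. p + t *\<^sub>R d \<in> F) \<longrightarrow> p + d \<in> W) \<longrightarrow> F \<subseteq> W)"
      by (rule exE)
    note V = bspec[OF V0]
    have "finite ?\<F>"
      using finite_polyhedron_faces[OF less.prems] by (rule rev_finite_subset) auto
    show ?thesis
    proof (intro exI[of _ "\<Union>(V ` ?\<F>)"] conjI allI impI)
      show "finite (\<Union>(V ` ?\<F>))" using V \<open>finite ?\<F>\<close> by blast
      show "\<Union>(V ` ?\<F>) \<subseteq> S" using V face_of_imp_subset by blast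
    next
      fix W
      assume W: "\<Union>(V ` ?\<F>) \<subseteq> W" "convex W"
        and recession: "\<forall>p\<in>W \<inter> S. \<forall>d. (\<forall>t\<ge>0. p + t *\<^sub>R d \<in> S) \<longrightarrow> p + d \<in> W"
      have faces: "F \<subseteq> W" if "F \<in> ?\<F>" for F
      proof -
        have "V F \<subseteq> W" using W(1) that by blast
        moreover have "\<forall>p\<in>W \<inter> F. \<forall>d. (\<forall>t\<ge>0. p + t *\<^sub>R d \<in> F) \<longrightarrow> p + d \<in> W"
          using recession that face_of_imp_subset[of F S] by blast
        ultimately show ?thesis using V[OF that] W(2) by blast
      qed
      then have frontier: "rel_frontier S \<subseteq> W"
        unfolding rel_frontier_of_polyhedron_alt[OF less.prems] by blast
      show "S \<subseteq> W"
      proof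
        fix y assume "y \<in> S"
        \<comment> \<open>A set that is not affine misses some point \<open>q\<close> of its affine
          hull; \<open>q\<close> determines the line to be drawn through \<open>y\<close>.\<close>
        obtain c d s where cd: "c \<in> S" "d \<in> S" "(1 - s) *\<^sub>R c + s *\<^sub>R d \<notin> S"
          using False affine_alt[of S] by blast
        define q where "q = (1 - s) *\<^sub>R c + s *\<^sub>R d"
        have q: "q \<in> affine hull S" "q \<notin> S"
          using mem_affine[OF affine_affine_hull, of c S d "1 - s" s] cd hull_subset[of S affine]
          unfolding q_def by auto
        \<comment> \<open>Otherwise the segment would be covered by two open sets that are disjoint
          on it, one cutting out the relative interior and the other the complement of
          \<open>S\<close>, against connectedness.\<close>
        have crossing: "\<exists>r\<in>{0..1}. y + r *\<^sub>R (z - y) \<in> rel_frontier S"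
          if "z \<in> affine hull S" "z \<notin> S" for z
        proof -
          have "closed_segment y z \<inter> rel_frontier S \<noteq> {}"
          proof
            assume disj: "closed_segment y z \<inter> rel_frontier S = {}"
            have sub: "closed_segment y z \<subseteq> affine hull S"
              using that \<open>y \<in> S\<close> affine_imp_convex[OF affine_affine_hull]
              by (intro closed_segment_subset) (auto intro: hull_inc)
            obtain U where U: "open U" "rel_interior S = affine hull S \<inter> U"
              using openin_rel_interior[of S] unfolding openin_open by blast
            have front: "rel_frontier S = S - rel_interior S"
              using \<open>closed S\<close> unfolding rel_frontier_def by simp
            have "open (- S)" using \<open>closed S\<close> by blast
            moreover have "U \<inter> - S \<inter> closed_segment y z = {}"
              using sub U(2) rel_interior_subset[of S] by blast
            moreover have "closed_segment y z \<subseteq> U \<union> - S"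
              using disj sub U(2) front by blast
            moreover have "y \<in> U" using disj \<open>y \<in> S\<close> U(2) front ends_in_segment(1)[of y z] by blast
            ultimately show False
              using connectedD[OF connected_segment(1)[of y z] U(1), of "- S"] that(2) by auto
          qed
          then obtain r where r: "0 \<le> r" "r \<le> 1" "(1 - r) *\<^sub>R y + r *\<^sub>R z \<in> rel_frontier S"
            by (auto simp: in_segment)
          then show ?thesis by (intro bexI[of _ r]) (simp_all add: algebra_simps)
        qed
        obtain r where r: "0 \<le> r" "y + r *\<^sub>R (q - y) \<in> rel_frontier S"
          using crossing[OF q] by auto
        define p where "p = y + r *\<^sub>R (q - y)"
        have "p \<in> W" "p \<in> S"
          using r(2) frontier \<open>closed S\<close> unfolding p_def rel_frontier_def by auto
        \<comment> \<open>Towards \<open>q\<close> the line meets the relative frontier at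
          \<open>p\<close>. If it never leaves \<open>S\<close> on the other side,
          \<open>y - p\<close> is a recession direction at \<open>p\<close>; otherwise
          \<open>y\<close> lies between two points of the relative frontier, and convexity of
          \<open>W\<close> suffices.\<close>
        show "y \<in> W"
        proof (cases "\<forall>t\<ge>0. y - t *\<^sub>R (q - y) \<in> S")
          case True
          have "p + t *\<^sub>R (y - p) \<in> S" if "t \<ge> 0" for t
          proof (cases "t \<le> 1")
            case True
            then have "(1 - t) *\<^sub>R p + t *\<^sub>R y \<in> S"
              using \<open>convex S\<close> \<open>p \<in> S\<close> \<open>y \<in> S\<close> that by (simp add: convexD)
            then show ?thesis by (simp add: algebra_simps)
          next
            case False
            then have "y - ((t - 1) * r) *\<^sub>R (q - y) \<in> S" using True r(1) by simp
            then show ?thesis unfolding p_def by (simp add: algebra_simps)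
          qed
          then have "p + (y - p) \<in> W" using recession \<open>p \<in> W\<close> \<open>p \<in> S\<close> by blast
          then show ?thesis by simp
        next
          case False
          then obtain t where t: "t \<ge> 0" "y - t *\<^sub>R (q - y) \<notin> S" by blast
          define q' where "q' = y - t *\<^sub>R (q - y)"
          have "q' = (1 + t) *\<^sub>R y + (- t) *\<^sub>R q" unfolding q'_def by (simp add: algebra_simps)
          then have "q' \<in> affine hull S"
            using mem_affine[OF affine_affine_hull, of y S q "1 + t" "- t"] q(1) \<open>y \<in> S\<close>
            by (auto intro: hull_inc)
          then obtain r' where r': "0 \<le> r'" "y + r' *\<^sub>R (q' - y) \<in> rel_frontier S"
            using crossing t(2) q'_def by force
          define p' where "p' = y + r' *\<^sub>R (q' - y)"
          have "p' \<in> W" using r'(2) frontier unfolding p'_def by blast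
          have p': "p' = y - (r' * t) *\<^sub>R (q - y)" unfolding p'_def q'_def by simp
          show ?thesis
          proof (cases "r + r' * t = 0")
            case True
            then have "r = 0" using r(1) r'(1) t(1) by (simp add: add_nonneg_eq_0_iff)
            then show ?thesis using \<open>p \<in> W\<close> unfolding p_def by simp
          next
            case False
            then have pos: "r + r' * t > 0"
              using r(1) r'(1) t(1) by (smt (verit) mult_nonneg_nonneg)
            \<comment> \<open>The weight for which the opposite displacements of \<open>p\<close>
              and \<open>p'\<close> along \<open>q - y\<close> cancel.\<close>
            let ?k = "r / (r + r' * t)"
            have k: "0 \<le> ?k" "?k \<le> 1"
              using pos r(1) r'(1) t(1) by auto
            have "(1 - ?k) * r - ?k * (r' * t) = r - ?k * (r + r' * t)"
              by (simp only: left_diff_distrib distrib_left mult_1)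
            also have "\<dots> = 0" using pos by simp
            finally have k0: "(1 - ?k) * r - ?k * (r' * t) = 0" .
            have "(1 - l) *\<^sub>R p + l *\<^sub>R p' = y + ((1 - l) * r - l * (r' * t)) *\<^sub>R (q - y)" for l
              unfolding p' p_def by (simp add: algebra_simps)
            then have "y = (1 - ?k) *\<^sub>R p + ?k *\<^sub>R p'" using k0 by simp
            then show ?thesis
              using convexD[OF W(2) \<open>p \<in> W\<close> \<open>p' \<in> W\<close>, of "1 - ?k" ?k] k by simp
          qed
        qed
      qed
    qed
  qed
qed

section \<open>Quadratic functions on polyhedra\<close>

lemma quadratic_fun_expansion:
  fixes q :: "'a::euclidean_space \<Rightarrow> real"
  assumes "quadratic_fun q"
  obtains Q l where "linear Q" "\<And>x y. Q x \<bullet> y = x \<bullet> Q y"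
    "\<And>s d. q (s + d) = q s + l s \<bullet> d + 1/2 * (Q d \<bullet> d)"
proof -
  obtain Q b c where Q: "linear Q" "\<And>x y. Q x \<bullet> y = x \<bullet> Q y"
      "\<And>x. q x = 1/2 * (Q x \<bullet> x) + b \<bullet> x + c"
    using assms unfolding quadratic_fun_def by blast
  have "q (s + d) = q s + (Q s + b) \<bullet> d + 1/2 * (Q d \<bullet> d)" for s d
    unfolding Q(3) linear_add[OF Q(1)] using Q(2)[of s d]
    by (simp add: inner_add_left inner_add_right inner_commute algebra_simps)
  then show ?thesis by (rule that[OF Q(1,2)])
qed

lemma quadratic_fun_diff_affine:
  assumes "quadratic_fun q"
  shows "quadratic_fun (\<lambda>x. q x - y \<bullet> (x - x0) - a)"
proof -
  obtain Q b c where Q: "linear Q" "\<forall>x y. Q x \<bullet> y = x \<bullet> Q y"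
      "\<forall>x. q x = 1/2 * (Q x \<bullet> x) + b \<bullet> x + c"
    using assms unfolding quadratic_fun_def by blast
  have "\<forall>x. q x - y \<bullet> (x - x0) - a = 1/2 * (Q x \<bullet> x) + (b - y) \<bullet> x + (c + y \<bullet> x0 - a)"
    using Q(3) by (simp add: inner_diff_left inner_diff_right)
  with Q(1,2) show ?thesis unfolding quadratic_fun_def by blast
qed

lemma quadratic_fun_continuous:
  fixes q :: "'a::euclidean_space \<Rightarrow> real"
  assumes "quadratic_fun q"
  shows "continuous_on S q"
proof -
  obtain Q b c where Q: "linear Q" "\<And>x. q x = 1/2 * (Q x \<bullet> x) + b \<bullet> x + c"
    using assms unfolding quadratic_fun_def by blast
  have "continuous_on S (\<lambda>x. 1/2 * (Q x \<bullet> x) + b \<bullet> x + c)"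
    by (intro continuous_intros linear_continuous_on linear_conv_bounded_linear[THEN iffD1] Q(1))
  then show ?thesis unfolding Q(2)[symmetric] .
qed

lemma quadratic_fun_remainder:
  fixes q :: "'a::euclidean_space \<Rightarrow> real"
  assumes "quadratic_fun q"
  obtains l C where "C \<ge> 0" "\<And>d. \<bar>q (s + d) - q s - l \<bullet> d\<bar> \<le> C * (norm d)\<^sup>2"
proof -
  obtain Q l where Q: "linear Q" "\<And>s d. q (s + d) = q s + l s \<bullet> d + 1/2 * (Q d \<bullet> d)"
    using quadratic_fun_expansion[OF assms] by metis
  obtain B where B: "B > 0" "\<And>d. norm (Q d) \<le> B * norm d"
    using linear_bounded_pos[OF Q(1)] by blast
  have "\<bar>q (s + d) - q s - l s \<bullet> d\<bar> \<le> (B / 2) * (norm d)\<^sup>2" for d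
  proof -
    have "\<bar>Q d \<bullet> d\<bar> \<le> norm (Q d) * norm d" by (rule Cauchy_Schwarz_ineq2)
    also have "\<dots> \<le> (B * norm d) * norm d" by (rule mult_right_mono[OF B(2)]) simp
    finally show ?thesis unfolding Q(2) by (simp add: power2_eq_square)
  qed
  then show ?thesis using B(1) by (intro that[of "B / 2"]) auto
qed

text \<open>Serves to derive a Cauchy--Schwarz inequality for a form that may be degenerate, so
  \<open>c = 0\<close> has to be covered. For \<open>c > 0\<close> the vertex of the parabola
  decides; \<open>c < 0\<close> is impossible because the linear terms at \<open>t\<close> and
  \<open>- t\<close> cancel.\<close>

lemma nonneg_quadratic_discriminant:
  fixes a b c :: real
  assumes "\<And>t. a + 2 * t * b + t\<^sup>2 * c \<ge> 0"
  shows "b\<^sup>2 \<le> a * c"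
proof (cases "c = 0")
  case True
  have "b = 0"
  proof (rule ccontr)
    assume "b \<noteq> 0"
    then have "2 * (- (a + 1) / (2 * b)) * b = - (a + 1)" by simp
    then show False using assms[of "- (a + 1) / (2 * b)"] unfolding True by linarith
  qed
  then show ?thesis using True by simp
next
  case False
  have "c > 0"
  proof (rule ccontr)
    assume "\<not> c > 0"
    then have "c < 0" using False by simp
    have "a + 2 * t * b + t\<^sup>2 * c + (a + 2 * (-t) * b + (-t)\<^sup>2 * c) = 2 * (a + t\<^sup>2 * c)" for t
      by simp
    then have ge: "a + t\<^sup>2 * c \<ge> 0" for t
      using assms[of t] assms[of "- t"] by (smt (verit))
    have "(sqrt ((\<bar>a\<bar> + 1) / (- c)))\<^sup>2 * c = - (\<bar>a\<bar> + 1)"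
      using \<open>c < 0\<close> by (simp add: real_sqrt_pow2 divide_simps)
    then show False using ge[of "sqrt ((\<bar>a\<bar> + 1) / (- c))"] by linarith
  qed
  then show ?thesis
    using assms[of "- b / c"] by (simp add: field_simps power2_eq_square)
qed

text \<open>No rate better than quadratic near 0 and linear at infinity can be expected: the Huber
  function, itself convex and piecewise linear-quadratic, grows in this way around its
  minimizer.\<close>

definition huber :: "real \<Rightarrow> real" where
  "huber r = min r (r\<^sup>2)"

lemma huber_nonneg: "r \<ge> 0 \<Longrightarrow> huber r \<ge> 0"
  unfolding huber_def by simp

lemma huber_le: "huber r \<le> r" "huber r \<le> r\<^sup>2"
  unfolding huber_def by simp_all

lemma huber_mono: "0 \<le> r \<Longrightarrow> r \<le> s \<Longrightarrow> huber r \<le> huber s"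
  unfolding huber_def by (intro min.mono power_mono)

text \<open>Along the span of \<open>P - s0\<close> the quadratic form \<open>Q\<close> is positive semidefinite, so its zeros
  there are cut out by linear equations. By the bound of Hoffman, the distance to the zero set of
  \<open>q\<close> is then controlled by the linear part plus the square root of the quadratic part of \<open>q\<close>.\<close>

lemma quadratic_growth_on_polyhedron:
  fixes q :: "'a::euclidean_space \<Rightarrow> real"
  assumes P: "polyhedron P" and q: "quadratic_fun q" and convex: "convex_on P q"
    and nonneg: "\<And>x. x \<in> P \<Longrightarrow> q x \<ge> 0" and s0: "s0 \<in> P" "q s0 = 0"
  shows "polyhedron {x\<in>P. q x = 0}"
    and "\<exists>c>0. \<forall>x\<in>P. c * huber (infdist x {x\<in>P. q x = 0}) \<le> q x"
proof -
  obtain Q l where Q: "linear Q" "\<And>x y. Q x \<bullet> y = x \<bullet> Q y"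
      "\<And>s d. q (s + d) = q s + l s \<bullet> d + 1/2 * (Q d \<bullet> d)"
    using quadratic_fun_expansion[OF q] by metis
  note lin = linear_add[OF Q(1)] linear_diff[OF Q(1)] linear_scale[OF Q(1)]
  have "convex P" using P by (rule polyhedron_imp_convex)
  define D where "D = (\<lambda>x. x - s0) ` P"
  have scale: "Q (t *\<^sub>R d) \<bullet> (t *\<^sub>R d) = t\<^sup>2 * (Q d \<bullet> d)" for t d
    by (simp add: lin power2_eq_square)
  \<comment> \<open>In the midpoint convexity inequality, the linear terms of the two expansions at
    the midpoint cancel and only the quadratic form is left.\<close>
  have diff: "Q (x - y) \<bullet> (x - y) \<ge> 0" if "x \<in> P" "y \<in> P" for x y
  proof -
    let ?m = "(1/2) *\<^sub>R x + (1/2) *\<^sub>R y" and ?e = "(1/2) *\<^sub>R (x - y)"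
    have "q ?m \<le> 1/2 * q x + 1/2 * q y"
      using convex_onD[OF convex, of "1/2" x y] that by simp
    moreover have "q x = q ?m + l ?m \<bullet> ?e + 1/2 * (Q ?e \<bullet> ?e)"
      unfolding Q(3)[symmetric] by (simp add: algebra_simps flip: scaleR_add_left)
    moreover have "q y = q ?m + l ?m \<bullet> (- ?e) + 1/2 * (Q (- ?e) \<bullet> (- ?e))"
      unfolding Q(3)[symmetric] by (simp add: algebra_simps flip: scaleR_add_left)
    then have "q y = q ?m - l ?m \<bullet> ?e + 1/2 * (Q ?e \<bullet> ?e)"
      unfolding linear_neg[OF Q(1)] by simp
    moreover have "X \<ge> 0" if "m \<le> 1/2 * qx + 1/2 * qy" "qx = m + L + 1/2 * X" "qy = m - L + 1/2 * X"
      for m qx qy L X :: real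
      using that by linarith
    ultimately have "Q ?e \<bullet> ?e \<ge> 0" by blast
    then have "(1/2)\<^sup>2 * (Q (x - y) \<bullet> (x - y)) \<ge> 0" unfolding scale .
    then show ?thesis by (simp add: zero_le_mult_iff)
  qed
  \<comment> \<open>Every \<open>u + t *\<^sub>R v\<close> is a multiple of a difference of two
    points of \<open>P\<close>; the three ranges of \<open>t\<close> correspond to the
    rearrangements with nonnegative weights, in which \<open>s0\<close> fills up the convex
    combinations.\<close>
  have psd: "Q (u + t *\<^sub>R v) \<bullet> (u + t *\<^sub>R v) \<ge> 0" if "u \<in> D" "v \<in> D" for u v t
  proof -
    obtain x y where xy: "x \<in> P" "u = x - s0" "y \<in> P" "v = y - s0"
      using \<open>u \<in> D\<close> \<open>v \<in> D\<close> unfolding D_def by blast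
    have comb: "(1 - r) *\<^sub>R s0 + r *\<^sub>R z \<in> P" if "z \<in> P" "0 \<le> r" "r \<le> 1" for z r
      using \<open>convex P\<close> s0(1) that by (simp add: convexD)
    consider "t \<ge> 0" | "-1 \<le> t" "t \<le> 0" | "t < -1" by linarith
    then show ?thesis
    proof cases
      case 1
      have "(1 / (1 + t)) *\<^sub>R x + (t / (1 + t)) *\<^sub>R y \<in> P"
        using 1 xy by (intro convexD[OF \<open>convex P\<close>]) (auto simp: add_divide_distrib[symmetric])
      from diff[OF this s0(1)]
      have "Q ((1 + t) *\<^sub>R ((1 / (1 + t)) *\<^sub>R x + (t / (1 + t)) *\<^sub>R y - s0)) \<bullet>
          ((1 + t) *\<^sub>R ((1 / (1 + t)) *\<^sub>R x + (t / (1 + t)) *\<^sub>R y - s0)) \<ge> 0"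
        unfolding scale by simp
      also have "(1 + t) *\<^sub>R ((1 / (1 + t)) *\<^sub>R x + (t / (1 + t)) *\<^sub>R y - s0) = u + t *\<^sub>R v"
        using 1 unfolding xy by (simp add: scaleR_add_right scaleR_diff_right scaleR_add_left)
      finally show ?thesis .
    next
      case 2
      have "u + t *\<^sub>R v = x - ((1 - (- t)) *\<^sub>R s0 + (- t) *\<^sub>R y)"
        unfolding xy by (simp add: algebra_simps)
      then show ?thesis using diff[OF xy(1) comb[OF xy(3), of "- t"]] 2 by simp
    next
      case 3
      have "u + t *\<^sub>R v = t *\<^sub>R (y - ((1 - (- 1 / t)) *\<^sub>R s0 + (- 1 / t) *\<^sub>R x))"
        using 3 unfolding xy by (simp add: algebra_simps)
      moreover have "Q (y - ((1 - (- 1 / t)) *\<^sub>R s0 + (- 1 / t) *\<^sub>R x)) \<bullet>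
          (y - ((1 - (- 1 / t)) *\<^sub>R s0 + (- 1 / t) *\<^sub>R x)) \<ge> 0"
        using 3 by (intro diff xy comb) (auto simp: divide_simps)
      ultimately show ?thesis by (simp only: scale mult_nonneg_nonneg zero_le_power2)
    qed
  qed
  have cauchy_schwarz: "(Q v \<bullet> u)\<^sup>2 \<le> (Q u \<bullet> u) * (Q v \<bullet> v)" if "u \<in> D" "v \<in> D" for u v
  proof -
    have "Q u \<bullet> u + 2 * t * (Q v \<bullet> u) + t\<^sup>2 * (Q v \<bullet> v) = Q (u + t *\<^sub>R v) \<bullet> (u + t *\<^sub>R v)" for t
      using Q(2)[of u v] by (simp add: lin inner_add_left inner_add_right inner_commute
          power2_eq_square algebra_simps)
    then show ?thesis using nonneg_quadratic_discriminant psd[OF that] by simp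
  qed
  have quad_nonneg: "Q u \<bullet> u \<ge> 0" if "u \<in> D" for u
    using psd[OF that that, of 0] by simp
  have linear_nonneg: "l s0 \<bullet> d \<ge> 0" if "d \<in> D" for d
  proof (rule ccontr)
    assume neg: "\<not> l s0 \<bullet> d \<ge> 0"
    obtain x where x: "x \<in> P" "d = x - s0" using \<open>d \<in> D\<close> unfolding D_def by blast
    have along: "t * (l s0 \<bullet> d) + 1/2 * (t\<^sup>2 * (Q d \<bullet> d)) \<ge> 0" if "0 \<le> t" "t \<le> 1" for t
    proof -
      have "s0 + t *\<^sub>R d = (1 - t) *\<^sub>R s0 + t *\<^sub>R x" unfolding x by (simp add: algebra_simps)
      then have "q (s0 + t *\<^sub>R d) \<ge> 0"
        using \<open>convex P\<close> s0(1) x(1) that nonneg by (simp add: convexD)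
      then show ?thesis unfolding Q(3) scale s0(2) by simp
    qed
    \<comment> \<open>Short enough for the quadratic term to consume at most half of the linear
      decrease; the \<open>1\<close> in the denominator covers
      \<open>Q d \<bullet> d = 0\<close>.\<close>
    define t where "t = min 1 (- (l s0 \<bullet> d) / (Q d \<bullet> d + 1))"
    have t: "0 < t" "t \<le> 1" "t * (Q d \<bullet> d) \<le> - (l s0 \<bullet> d)"
    proof -
      show "0 < t" using neg quad_nonneg[OF that] unfolding t_def by (auto intro!: divide_pos_pos simp del: minus_divide_left divide_minus_left)
      then have "t * (Q d \<bullet> d) \<le> t * (Q d \<bullet> d + 1)" by simp
      also have "\<dots> \<le> - (l s0 \<bullet> d) / (Q d \<bullet> d + 1) * (Q d \<bullet> d + 1)"
        unfolding t_def using quad_nonneg[OF that] by (intro mult_right_mono) auto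
      also have "\<dots> = - (l s0 \<bullet> d)" using quad_nonneg[OF that] by simp
      finally show "t * (Q d \<bullet> d) \<le> - (l s0 \<bullet> d)" .
    qed (simp add: t_def)
    have "t * (l s0 \<bullet> d) + 1/2 * (t\<^sup>2 * (Q d \<bullet> d)) = t * (l s0 \<bullet> d + 1/2 * (t * (Q d \<bullet> d)))"
      by (simp add: power2_eq_square algebra_simps)
    also have "\<dots> < 0"
    proof (rule mult_pos_neg[OF t(1)])
      have "1/2 * (t * (Q d \<bullet> d)) \<le> 1/2 * (- (l s0 \<bullet> d))" using t(3) by linarith
      then show "l s0 \<bullet> d + 1/2 * (t * (Q d \<bullet> d)) < 0" using neg by linarith
    qed
    finally show False using along[of t] t by simp
  qed
  \<comment> \<open>For \<open>d\<close> in \<open>D\<close>, semidefiniteness makes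
    \<open>Q d \<bullet> d = 0\<close> equivalent to \<open>Q v \<bullet> d = 0\<close> for all
    \<open>v\<close> in \<open>D\<close>, hence for the finitely many \<open>v\<close> in a basis of
    the span.\<close>
  obtain B where B: "B \<subseteq> D" "independent B" "D \<subseteq> span B"
    using maximal_independent_subset by blast
  have "finite B" using B(2) by (rule independent_imp_finite)
  obtain F :: "('a \<times> real) set" where F: "finite F" "P = {x. \<forall>p\<in>F. fst p \<bullet> x \<le> snd p}"
    by (rule polyhedron_inequalitiesE[OF P])
  \<comment> \<open>Equations appear as pairs of inequalities. For the linear part one inequality is
    enough, as it is nonnegative on \<open>D\<close>.\<close>
  define G where "G = insert (l s0, l s0 \<bullet> s0)
    ((\<lambda>v. (Q v, Q v \<bullet> s0)) ` B \<union> (\<lambda>v. (- Q v, - Q v \<bullet> s0)) ` B)"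
  let ?Z = "{x\<in>P. q x = 0}"
  have Z: "?Z = {x. \<forall>p\<in>F \<union> G. fst p \<bullet> x \<le> snd p}"
  proof (intro equalityI subsetI)
    fix x assume x: "x \<in> ?Z"
    define d where "d = x - s0"
    have "d \<in> D" using x unfolding d_def D_def by blast
    have "l s0 \<bullet> d + 1/2 * (Q d \<bullet> d) = 0"
      using Q(3)[of s0 d] s0(2) x unfolding d_def by simp
    then have zero: "l s0 \<bullet> d = 0" "Q d \<bullet> d = 0"
      using linear_nonneg[OF \<open>d \<in> D\<close>] quad_nonneg[OF \<open>d \<in> D\<close>] by linarith+
    have "Q v \<bullet> d = 0" if "v \<in> B" for v
    proof -
      have "(Q v \<bullet> d)\<^sup>2 \<le> 0"
        using cauchy_schwarz[OF \<open>d \<in> D\<close>, of v] subsetD[OF B(1) that] zero(2) by simp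
      then show ?thesis by simp
    qed
    then show "x \<in> {x. \<forall>p\<in>F \<union> G. fst p \<bullet> x \<le> snd p}"
      using x zero(1) F(2) unfolding G_def d_def by (auto simp: inner_diff_right)
  next
    fix x assume x: "x \<in> {x. \<forall>p\<in>F \<union> G. fst p \<bullet> x \<le> snd p}"
    define d where "d = x - s0"
    have "x \<in> P" using x F(2) by blast
    then have "d \<in> D" unfolding d_def D_def by blast
    have "l s0 \<bullet> d = 0"
      using x linear_nonneg[OF \<open>d \<in> D\<close>] unfolding G_def d_def by (auto simp: inner_diff_right)
    moreover have "Q v \<bullet> d = 0" if "v \<in> B" for v
    proof -
      have "(Q v, Q v \<bullet> s0) \<in> F \<union> G" "(- Q v, - Q v \<bullet> s0) \<in> F \<union> G"
        using that unfolding G_def by auto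
      then have "Q v \<bullet> x \<le> Q v \<bullet> s0" "- Q v \<bullet> x \<le> - Q v \<bullet> s0"
        using bspec[OF CollectD[OF x]] by (metis fst_conv snd_conv)+
      then show ?thesis unfolding d_def by (simp add: inner_diff_right)
    qed
    then have "B \<subseteq> {w. Q d \<bullet> w = 0}" using Q(2) by (auto simp: inner_commute)
    then have "span B \<subseteq> {w. Q d \<bullet> w = 0}" using subspace_hyperplane by (rule span_minimal)
    then have "Q d \<bullet> d = 0" using \<open>d \<in> D\<close> B(3) by blast
    ultimately have "q (s0 + d) = 0" unfolding Q(3) s0(2) by simp
    then show "x \<in> ?Z" using \<open>x \<in> P\<close> unfolding d_def by simp
  qed
  have "finite (F \<union> G)" using F(1) \<open>finite B\<close> unfolding G_def by simp
  then show "polyhedron ?Z"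
    unfolding polyhedron_finite_inequalities using Z by (intro exI[of _ "F \<union> G"] conjI)
  have "?Z \<noteq> {}" using s0 by blast
  obtain \<kappa> where \<kappa>: "\<kappa> > 0"
      "\<And>x. infdist x ?Z \<le> \<kappa> * (\<Sum>p\<in>F \<union> G. max 0 (fst p \<bullet> x - snd p))"
    using hoffman_infdist[OF \<open>finite (F \<union> G)\<close> Z \<open>?Z \<noteq> {}\<close>] by blast
  define M where "M = 1 + (\<Sum>v\<in>B. sqrt (Q v \<bullet> v))"
  have sum_nonneg_B: "(\<Sum>v\<in>B. sqrt (Q v \<bullet> v)) \<ge> 0"
    using B(1) quad_nonneg by (intro sum_nonneg) auto
  then have "M \<ge> 1" unfolding M_def by simp
  define K where "K = \<kappa> * real (card (F \<union> G)) * M"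
  have "K \<ge> 0" unfolding K_def using \<kappa>(1) \<open>M \<ge> 1\<close> by simp
  have bound: "infdist x ?Z \<le> K * (l s0 \<bullet> (x - s0) + sqrt (Q (x - s0) \<bullet> (x - s0)))" if "x \<in> P" for x
  proof -
    define d where "d = x - s0"
    have "d \<in> D" using that unfolding d_def D_def by blast
    let ?r = "l s0 \<bullet> d + sqrt (Q d \<bullet> d)"
    have a: "l s0 \<bullet> d \<ge> 0" and b: "sqrt (Q d \<bullet> d) \<ge> 0"
      using linear_nonneg[OF \<open>d \<in> D\<close>] quad_nonneg[OF \<open>d \<in> D\<close>] by auto
    have Mr: "M * (l s0 \<bullet> d) \<ge> l s0 \<bullet> d" "M * sqrt (Q d \<bullet> d) \<ge> 0"
      using a b \<open>M \<ge> 1\<close> mult_right_mono[of 1 M "l s0 \<bullet> d"] by simp_all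
    have eq: "\<bar>Q v \<bullet> d\<bar> \<le> M * sqrt (Q d \<bullet> d)" if "v \<in> B" for v
    proof -
      have "\<bar>Q v \<bullet> d\<bar> = sqrt ((Q v \<bullet> d)\<^sup>2)" by simp
      also have "\<dots> \<le> sqrt ((Q d \<bullet> d) * (Q v \<bullet> v))"
        using cauchy_schwarz[OF \<open>d \<in> D\<close>, of v] that B(1) by (intro real_sqrt_le_mono) blast
      also have "\<dots> = sqrt (Q v \<bullet> v) * sqrt (Q d \<bullet> d)" by (simp add: real_sqrt_mult)
      also have "\<dots> \<le> M * sqrt (Q d \<bullet> d)"
      proof (rule mult_right_mono[OF _ b])
        have "sqrt (Q v \<bullet> v) \<le> (\<Sum>v\<in>B. sqrt (Q v \<bullet> v))"
          using that \<open>finite B\<close> B(1) quad_nonneg by (intro member_le_sum) auto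
        then show "sqrt (Q v \<bullet> v) \<le> M" unfolding M_def by simp
      qed
      finally show ?thesis .
    qed
    have "max 0 (fst p \<bullet> x - snd p) \<le> M * ?r" if "p \<in> F \<union> G" for p
    proof -
      have r: "M * ?r = M * (l s0 \<bullet> d) + M * sqrt (Q d \<bullet> d)" by (rule distrib_left)
      consider "p \<in> F" | "p = (l s0, l s0 \<bullet> s0)" | v where "v \<in> B" "p = (Q v, Q v \<bullet> s0)"
        | v where "v \<in> B" "p = (- Q v, - Q v \<bullet> s0)"
        using \<open>p \<in> F \<union> G\<close> unfolding G_def by blast
      then show ?thesis
      proof cases
        case 1
        then have "fst p \<bullet> x - snd p \<le> 0" using \<open>x \<in> P\<close> F(2) by simp
        then show ?thesis using Mr a unfolding r by linarith
      next
        case 2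
        then have "fst p \<bullet> x - snd p = l s0 \<bullet> d" unfolding d_def by (simp add: inner_diff_right)
        then show ?thesis using Mr a unfolding r by linarith
      next
        case (3 v)
        then have "fst p \<bullet> x - snd p = Q v \<bullet> d" unfolding d_def by (simp add: inner_diff_right)
        then show ?thesis using Mr a eq[OF 3(1)] unfolding r by linarith
      next
        case (4 v)
        then have "fst p \<bullet> x - snd p = - (Q v \<bullet> d)" unfolding d_def by (simp add: inner_diff_right)
        then show ?thesis using Mr a eq[OF 4(1)] unfolding r by linarith
      qed
    qed
    then have "(\<Sum>p\<in>F \<union> G. max 0 (fst p \<bullet> x - snd p)) \<le> real (card (F \<union> G)) * (M * ?r)"
      by (rule sum_bounded_above)
    then have "\<kappa> * (\<Sum>p\<in>F \<union> G. max 0 (fst p \<bullet> x - snd p)) \<le> \<kappa> * (real (card (F \<union> G)) * (M * ?r))"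
      using \<kappa>(1) by (intro mult_left_mono) auto
    then show ?thesis using \<kappa>(2)[of x] unfolding K_def d_def by (simp add: mult.assoc)
  qed
  define L where "L = K + 1"
  have "L > 0" unfolding L_def using \<open>K \<ge> 0\<close> by simp
  \<comment> \<open>With \<open>a\<close> the linear part, \<open>b\<close> the quadratic form and
    \<open>r\<close> the distance: \<open>r / 2 \<le> L * a\<close> gives
    \<open>a \<ge> r / (2 * L)\<close>, while \<open>r / 2 \<le> L * sqrt b\<close> gives
    \<open>b / 2 \<ge> r\<^sup>2 / (8 * L\<^sup>2)\<close>. One of the two cases always
    occurs.\<close>
  define c where "c = min (1 / (2 * L)) (1 / (8 * L\<^sup>2))"
  have "c > 0" unfolding c_def using \<open>L > 0\<close> by simp
  moreover have "c * huber (infdist x ?Z) \<le> q x" if "x \<in> P" for x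
  proof -
    define d where "d = x - s0"
    have "d \<in> D" using that unfolding d_def D_def by blast
    define a where "a = l s0 \<bullet> d"
    define b where "b = Q d \<bullet> d"
    define r where "r = infdist x ?Z"
    have "a \<ge> 0" "b \<ge> 0"
      using linear_nonneg[OF \<open>d \<in> D\<close>] quad_nonneg[OF \<open>d \<in> D\<close>] unfolding a_def b_def by auto
    have "r \<ge> 0" unfolding r_def by (rule infdist_nonneg)
    have qx: "q x = a + b / 2"
      using Q(3)[of s0 d] s0(2) unfolding a_def b_def d_def by simp
    have "r \<le> K * (a + sqrt b)"
      using bound[OF that] unfolding a_def b_def d_def r_def .
    also have "\<dots> \<le> L * (a + sqrt b)"
      using \<open>a \<ge> 0\<close> \<open>b \<ge> 0\<close> unfolding L_def by (intro mult_right_mono) auto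
    finally have "r / 2 \<le> L * a \<or> r / 2 \<le> L * sqrt b" by (auto simp: distrib_left)
    then show ?thesis
    proof
      assume "r / 2 \<le> L * a"
      then have "1 / (2 * L) * r \<le> a" using \<open>L > 0\<close> by (simp add: field_simps)
      moreover have "c * huber r \<le> 1 / (2 * L) * r"
        using huber_le(1)[of r] huber_nonneg[OF \<open>r \<ge> 0\<close>] \<open>L > 0\<close> unfolding c_def
        by (intro mult_mono) auto
      ultimately show ?thesis using \<open>b \<ge> 0\<close> unfolding qx r_def by linarith
    next
      assume "r / 2 \<le> L * sqrt b"
      then have "(r / 2)\<^sup>2 \<le> (L * sqrt b)\<^sup>2" using \<open>r \<ge> 0\<close> by (intro power_mono) auto
      then have "r\<^sup>2 \<le> 4 * L\<^sup>2 * b" using \<open>b \<ge> 0\<close> by (simp add: power_mult_distrib power_divide)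
      then have "1 / (8 * L\<^sup>2) * r\<^sup>2 \<le> b / 2" using \<open>L > 0\<close> by (simp add: field_simps)
      moreover have "c * huber r \<le> 1 / (8 * L\<^sup>2) * r\<^sup>2"
        using huber_le(2)[of r] huber_nonneg[OF \<open>r \<ge> 0\<close>] \<open>L > 0\<close> unfolding c_def
        by (intro mult_mono) auto
      ultimately show ?thesis using \<open>a \<ge> 0\<close> unfolding qx r_def by linarith
    qed
  qed
  ultimately show "\<exists>c>0. \<forall>x\<in>P. c * huber (infdist x ?Z) \<le> q x" by blast
qed

section \<open>Piecewise linear-quadratic functions\<close>

definition subgrad :: "('a::real_inner \<Rightarrow> ereal) \<Rightarrow> 'a \<Rightarrow> 'a \<Rightarrow> bool" where
  "subgrad h x y \<longleftrightarrow> \<bar>h x\<bar> \<noteq> \<infinity> \<and> (\<forall>u. h x + ereal (y \<bullet> (u - x)) \<le> h u)"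

text \<open>The set \<open>{u. subgrad h u y}\<close>, called the fibre of \<open>y\<close> below,
  consists of the minimizers of \<open>h\<close> minus the linear function given by
  \<open>y\<close>. The distance is to this whole set; \<open>x\<close> only fixes the minimal
  value.\<close>

definition quad_growth :: "('a::real_inner \<Rightarrow> ereal) \<Rightarrow> 'a \<Rightarrow> 'a \<Rightarrow> bool" where
  "quad_growth h x y \<longleftrightarrow>
    (\<exists>c>0. \<forall>u. h x + ereal (y \<bullet> (u - x) + c * huber (infdist u {u. subgrad h u y})) \<le> h u)"

text \<open>The premise on \<open>s'\<close> says that \<open>e\<close> is normal to
  \<open>S\<close> at \<open>s\<close>, so \<open>s \<bullet> e\<close> is the support function of
  \<open>S\<close> at \<open>e\<close>. When \<open>S\<close> is the subdifferential at
  \<open>x\<close>, this plays the role of the directional derivative, and the bound is a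
  second-order upper estimate near \<open>x\<close>.\<close>

definition quad_upper :: "('a::real_inner \<Rightarrow> ereal) \<Rightarrow> 'a \<Rightarrow> 'a set \<Rightarrow> bool" where
  "quad_upper h x S \<longleftrightarrow> (\<exists>C\<ge>0. \<exists>\<epsilon>>0. \<forall>s\<in>S. \<forall>e. norm e \<le> \<epsilon> \<longrightarrow> (\<forall>s'\<in>S. (s' - s) \<bullet> e \<le> 0) \<longrightarrow>
    h (x + e) \<le> h x + ereal (s \<bullet> e + C * (norm e)\<^sup>2))"

lemma subgrad_real:
  assumes "subgrad h x y"
  obtains a where "h x = ereal a" "\<And>u. ereal (a + y \<bullet> (u - x)) \<le> h u"
  using assms unfolding subgrad_def by (cases "h x") auto

lemma subgradI:
  assumes "h x = ereal a" "\<And>u. ereal (a + y \<bullet> (u - x)) \<le> h u"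
  shows "subgrad h x y"
  using assms unfolding subgrad_def by simp

text \<open>An affine minorant that touches \<open>h\<close> at \<open>x0\<close> is determined by
  its slope, so \<open>y\<close> is a subgradient at \<open>u\<close> exactly when the same minorant
  touches at \<open>u\<close>. This presents the fibre as a sublevel set.\<close>

lemma subgrad_iff_le:
  assumes "subgrad h x0 y"
  shows "subgrad h u y \<longleftrightarrow> h u \<le> h x0 + ereal (y \<bullet> (u - x0))"
proof -
  obtain a where a: "h x0 = ereal a" "\<And>u. ereal (a + y \<bullet> (u - x0)) \<le> h u"
    using subgrad_real[OF assms] by blast
  show ?thesis
  proof
    assume "subgrad h u y"
    then obtain b where b: "h u = ereal b" "\<And>w. ereal (b + y \<bullet> (w - u)) \<le> h w"
      using subgrad_real by blast
    show "h u \<le> h x0 + ereal (y \<bullet> (u - x0))"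
      using b(2)[of x0] unfolding a b by (simp add: inner_diff_right)
  next
    assume "h u \<le> h x0 + ereal (y \<bullet> (u - x0))"
    then have "h u = ereal (a + y \<bullet> (u - x0))" using a by (simp add: antisym)
    then show "subgrad h u y"
    proof (rule subgradI)
      show "ereal (a + y \<bullet> (u - x0) + y \<bullet> (w - u)) \<le> h w" for w
        using a(2)[of w] by (simp add: inner_diff_right)
    qed
  qed
qed

lemma convex_erealD:
  assumes "convex_ereal h" "h u \<le> ereal a" "h v \<le> ereal b" "0 \<le> t" "t \<le> 1"
  shows "h ((1 - t) *\<^sub>R u + t *\<^sub>R v) \<le> ereal ((1 - t) * a + t * b)"
proof -
  have "h ((1 - t) *\<^sub>R u + t *\<^sub>R v) \<le> ereal (1 - t) * h u + ereal t * h v"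
    using assms unfolding convex_ereal_def by auto
  also have "\<dots> \<le> ereal (1 - t) * ereal a + ereal t * ereal b"
    using assms by (intro add_mono ereal_mult_left_mono) auto
  finally show ?thesis by simp
qed

lemma convex_subgrad_fibre:
  assumes "convex_ereal h" "subgrad h x0 y"
  shows "convex {u. subgrad h u y}"
proof -
  obtain a where a: "h x0 = ereal a" using subgrad_real[OF assms(2)] by blast
  have sub: "subgrad h u y \<longleftrightarrow> h u \<le> ereal (a + y \<bullet> (u - x0))" for u
    using subgrad_iff_le[OF assms(2), of u] a by simp
  show ?thesis
    unfolding convex_alt
  proof (intro ballI allI impI)
    fix u v t assume uv: "u \<in> {u. subgrad h u y}" "v \<in> {u. subgrad h u y}" "0 \<le> (t::real) \<and> t \<le> 1"
    then have "h ((1 - t) *\<^sub>R u + t *\<^sub>R v) \<le>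
        ereal ((1 - t) * (a + y \<bullet> (u - x0)) + t * (a + y \<bullet> (v - x0)))"
      using sub by (intro convex_erealD[OF assms(1)]) auto
    also have "(1 - t) * (a + y \<bullet> (u - x0)) + t * (a + y \<bullet> (v - x0)) =
        a + y \<bullet> (((1 - t) *\<^sub>R u + t *\<^sub>R v) - x0)"
      by (simp add: inner_diff_right inner_add_right algebra_simps)
    finally show "(1 - t) *\<^sub>R u + t *\<^sub>R v \<in> {u. subgrad h u y}" using sub by simp
  qed
qed

section \<open>Growth and upper bounds of piecewise linear-quadratic functions\<close>

lemma plq_pieces:
  assumes "piecewise_linear_quadratic f"
  obtains \<P> q where "finite \<P>" "\<And>P. P \<in> \<P> \<Longrightarrow> polyhedron P" "edom f = \<Union>\<P>"
    "\<And>P. P \<in> \<P> \<Longrightarrow> quadratic_fun (q P)" "\<And>P x. P \<in> \<P> \<Longrightarrow> x \<in> P \<Longrightarrow> f x = ereal (q P x)"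
proof -
  obtain \<P> where P: "finite \<P>" "\<forall>P\<in>\<P>. polyhedron P" "edom f = \<Union>\<P>"
      "\<forall>P\<in>\<P>. \<exists>q. quadratic_fun q \<and> (\<forall>x\<in>P. f x = ereal (q x))"
    using assms unfolding piecewise_linear_quadratic_def by blast
  from bchoice[OF P(4)] obtain q where "\<forall>P\<in>\<P>. quadratic_fun (q P) \<and> (\<forall>x\<in>P. f x = ereal (q P x))"
    by (rule exE)
  with P(1-3) show ?thesis by (intro that[of \<P> q]) auto
qed

lemma finite_uniform_pos:
  fixes R :: "'i \<Rightarrow> real \<Rightarrow> bool"
  assumes "finite I" "\<And>i. i \<in> I \<Longrightarrow> \<exists>c>0. R i c" "\<And>i c c'. R i c \<Longrightarrow> 0 < c' \<Longrightarrow> c' \<le> c \<Longrightarrow> R i c'"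
  shows "\<exists>c>0. \<forall>i\<in>I. R i c"
proof -
  have "\<forall>i\<in>I. \<exists>c>0. R i c" using assms(2) by blast
  from bchoice[OF this] obtain c where c: "\<forall>i\<in>I. c i > 0 \<and> R i (c i)" by (rule exE)
  \<comment> \<open>The \<open>1\<close> stands in for an empty index set.\<close>
  define m where "m = Min (insert 1 (c ` I))"
  have "m > 0" unfolding m_def using assms(1) c by simp
  moreover have "m \<le> c i" if "i \<in> I" for i
    unfolding m_def using assms(1) that by simp
  ultimately show ?thesis using c assms(3) by blast
qed

text \<open>On pieces that meet the fibre, \<open>quadratic_growth_on_polyhedron\<close> applies.
  The other pieces keep a positive distance from the fibre, as all sets involved are polyhedra, so
  near the fibre they do not interfere. Convexity along segments to the fibre then carries the
  estimate to all points, with the linear branch of \<open>huber\<close>.\<close>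

lemma plq_growth:
  fixes f :: "'a::euclidean_space \<Rightarrow> ereal"
  assumes f: "proper_lsc_convex f" "piecewise_linear_quadratic f" and sub: "subgrad f x0 y"
  shows "polyhedron {u. subgrad f u y}" "quad_growth f x0 y"
proof -
  let ?U = "{u. subgrad f u y}"
  have cvx: "convex_ereal f" using f(1) unfolding proper_lsc_convex_def by simp
  obtain \<P> q where P: "finite \<P>" "\<And>P. P \<in> \<P> \<Longrightarrow> polyhedron P" "edom f = \<Union>\<P>"
    "\<And>P. P \<in> \<P> \<Longrightarrow> quadratic_fun (q P)" "\<And>P x. P \<in> \<P> \<Longrightarrow> x \<in> P \<Longrightarrow> f x = ereal (q P x)"
    using plq_pieces[OF f(2)] by metis
  obtain a where a: "f x0 = ereal a" "\<And>u. ereal (a + y \<bullet> (u - x0)) \<le> f u"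
    using subgrad_real[OF sub] by blast
  \<comment> \<open>The gap between \<open>f\<close> and its affine minorant, expressed on the piece
    \<open>P\<close>; its zeros in \<open>P\<close> are the points of the fibre.\<close>
  define k where "k P x = q P x - y \<bullet> (x - x0) - a" for P x
  have k_nonneg: "k P x \<ge> 0" if "P \<in> \<P>" "x \<in> P" for P x
    using a(2)[of x] P(5)[OF that] unfolding k_def by simp
  have U_piece: "x \<in> ?U \<longleftrightarrow> k P x = 0" if "P \<in> \<P>" "x \<in> P" for P x
    using subgrad_iff_le[OF sub, of x] k_nonneg[OF that] unfolding k_def P(5)[OF that] a by auto
  then have U_Int: "?U \<inter> P = {x\<in>P. k P x = 0}" if "P \<in> \<P>" for P
    using that by blast
  have "?U \<subseteq> \<Union>\<P>"
  proof
    fix u assume "u \<in> ?U"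
    then have "u \<in> edom f" unfolding edom_def subgrad_def by auto
    then show "u \<in> \<Union>\<P>" using P(3) by simp
  qed
  then have U_Union: "?U = \<Union>((\<lambda>P. ?U \<inter> P) ` \<P>)" by blast
  have quad: "quadratic_fun (k P)" if "P \<in> \<P>" for P
    unfolding k_def using quadratic_fun_diff_affine[OF P(4)[OF that]] by simp
  have convk: "convex_on P (k P)" if "P \<in> \<P>" for P
  proof (rule convex_onI)
    show "convex P" using P(2)[OF that] by (rule polyhedron_imp_convex)
    fix t :: real and u v assume tuv: "0 < t" "t < 1" "u \<in> P" "v \<in> P"
    then have w: "(1 - t) *\<^sub>R u + t *\<^sub>R v \<in> P" using \<open>convex P\<close> by (simp add: convexD)
    have "f ((1 - t) *\<^sub>R u + t *\<^sub>R v) \<le> ereal ((1 - t) * q P u + t * q P v)"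
      using tuv P(5)[OF that] by (intro convex_erealD[OF cvx]) auto
    then have "q P ((1 - t) *\<^sub>R u + t *\<^sub>R v) \<le> (1 - t) * q P u + t * q P v"
      using P(5)[OF that w] by simp
    then show "k P ((1 - t) *\<^sub>R u + t *\<^sub>R v) \<le> (1 - t) * k P u + t * k P v"
      unfolding k_def by (simp add: inner_diff_right inner_add_right algebra_simps)
  qed
  have growth: "polyhedron (?U \<inter> P)" "\<exists>c>0. \<forall>x\<in>P. c * huber (infdist x (?U \<inter> P)) \<le> k P x"
    if "P \<in> \<P>" "?U \<inter> P \<noteq> {}" for P
  proof -
    obtain s where s: "s \<in> P" "k P s = 0" using \<open>?U \<inter> P \<noteq> {}\<close> U_Int[OF \<open>P \<in> \<P>\<close>] by blast
    note * = quadratic_growth_on_polyhedron[OF P(2)[OF that(1)] quad[OF that(1)] convk[OF that(1)]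
        k_nonneg[OF that(1)] s]
    show "polyhedron (?U \<inter> P)" "\<exists>c>0. \<forall>x\<in>P. c * huber (infdist x (?U \<inter> P)) \<le> k P x"
      unfolding U_Int[OF that(1)] using * by blast+
  qed
  have "polyhedron (\<Union>((\<lambda>P. ?U \<inter> P) ` \<P>))"
  proof (rule polyhedron_finite_Union)
    show "convex (\<Union>((\<lambda>P. ?U \<inter> P) ` \<P>))"
      using convex_subgrad_fibre[OF cvx sub] U_Union by simp
    show "polyhedron Q" if "Q \<in> (\<lambda>P. ?U \<inter> P) ` \<P>" for Q
      using that growth(1) by (cases "Q = {}") auto
  qed (use P(1) in simp)
  then show poly: "polyhedron ?U" using U_Union by simp
  have "x0 \<in> ?U" using sub by simp
  have "closed ?U" using poly by (rule polyhedron_imp_closed)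
  have apart: "\<exists>\<delta>>0. \<forall>P\<in>\<P>. ?U \<inter> P = {} \<longrightarrow> (\<forall>x\<in>P. \<delta> \<le> infdist x ?U)"
  proof (rule finite_uniform_pos[OF P(1)])
    fix P assume "P \<in> \<P>"
    show "\<exists>\<delta>>0. ?U \<inter> P = {} \<longrightarrow> (\<forall>x\<in>P. \<delta> \<le> infdist x ?U)"
    proof (cases "?U \<inter> P = {}")
      case True
      then obtain \<delta> where \<delta>: "\<delta> > 0" "\<forall>u\<in>?U. \<forall>x\<in>P. \<delta> \<le> dist u x"
        using disjoint_polyhedra_apart[OF poly P(2)[OF \<open>P \<in> \<P>\<close>]] by blast
      have "\<delta> \<le> infdist x ?U" if "x \<in> P" for x
        using infdist_attains_inf[OF \<open>closed ?U\<close>, of x] \<open>x0 \<in> ?U\<close> \<delta>(2) that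
        by (metis dist_commute empty_iff)
      with \<delta>(1) show ?thesis by blast
    qed (auto intro: exI[of _ 1])
  qed force
  then obtain \<delta> where "\<delta> > 0" and far: "\<And>P x. P \<in> \<P> \<Longrightarrow> ?U \<inter> P = {} \<Longrightarrow> x \<in> P \<Longrightarrow> \<delta> \<le> infdist x ?U"
    by blast
  have "\<exists>c>0. \<forall>P\<in>\<P>. ?U \<inter> P \<noteq> {} \<longrightarrow> (\<forall>x\<in>P. c * huber (infdist x ?U) \<le> k P x)"
  proof (rule finite_uniform_pos[OF P(1)])
    fix P assume "P \<in> \<P>"
    show "\<exists>c>0. ?U \<inter> P \<noteq> {} \<longrightarrow> (\<forall>x\<in>P. c * huber (infdist x ?U) \<le> k P x)"
    proof (cases "?U \<inter> P = {}")
      case False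
      then obtain c where c: "c > 0" "\<forall>x\<in>P. c * huber (infdist x (?U \<inter> P)) \<le> k P x"
        using growth(2)[OF \<open>P \<in> \<P>\<close>] by blast
      have "c * huber (infdist x ?U) \<le> c * huber (infdist x (?U \<inter> P))" for x
        using c(1) False by (intro mult_left_mono huber_mono infdist_mono infdist_nonneg) auto
      with c show ?thesis by (meson order_trans)
    qed (auto intro: exI[of _ 1])
  next
    fix P and c c' :: real
    assume *: "?U \<inter> P \<noteq> {} \<longrightarrow> (\<forall>x\<in>P. c * huber (infdist x ?U) \<le> k P x)" "c' \<le> c"
    have "c' * huber (infdist x ?U) \<le> c * huber (infdist x ?U)" for x
      using *(2) by (intro mult_right_mono huber_nonneg infdist_nonneg)
    then show "?U \<inter> P \<noteq> {} \<longrightarrow> (\<forall>x\<in>P. c' * huber (infdist x ?U) \<le> k P x)"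
      using *(1) by (meson order_trans)
  qed
  then obtain c where "c > 0"
    and near: "\<And>P x. P \<in> \<P> \<Longrightarrow> ?U \<inter> P \<noteq> {} \<Longrightarrow> x \<in> P \<Longrightarrow> c * huber (infdist x ?U) \<le> k P x"
    by blast
  \<comment> \<open>\<open>\<rho> < \<delta>\<close> excludes the pieces that miss
    \<open>?U\<close>, and \<open>\<rho> \<le> 1\<close> ensures
    \<open>huber \<rho> = \<rho>\<^sup>2\<close>.\<close>
  define \<rho> where "\<rho> = min 1 (\<delta> / 2)"
  have \<rho>: "\<rho> > 0" "\<rho> \<le> 1" "\<rho> < \<delta>" using \<open>\<delta> > 0\<close> unfolding \<rho>_def by auto
  have close: "c * huber (infdist x ?U) \<le> k P x" if "P \<in> \<P>" "x \<in> P" "infdist x ?U \<le> \<rho>" for P x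
    using near[OF that(1) _ that(2)] far[OF that(1) _ that(2)] that(3) \<rho>(3) by fastforce
  define c' where "c' = c * \<rho>"
  have c': "c' > 0" "c' \<le> c" unfolding c'_def using \<open>c > 0\<close> \<rho> by (auto simp: mult_left_le)
  have "c' * huber (infdist x ?U) \<le> k P x" if "P \<in> \<P>" "x \<in> P" for P x
  proof (cases "infdist x ?U \<le> \<rho>")
    case True
    have "c' * huber (infdist x ?U) \<le> c * huber (infdist x ?U)"
      using c'(2) by (intro mult_right_mono huber_nonneg infdist_nonneg)
    then show ?thesis using close[OF that True] by linarith
  next
    case False
    define r where "r = infdist x ?U"
    have "r > \<rho>" using False unfolding r_def by simp
    obtain p where p: "p \<in> ?U" "r = dist x p"
      using infdist_attains_inf[OF \<open>closed ?U\<close>, of x] \<open>x0 \<in> ?U\<close> unfolding r_def by blast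
    \<comment> \<open>Move \<open>x\<close> towards its projection \<open>p\<close> until the
      distance to \<open>?U\<close> is exactly \<rho>. The gap vanishes at \<open>p\<close>, so
      convexity gives \<open>c * \<rho>\<^sup>2 \<le> t * k P x\<close>; dividing by
      \<open>t = \<rho> / r\<close> yields a bound linear in \<open>r\<close>.\<close>
    define t where "t = \<rho> / r"
    have t: "0 < t" "t < 1" "t * r = \<rho>" using \<rho>(1) \<open>r > \<rho>\<close> unfolding t_def by auto
    define z where "z = (1 - t) *\<^sub>R p + t *\<^sub>R x"
    have "f p \<le> ereal (a + y \<bullet> (p - x0))" using p(1) subgrad_iff_le[OF sub, of p] a by simp
    then have fz: "f z \<le> ereal ((1 - t) * (a + y \<bullet> (p - x0)) + t * q P x)"
      unfolding z_def using t P(5)[OF that] by (intro convex_erealD[OF cvx]) auto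
    then have "z \<in> edom f" unfolding edom_def by auto
    then obtain P' where P': "P' \<in> \<P>" "z \<in> P'" using P(3) by blast
    have "q P' z \<le> (1 - t) * (a + y \<bullet> (p - x0)) + t * q P x"
      using fz P(5)[OF P'] by simp
    then have kz: "k P' z \<le> t * k P x"
      unfolding k_def z_def by (simp add: inner_diff_right inner_add_right algebra_simps)
    have "z - p = t *\<^sub>R (x - p)" "x - z = (1 - t) *\<^sub>R (x - p)"
      unfolding z_def by (simp_all add: algebra_simps)
    then have dz: "dist z p = \<rho>" "dist x z = r - \<rho>"
      using t p(2) by (simp_all add: dist_norm left_diff_distrib)
    have "infdist z ?U \<le> \<rho>" using infdist_le[OF p(1), of z] dz(1) by simp
    moreover have "r \<le> infdist z ?U + dist x z" unfolding r_def by (rule infdist_triangle)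
    ultimately have "infdist z ?U = \<rho>" using dz(2) by linarith
    then have "c * huber \<rho> \<le> t * k P x"
      using close[OF P'] kz by simp
    moreover have "huber \<rho> = \<rho> * (t * r)"
      using \<rho> t(3) unfolding huber_def by (simp add: power2_eq_square mult_left_le)
    ultimately have "t * (c' * r) \<le> t * k P x" unfolding c'_def by (simp add: mult_ac)
    then have "c' * r \<le> k P x" using t(1) by simp
    moreover have "c' * huber r \<le> c' * r" using huber_le(1) c'(1) by (intro mult_left_mono) auto
    ultimately show ?thesis unfolding r_def by linarith
  qed
  then have "ereal (a + y \<bullet> (x - x0) + c' * huber (infdist x ?U)) \<le> f x" for x
  proof (cases "f x = \<infinity>")
    case False
    then have "x \<in> edom f" unfolding edom_def by (auto simp: less_top)
    then obtain P where "P \<in> \<P>" "x \<in> P" using P(3) by blast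
    then show ?thesis
      using \<open>\<And>x P. P \<in> \<P> \<Longrightarrow> x \<in> P \<Longrightarrow> c' * huber (infdist x ?U) \<le> k P x\<close>[of P x] P(5)[of P x]
      unfolding k_def by simp
  qed simp
  then show "quad_growth f x0 y"
    unfolding quad_growth_def using c'(1) a(1) by (intro exI[of _ c']) (simp add: add.assoc)
qed


text \<open>The set \<open>E\<close> below is the closed cone generated by the epigraph of \<open>f\<close>, shifted by
  \<open>(x0, f x0)\<close>, that is, the epigraph of the directional derivative of \<open>f\<close> at \<open>x0\<close>. Separating
  a point \<open>(e, s \<bullet> e)\<close> from it yields a subgradient \<open>s'\<close> with \<open>(s' - s) \<bullet> e > 0\<close>.\<close>

lemma plq_upper:
  fixes f :: "'a::euclidean_space \<Rightarrow> ereal"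
  assumes f: "proper_lsc_convex f" "piecewise_linear_quadratic f" and sub: "subgrad f x0 y"
  shows "polyhedron {s. subgrad f x0 s}" "quad_upper f x0 {s. subgrad f x0 s}"
proof -
  have cvx: "convex_ereal f" using f(1) unfolding proper_lsc_convex_def by simp
  obtain \<P> q where P: "finite \<P>" "\<And>P. P \<in> \<P> \<Longrightarrow> polyhedron P" "edom f = \<Union>\<P>"
    "\<And>P. P \<in> \<P> \<Longrightarrow> quadratic_fun (q P)" "\<And>P x. P \<in> \<P> \<Longrightarrow> x \<in> P \<Longrightarrow> f x = ereal (q P x)"
    using plq_pieces[OF f(2)] by metis
  obtain a where a: "f x0 = ereal a" using subgrad_real[OF sub] by blast
  \<comment> \<open>Only pieces through \<open>x0\<close> matter near \<open>x0\<close>: the union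
    of the others is closed and misses \<open>x0\<close>.\<close>
  define \<Q> where "\<Q> = {P\<in>\<P>. x0 \<in> P}"
  have Q: "finite \<Q>" "\<And>P. P \<in> \<Q> \<Longrightarrow> P \<in> \<P>" "\<And>P. P \<in> \<Q> \<Longrightarrow> x0 \<in> P"
    using P(1) unfolding \<Q>_def by auto
  have "x0 \<in> \<Union>\<P>" using a P(3)[symmetric] unfolding edom_def by simp
  then have "\<Q> \<noteq> {}" unfolding \<Q>_def by blast
  have "\<forall>P\<in>\<Q>. \<exists>T. polyhedron T \<and> cone T \<and> (\<forall>x\<in>P. x - x0 \<in> T) \<and>
      (\<exists>\<epsilon>>0. \<forall>d\<in>T. norm d \<le> \<epsilon> \<longrightarrow> x0 + d \<in> P)"
  proof
    fix P assume "P \<in> \<Q>"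
    obtain T \<epsilon> where "polyhedron T" "cone T" "\<epsilon> > 0" "\<And>x. x \<in> P \<Longrightarrow> x - x0 \<in> T"
        "\<And>d. d \<in> T \<Longrightarrow> norm d \<le> \<epsilon> \<Longrightarrow> x0 + d \<in> P"
      by (rule polyhedron_tangent_cone[OF P(2)[OF Q(2)[OF \<open>P \<in> \<Q>\<close>]] Q(3)[OF \<open>P \<in> \<Q>\<close>]]) blast
    then show "\<exists>T. polyhedron T \<and> cone T \<and> (\<forall>x\<in>P. x - x0 \<in> T) \<and>
        (\<exists>\<epsilon>>0. \<forall>d\<in>T. norm d \<le> \<epsilon> \<longrightarrow> x0 + d \<in> P)"
      by (intro exI[of _ T]) blast
  qed
  from bchoice[OF this] obtain T where "\<forall>P\<in>\<Q>. polyhedron (T P) \<and> cone (T P) \<and>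
      (\<forall>x\<in>P. x - x0 \<in> T P) \<and> (\<exists>\<epsilon>>0. \<forall>d\<in>T P. norm d \<le> \<epsilon> \<longrightarrow> x0 + d \<in> P)"
    by (rule exE)
  then have T: "\<And>P. P \<in> \<Q> \<Longrightarrow> polyhedron (T P)" "\<And>P. P \<in> \<Q> \<Longrightarrow> cone (T P)"
      "\<And>P x. P \<in> \<Q> \<Longrightarrow> x \<in> P \<Longrightarrow> x - x0 \<in> T P"
      "\<And>P. P \<in> \<Q> \<Longrightarrow> \<exists>\<epsilon>>0. \<forall>d\<in>T P. norm d \<le> \<epsilon> \<longrightarrow> x0 + d \<in> P"
    by blast+
  have T0: "0 \<in> T P" if "P \<in> \<Q>" for P using T(3)[OF that Q(3)[OF that]] by simp
  have T_scale: "t *\<^sub>R d \<in> T P" if "P \<in> \<Q>" "d \<in> T P" "t \<ge> 0" for P d t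
    using T(2)[OF that(1)] that(2,3) unfolding cone_def by blast
  have "\<forall>P\<in>\<Q>. \<exists>l. \<exists>C\<ge>0. \<forall>d. \<bar>q P (x0 + d) - q P x0 - l \<bullet> d\<bar> \<le> C * (norm d)\<^sup>2"
  proof
    fix P assume "P \<in> \<Q>"
    obtain l C where "C \<ge> 0" "\<And>d. \<bar>q P (x0 + d) - q P x0 - l \<bullet> d\<bar> \<le> C * (norm d)\<^sup>2"
      by (rule quadratic_fun_remainder[OF P(4)[OF Q(2)[OF \<open>P \<in> \<Q>\<close>]], of x0]) blast
    then show "\<exists>l. \<exists>C\<ge>0. \<forall>d. \<bar>q P (x0 + d) - q P x0 - l \<bullet> d\<bar> \<le> C * (norm d)\<^sup>2" by blast
  qed
  from bchoice[OF this] obtain l where "\<forall>P\<in>\<Q>. \<exists>C\<ge>0. \<forall>d. \<bar>q P (x0 + d) - q P x0 - l P \<bullet> d\<bar> \<le> C * (norm d)\<^sup>2"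
    by (rule exE)
  from bchoice[OF this] obtain C where C: "\<forall>P\<in>\<Q>. C P \<ge> 0 \<and>
      (\<forall>d. \<bar>q P (x0 + d) - q P x0 - l P \<bullet> d\<bar> \<le> C P * (norm d)\<^sup>2)"
    by (auto simp: Bex_def)
  define K where "K = (\<Sum>P\<in>\<Q>. C P)"
  have "K \<ge> 0" unfolding K_def using C by (intro sum_nonneg) blast
  have remainder: "\<bar>q P (x0 + d) - a - l P \<bullet> d\<bar> \<le> K * (norm d)\<^sup>2" if "P \<in> \<Q>" for P d
  proof -
    have "C P \<le> K" unfolding K_def using that C Q(1) by (intro member_le_sum) auto
    then have "C P * (norm d)\<^sup>2 \<le> K * (norm d)\<^sup>2" by (rule mult_right_mono) simp
    moreover have "q P x0 = a" using P(5)[OF Q(2)[OF that] Q(3)[OF that]] a by simp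
    moreover have "\<bar>q P (x0 + d) - q P x0 - l P \<bullet> d\<bar> \<le> C P * (norm d)\<^sup>2" using C that by blast
    ultimately show ?thesis by linarith
  qed
  have "\<exists>\<epsilon>>0. \<forall>P\<in>\<Q>. \<forall>d\<in>T P. norm d \<le> \<epsilon> \<longrightarrow> x0 + d \<in> P"
    by (rule finite_uniform_pos[OF Q(1) T(4)]) auto
  then obtain \<epsilon>1 where \<epsilon>1: "\<epsilon>1 > 0" "\<forall>P\<in>\<Q>. \<forall>d\<in>T P. norm d \<le> \<epsilon>1 \<longrightarrow> x0 + d \<in> P"
    by blast
  have "closed (\<Union>(\<P> - \<Q>))"
  proof (intro closed_Union ballI)
    show "finite (\<P> - \<Q>)" using P(1) by simp
    show "closed P" if "P \<in> \<P> - \<Q>" for P using that P(2) polyhedron_imp_closed by blast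
  qed
  then have "open (- \<Union>(\<P> - \<Q>))" by blast
  moreover have "x0 \<in> - \<Union>(\<P> - \<Q>)" unfolding \<Q>_def by blast
  ultimately obtain \<epsilon>2 where \<epsilon>2: "\<epsilon>2 > 0" "cball x0 \<epsilon>2 \<subseteq> - \<Union>(\<P> - \<Q>)"
    using open_contains_cball by blast
  define \<epsilon> where "\<epsilon> = min \<epsilon>1 \<epsilon>2"
  have "\<epsilon> > 0" unfolding \<epsilon>_def using \<epsilon>1 \<epsilon>2 by simp
  have in_piece: "x0 + d \<in> P" if "P \<in> \<Q>" "d \<in> T P" "norm d \<le> \<epsilon>" for P d
    using \<epsilon>1(2) that unfolding \<epsilon>_def by simp
  have piece: "\<exists>P\<in>\<Q>. x0 + d \<in> P" if "norm d \<le> \<epsilon>" "x0 + d \<in> edom f" for d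
  proof -
    have "x0 + d \<in> cball x0 \<epsilon>2" using that(1) unfolding \<epsilon>_def by (simp add: dist_norm)
    then show ?thesis using \<epsilon>2(2) that(2) P(3) by blast
  qed
  have small: "\<forall>\<^sub>F t in at_right (0::real). t > 0 \<and> norm (t *\<^sub>R d) \<le> \<epsilon>" for d :: 'a
  proof -
    have "((\<lambda>t. norm (t *\<^sub>R d)) \<longlongrightarrow> norm (0 *\<^sub>R d)) (at_right 0)"
      by (intro tendsto_intros)
    then have "\<forall>\<^sub>F t in at_right (0::real). norm (t *\<^sub>R d) < \<epsilon>"
      using \<open>\<epsilon> > 0\<close> by (intro order_tendstoD(2)) auto
    then show ?thesis using eventually_at_right_less[of "0::real"] by eventually_elim simp
  qed
  define E where "E = (\<Union>P\<in>\<Q>. {z. fst z \<in> T P \<and> l P \<bullet> fst z \<le> snd z})"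
  \<comment> \<open>Points \<open>x0 + t *\<^sub>R d\<close> with small \<open>t\<close> lie in
    finitely many pieces. If no piece had \<open>d\<close> in its cone with slope at most
    \<open>r\<close>, then for small \<open>t\<close> none would have slope at most
    \<open>r + ?N * t\<close> either, against the upper bound on \<open>f\<close>.\<close>
  have E_intro: "(d, r) \<in> E"
    if ev: "\<forall>\<^sub>F t in at_right 0. f (x0 + t *\<^sub>R d) \<le> ereal (a + t * r + M * t\<^sup>2)" for d r M
  proof (rule ccontr)
    assume "(d, r) \<notin> E"
    then have no: "\<not> (d \<in> T P \<and> l P \<bullet> d \<le> r)" if "P \<in> \<Q>" for P
      using that unfolding E_def by auto
    let ?N = "M + K * (norm d)\<^sup>2"
    have "\<forall>\<^sub>F t in at_right (0::real). \<forall>P\<in>\<Q>. \<not> (d \<in> T P \<and> l P \<bullet> d \<le> r + ?N * t)"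
    proof (intro eventually_ball_finite Q(1) ballI)
      fix P assume "P \<in> \<Q>"
      show "\<forall>\<^sub>F t in at_right (0::real). \<not> (d \<in> T P \<and> l P \<bullet> d \<le> r + ?N * t)"
      proof (cases "d \<in> T P")
        case True
        have "((\<lambda>t. r + ?N * t) \<longlongrightarrow> r + ?N * 0) (at_right 0)" by (intro tendsto_intros)
        then have "\<forall>\<^sub>F t in at_right 0. r + ?N * t < l P \<bullet> d"
          using no[OF \<open>P \<in> \<Q>\<close>] True by (intro order_tendstoD(2)) auto
        then show ?thesis by (rule eventually_mono) simp
      qed simp
    qed
    with ev small[of d] have "\<forall>\<^sub>F t in at_right (0::real). False"
    proof eventually_elim
      case (elim t)
      then have "x0 + t *\<^sub>R d \<in> edom f" unfolding edom_def by auto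
      then obtain P where P': "P \<in> \<Q>" "x0 + t *\<^sub>R d \<in> P" using piece elim by blast
      have "t *\<^sub>R d \<in> T P" using T(3)[OF P'] by simp
      from T_scale[OF P'(1) this, of "1 / t"] have "(1 / t) *\<^sub>R t *\<^sub>R d \<in> T P" using elim by simp
      then have "d \<in> T P" using elim by simp
      have "q P (x0 + t *\<^sub>R d) \<le> a + t * r + M * t\<^sup>2"
        using elim P(5)[OF Q(2)[OF P'(1)] P'(2)] by simp
      moreover have "q P (x0 + t *\<^sub>R d) \<ge> a + t * (l P \<bullet> d) - K * (norm d)\<^sup>2 * t\<^sup>2"
        using remainder[OF P'(1), of "t *\<^sub>R d"] by (simp add: power_mult_distrib mult_ac abs_le_iff)
      ultimately have "t * (l P \<bullet> d) \<le> t * (r + ?N * t)"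
        by (simp add: algebra_simps power2_eq_square)
      then have "l P \<bullet> d \<le> r + ?N * t" using elim by simp
      with elim \<open>d \<in> T P\<close> P'(1) show False by blast
    qed
    then show False by simp
  qed
  have above: "f (x0 + t *\<^sub>R d) \<le> ereal (a + t * r + K * (norm d)\<^sup>2 * t\<^sup>2)"
    if "P \<in> \<Q>" "d \<in> T P" "l P \<bullet> d \<le> r" "t \<ge> 0" "norm (t *\<^sub>R d) \<le> \<epsilon>" for P d r t
  proof -
    have "x0 + t *\<^sub>R d \<in> P" using in_piece T_scale that by blast
    then have "f (x0 + t *\<^sub>R d) = ereal (q P (x0 + t *\<^sub>R d))" using P(5) Q(2) that(1) by blast
    moreover have "q P (x0 + t *\<^sub>R d) \<le> a + t * (l P \<bullet> d) + K * (norm d)\<^sup>2 * t\<^sup>2"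
      using remainder[OF that(1), of "t *\<^sub>R d"] by (simp add: power_mult_distrib mult_ac abs_le_iff)
    moreover have "t * (l P \<bullet> d) \<le> t * r" using that by (intro mult_left_mono)
    ultimately show ?thesis by simp
  qed
  have "closed E"
    unfolding E_def
  proof (intro closed_UN Q(1) ballI)
    fix P assume "P \<in> \<Q>"
    have "closed {z :: 'a \<times> real. fst z \<in> T P}"
      using closed_vimage_fst[OF polyhedron_imp_closed[OF T(1)[OF \<open>P \<in> \<Q>\<close>]]] by (simp add: vimage_def)
    moreover have "closed {z :: 'a \<times> real. l P \<bullet> fst z \<le> snd z}"
      by (intro closed_Collect_le continuous_intros)
    ultimately show "closed {z. fst z \<in> T P \<and> l P \<bullet> fst z \<le> snd z}" by (rule closed_Collect_conj)
  qed
  \<comment> \<open>\<open>E\<close> is a union of cones over the pieces, so its convexity has to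
    come from that of \<open>f\<close>: \<open>above\<close> passes from \<open>E\<close> to
    \<open>f\<close>, and \<open>E_intro\<close> returns.\<close>
  have "convex E"
    unfolding convex_alt
  proof (intro ballI allI impI)
    fix z1 z2 :: "'a \<times> real" and u :: real
    assume z: "z1 \<in> E" "z2 \<in> E" and u: "0 \<le> u \<and> u \<le> 1"
    obtain P1 d1 r1 where 1: "z1 = (d1, r1)" "P1 \<in> \<Q>" "d1 \<in> T P1" "l P1 \<bullet> d1 \<le> r1"
      using z(1) unfolding E_def by (cases z1) auto
    obtain P2 d2 r2 where 2: "z2 = (d2, r2)" "P2 \<in> \<Q>" "d2 \<in> T P2" "l P2 \<bullet> d2 \<le> r2"
      using z(2) unfolding E_def by (cases z2) auto
    let ?M = "(1 - u) * (K * (norm d1)\<^sup>2) + u * (K * (norm d2)\<^sup>2)"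
    have "((1 - u) *\<^sub>R d1 + u *\<^sub>R d2, (1 - u) * r1 + u * r2) \<in> E"
    proof (rule E_intro[of _ _ ?M], use small[of d1] small[of d2] in eventually_elim)
      case (elim t)
      have "f ((1 - u) *\<^sub>R (x0 + t *\<^sub>R d1) + u *\<^sub>R (x0 + t *\<^sub>R d2)) \<le>
          ereal ((1 - u) * (a + t * r1 + K * (norm d1)\<^sup>2 * t\<^sup>2) + u * (a + t * r2 + K * (norm d2)\<^sup>2 * t\<^sup>2))"
        using elim above[OF 1(2-4)] above[OF 2(2-4)] u by (intro convex_erealD[OF cvx]) auto
      also have "(1 - u) *\<^sub>R (x0 + t *\<^sub>R d1) + u *\<^sub>R (x0 + t *\<^sub>R d2) = x0 + t *\<^sub>R ((1 - u) *\<^sub>R d1 + u *\<^sub>R d2)"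
        by (simp add: algebra_simps)
      finally show ?case by (simp add: algebra_simps)
    qed
    then show "(1 - u) *\<^sub>R z1 + u *\<^sub>R z2 \<in> E" unfolding 1 2 by simp
  qed
  let ?S = "{s. subgrad f x0 s}"
  \<comment> \<open>The subgradients are the vectors that stay below \<open>l P\<close> on each
    tangent cone; this finite intersection of shifted dual cones is the source of
    polyhedrality.\<close>
  have S: "?S = (\<Inter>P\<in>\<Q>. {s. \<forall>d\<in>T P. s \<bullet> d \<le> l P \<bullet> d})"
  proof (intro equalityI subsetI INT_I CollectI ballI)
    fix s P d assume s: "s \<in> ?S" and d: "P \<in> \<Q>" "d \<in> T P"
    have "\<forall>\<^sub>F t in at_right 0. s \<bullet> d \<le> l P \<bullet> d + K * (norm d)\<^sup>2 * t"
      using small[of d]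
    proof eventually_elim
      case (elim t)
      have "f x0 + ereal (s \<bullet> (x0 + t *\<^sub>R d - x0)) \<le> f (x0 + t *\<^sub>R d)"
        using s unfolding subgrad_def by blast
      also have "\<dots> \<le> ereal (a + t * (l P \<bullet> d) + K * (norm d)\<^sup>2 * t\<^sup>2)"
        using elim by (intro above[OF d order_refl]) auto
      finally have "t * (s \<bullet> d) \<le> t * (l P \<bullet> d + K * (norm d)\<^sup>2 * t)"
        unfolding a by (simp add: algebra_simps power2_eq_square)
      then show ?case using elim by simp
    qed
    moreover have "((\<lambda>t. l P \<bullet> d + K * (norm d)\<^sup>2 * t) \<longlongrightarrow> l P \<bullet> d + K * (norm d)\<^sup>2 * 0) (at_right 0)"
      by (intro tendsto_intros)
    ultimately have "s \<bullet> d \<le> l P \<bullet> d + K * (norm d)\<^sup>2 * 0"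
      by (intro tendsto_lowerbound) auto
    then show "s \<bullet> d \<le> l P \<bullet> d" by simp
  next
    fix s assume s: "s \<in> (\<Inter>P\<in>\<Q>. {s. \<forall>d\<in>T P. s \<bullet> d \<le> l P \<bullet> d})"
    show "subgrad f x0 s"
    proof (rule subgradI[of f, OF a])
      fix u
      show "ereal (a + s \<bullet> (u - x0)) \<le> f u"
      proof (cases "f u")
        case (real b)
        have "\<forall>\<^sub>F t in at_right (0::real). t < 1" by (rule eventually_at_right_real[THEN eventually_mono]) auto
        then have "\<forall>\<^sub>F t in at_right 0. f (x0 + t *\<^sub>R (u - x0)) \<le> ereal (a + t * (b - a) + 0 * t\<^sup>2)"
          using eventually_at_right_less[of "0::real"]
        proof eventually_elim
          case (elim t)
          have "f ((1 - t) *\<^sub>R x0 + t *\<^sub>R u) \<le> ereal ((1 - t) * a + t * b)"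
            using elim a real by (intro convex_erealD[OF cvx]) auto
          then show ?case by (simp add: algebra_simps)
        qed
        then have "(u - x0, b - a) \<in> E" by (rule E_intro)
        then obtain P where "P \<in> \<Q>" "u - x0 \<in> T P" "l P \<bullet> (u - x0) \<le> b - a" unfolding E_def by auto
        then have "s \<bullet> (u - x0) \<le> b - a" using s by fastforce
        then show ?thesis using real by simp
      next
        case MInf
        then show ?thesis using f(1) unfolding proper_lsc_convex_def proper_def by simp
      qed simp
    qed
  qed
  show "polyhedron ?S"
    unfolding S using Q(1) T(1,2) by (intro polyhedron_Inter) (auto intro!: polyhedron_dual_cone)
  have "(e, s \<bullet> e) \<in> E" if s: "s \<in> ?S" and e: "\<forall>s'\<in>?S. (s' - s) \<bullet> e \<le> 0" for s e
  proof (rule ccontr)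
    assume "(e, s \<bullet> e) \<notin> E"
    then obtain w \<beta> where w: "w \<bullet> (e, s \<bullet> e) < \<beta>" "\<And>z. z \<in> E \<Longrightarrow> w \<bullet> z > \<beta>"
      using separating_hyperplane_closed_point[OF \<open>convex E\<close> \<open>closed E\<close>] by blast
    obtain w1 w2 where w12: "w = (w1, w2)" by (cases w)
    have in_E: "(d, r) \<in> E" if "P \<in> \<Q>" "d \<in> T P" "l P \<bullet> d \<le> r" for P d r
      using that unfolding E_def by force
    obtain P0 where "P0 \<in> \<Q>" using \<open>\<Q> \<noteq> {}\<close> by blast
    have "\<beta> < 0" using w(2)[OF in_E[OF \<open>P0 \<in> \<Q>\<close> T0[OF \<open>P0 \<in> \<Q>\<close>], of 0]] unfolding w12 by simp
    have nonneg: "w1 \<bullet> d + w2 * r \<ge> 0" if "P \<in> \<Q>" "d \<in> T P" "l P \<bullet> d \<le> r" for P d r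
    proof (rule ccontr)
      assume neg: "\<not> w1 \<bullet> d + w2 * r \<ge> 0"
      define t where "t = \<beta> / (w1 \<bullet> d + w2 * r)"
      have "t \<ge> 0" unfolding t_def using neg \<open>\<beta> < 0\<close> by (simp add: divide_nonpos_nonpos)
      then have "(t *\<^sub>R d, t * r) \<in> E"
        using that T_scale by (intro in_E[of P]) (auto intro: mult_left_mono)
      from w(2)[OF this] have "t * (w1 \<bullet> d + w2 * r) > \<beta>"
        unfolding w12 by (simp add: algebra_simps)
      then show False using neg unfolding t_def by simp
    qed
    have "w2 \<ge> 0" using nonneg[OF \<open>P0 \<in> \<Q>\<close> T0[OF \<open>P0 \<in> \<Q>\<close>], of 1] by simp
    have less: "w1 \<bullet> e + w2 * (s \<bullet> e) < 0" using w(1) \<open>\<beta> < 0\<close> unfolding w12 by simp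
    show False
    \<comment> \<open>If the hyperplane is vertical, \<open>- w1\<close> is a recession direction of
      the subdifferential and \<open>s - w1\<close> contradicts the normality of \<open>e\<close>;
      otherwise \<open>- (1 / w2) *\<^sub>R w1\<close> does.\<close>
    proof (cases "w2 = 0")
      case True
      have "s - w1 \<in> ?S"
        using s nonneg[OF _ _ order_refl] unfolding S True by (fastforce simp: inner_diff_left)
      then show False using e less unfolding True by (fastforce simp: inner_diff_left)
    next
      case False
      then have "w2 > 0" using \<open>w2 \<ge> 0\<close> by simp
      let ?s = "- (1 / w2) *\<^sub>R w1"
      have eq: "?s \<bullet> d \<le> r \<longleftrightarrow> w1 \<bullet> d + w2 * r \<ge> 0" for d r
        using \<open>w2 > 0\<close> by (simp add: field_simps) linarith
      have "?s \<in> ?S" unfolding S using nonneg[OF _ _ order_refl] eq by blast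
      then have "(?s - s) \<bullet> e \<le> 0" using e by blast
      then have "?s \<bullet> e \<le> s \<bullet> e" unfolding inner_diff_left by linarith
      then show False using eq less by fastforce
    qed
  qed
  then have "f (x0 + e) \<le> f x0 + ereal (s \<bullet> e + K * (norm e)\<^sup>2)"
    if "s \<in> ?S" "norm e \<le> \<epsilon>" "\<forall>s'\<in>?S. (s' - s) \<bullet> e \<le> 0" for s e
    using that above[of _ e "s \<bullet> e" 1] unfolding E_def a by (fastforce simp: add.assoc)
  then show "quad_upper f x0 ?S"
    unfolding quad_upper_def using \<open>K \<ge> 0\<close> \<open>\<epsilon> > 0\<close> by (intro exI[of _ K] conjI exI[of _ \<epsilon>]) auto
qed

section \<open>Conjugation\<close>

text \<open>By duality the two inequalities interchange their roles: \<open>quad_growth\<close> of \<open>h\<close> corresponds to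
  \<open>quad_upper\<close> of the conjugate and conversely. Hence this class is stable under conjugation.\<close>

definition plq_like :: "('a::euclidean_space \<Rightarrow> ereal) \<Rightarrow> bool" where
  "plq_like h \<longleftrightarrow> convex_ereal h \<and> (\<forall>x. h x \<noteq> -\<infinity>) \<and>
    (\<forall>x y. subgrad h x y \<longrightarrow> polyhedron {u. subgrad h u y} \<and> polyhedron {s. subgrad h x s} \<and>
      quad_growth h x y \<and> quad_upper h x {s. subgrad h x s})"

lemma plq_imp_plq_like:
  assumes "proper_lsc_convex f" "piecewise_linear_quadratic f"
  shows "plq_like f"
  using assms plq_growth[OF assms] plq_upper[OF assms]
  unfolding plq_like_def proper_lsc_convex_def proper_def by blast

text \<open>The form in which lower semicontinuity enters the separation arguments; the epigraph is
  a finite union of closed sets, one for each piece.\<close>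

lemma plq_epigraph_closed:
  fixes f :: "'a::euclidean_space \<Rightarrow> ereal"
  assumes "piecewise_linear_quadratic f"
  shows "closed {z. f (fst z) \<le> ereal (snd z)}"
proof -
  obtain \<P> q where P: "finite \<P>" "\<And>P. P \<in> \<P> \<Longrightarrow> polyhedron P" "edom f = \<Union>\<P>"
    "\<And>P. P \<in> \<P> \<Longrightarrow> quadratic_fun (q P)" "\<And>P x. P \<in> \<P> \<Longrightarrow> x \<in> P \<Longrightarrow> f x = ereal (q P x)"
    using plq_pieces[OF assms] by metis
  have "{z. f (fst z) \<le> ereal (snd z)} = (\<Union>P\<in>\<P>. {z. fst z \<in> P \<and> q P (fst z) \<le> snd z})"
  proof (intro equalityI subsetI)
    fix z assume "z \<in> {z. f (fst z) \<le> ereal (snd z)}"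
    then have z: "f (fst z) \<le> ereal (snd z)" by simp
    then have "fst z \<in> edom f" unfolding edom_def by auto
    then show "z \<in> (\<Union>P\<in>\<P>. {z. fst z \<in> P \<and> q P (fst z) \<le> snd z})"
      using P(3,5) z by auto
  qed (use P(5) in auto)
  also have "closed \<dots>"
  proof (intro closed_UN P(1) ballI)
    fix P assume "P \<in> \<P>"
    have "closed {z :: 'a \<times> real. fst z \<in> P}"
      using closed_vimage_fst[OF polyhedron_imp_closed[OF P(2)[OF \<open>P \<in> \<P>\<close>]]] by (simp add: vimage_def)
    moreover have "closed {z :: 'a \<times> real. q P (fst z) \<le> snd z}"
    proof (intro closed_Collect_le continuous_intros)
      show "continuous_on UNIV (\<lambda>z :: 'a \<times> real. q P (fst z))"
        using continuous_on_compose2[OF quadratic_fun_continuous[OF P(4)[OF \<open>P \<in> \<P>\<close>], of UNIV]]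
          continuous_on_fst[OF continuous_on_id] by blast
    qed
    ultimately show "closed {z. fst z \<in> P \<and> q P (fst z) \<le> snd z}" by (rule closed_Collect_conj)
  qed
  finally show ?thesis .
qed

text \<open>The epigraph of the conjugate parametrizes the affine minorants of \<open>f\<close>.
  Upper bounds on conjugates are obtained in this form below.\<close>

lemma conjugate_le_iff: "conjugate f y \<le> ereal c \<longleftrightarrow> (\<forall>u. ereal (u \<bullet> y - c) \<le> f u)"
proof -
  have "ereal (u \<bullet> y) - f u \<le> ereal c \<longleftrightarrow> ereal (u \<bullet> y - c) \<le> f u" for u
    by (cases "f u") (auto simp: algebra_simps)
  then show ?thesis unfolding conjugate_def SUP_le_iff by simp
qed

lemma conjugate_ge: "f u \<le> ereal b \<Longrightarrow> ereal (u \<bullet> y - b) \<le> conjugate f y"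
proof -
  assume "f u \<le> ereal b"
  then have "ereal (u \<bullet> y - b) \<le> ereal (u \<bullet> y) - f u" by (cases "f u") auto
  also have "\<dots> \<le> conjugate f y" unfolding conjugate_def by (rule SUP_upper) simp
  finally show ?thesis .
qed

text \<open>The epigraph separates strictly from every point below it. A vertical separating hyperplane
  is tilted with the help of some affine minorant.\<close>

lemma fenchel_moreau_le:
  fixes f :: "'a::euclidean_space \<Rightarrow> ereal"
  assumes proper: "proper f" and cvx: "convex_ereal f" and closed: "closed {z. f (fst z) \<le> ereal (snd z)}"
  shows "\<exists>v c. conjugate f v \<le> ereal c"
    and "(\<And>v c. conjugate f v \<le> ereal c \<Longrightarrow> x \<bullet> v - c \<le> r) \<Longrightarrow> f x \<le> ereal r"
proof -
  let ?E = "{z. f (fst z) \<le> ereal (snd z)}"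
  have "convex ?E"
    unfolding convex_alt
  proof (intro ballI allI impI CollectI)
    fix z w and t :: real assume "z \<in> ?E" "w \<in> ?E" "0 \<le> t \<and> t \<le> 1"
    then show "f (fst ((1 - t) *\<^sub>R z + t *\<^sub>R w)) \<le> ereal (snd ((1 - t) *\<^sub>R z + t *\<^sub>R w))"
      using convex_erealD[OF cvx, of "fst z" "snd z" "fst w" "snd w" t] by simp
  qed
  have separate: "\<exists>a b c. b \<ge> 0 \<and> a \<bullet> x + b * r < c \<and> (\<forall>u t. f u \<le> ereal t \<longrightarrow> a \<bullet> u + b * t > c)"
    if below: "\<not> f x \<le> ereal r" for x r
  proof -
    obtain w c where w: "w \<bullet> (x, r) < c" "\<And>z. z \<in> ?E \<Longrightarrow> w \<bullet> z > c"
      using separating_hyperplane_closed_point[OF \<open>convex ?E\<close> closed, of "(x, r)"] below by auto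
    obtain a b where ab: "w = (a, b)" by (cases w)
    have E: "a \<bullet> u + b * t > c" if "f u \<le> ereal t" for u t
      using w(2)[of "(u, t)"] that unfolding ab by simp
    obtain u0 where "f u0 < \<infinity>" using proper unfolding proper_def edom_def by auto
    then obtain t0 where t0: "f u0 \<le> ereal t0"
      by (cases "f u0") auto
    \<comment> \<open>Epigraphs extend upwards: for \<open>b < 0\<close>, a large \<open>t\<close>
      would violate the separation.\<close>
    have "b \<ge> 0"
    proof (rule ccontr)
      assume "\<not> b \<ge> 0"
      define t where "t = max t0 ((c - a \<bullet> u0) / b)"
      have "f u0 \<le> ereal t" using t0 by (rule order_trans) (simp add: t_def)
      moreover have "b * t \<le> b * ((c - a \<bullet> u0) / b)"
        unfolding t_def using \<open>\<not> b \<ge> 0\<close> by (intro mult_left_mono_neg) auto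
      ultimately show False using E[of u0 t] \<open>\<not> b \<ge> 0\<close> by simp
    qed
    then show ?thesis using w(1) E unfolding ab by (intro exI[of _ a] exI[of _ b] exI[of _ c]) auto
  qed
  have minorant: "conjugate f (- (1 / b) *\<^sub>R a) \<le> ereal (- c / b)"
    if "b > 0" "\<forall>u t. f u \<le> ereal t \<longrightarrow> a \<bullet> u + b * t > c" for a b c
    unfolding conjugate_le_iff
  proof
    fix u
    show "ereal (u \<bullet> (- (1 / b) *\<^sub>R a) - - c / b) \<le> f u"
    proof (cases "f u")
      case (real t)
      then have "a \<bullet> u + b * t > c" using that(2) by simp
      then show ?thesis using real \<open>b > 0\<close> by (simp add: field_simps inner_commute)
    next
      case MInf
      then show ?thesis using proper unfolding proper_def by simp
    qed simp
  qed
  obtain u0 where "f u0 < \<infinity>" using proper unfolding proper_def edom_def by auto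
  then obtain t0 where t0: "f u0 = ereal t0"
    using proper unfolding proper_def by (cases "f u0") auto
  \<comment> \<open>The separated point lies one below the graph, above a point \<open>u0\<close> of
    the domain. Hence the hyperplane is not vertical and yields an affine minorant.\<close>
  obtain a b c where abc: "b \<ge> 0" "a \<bullet> u0 + b * (t0 - 1) < c" "\<forall>u t. f u \<le> ereal t \<longrightarrow> a \<bullet> u + b * t > c"
    using separate[of u0 "t0 - 1"] t0 by auto
  have "a \<bullet> u0 + b * t0 > c" using abc(3) t0 by simp
  then have "b > 0" using abc(2) by (simp add: right_diff_distrib)
  then show exists: "\<exists>v c. conjugate f v \<le> ereal c" using minorant abc(3) by blast
  show "f x \<le> ereal r" if dual: "\<And>v c. conjugate f v \<le> ereal c \<Longrightarrow> x \<bullet> v - c \<le> r"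
  proof (rule ccontr)
    assume "\<not> f x \<le> ereal r"
    then obtain a b c where abc: "b \<ge> 0" "a \<bullet> x + b * r < c" "\<forall>u t. f u \<le> ereal t \<longrightarrow> a \<bullet> u + b * t > c"
      using separate by blast
    show False
    proof (cases "b = 0")
      case False
      then have "b > 0" using abc(1) by simp
      have "x \<bullet> (- (1 / b) *\<^sub>R a) - (- c / b) \<le> r" using dual minorant[OF \<open>b > 0\<close> abc(3)] by blast
      then show False using abc(2) \<open>b > 0\<close> by (simp add: field_simps inner_commute)
    next
      case True
      obtain v0 c0 where v0: "conjugate f v0 \<le> ereal c0" using exists by blast
      \<comment> \<open>Adding \<open>k\<close> times the vertical separation to the minorant given
        by \<open>v0\<close> and \<open>c0\<close> keeps it a minorant and raises its value at
        \<open>x\<close> by \<open>k * m\<close>, which exceeds any bound for large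
        \<open>k\<close>.\<close>
      have tilt: "conjugate f (v0 - k *\<^sub>R a) \<le> ereal (c0 - k * c)" if "k \<ge> 0" for k
        unfolding conjugate_le_iff
      proof
        fix u
        show "ereal (u \<bullet> (v0 - k *\<^sub>R a) - (c0 - k * c)) \<le> f u"
        proof (cases "f u")
          case (real t)
          then have "a \<bullet> u > c" using abc(3)[rule_format, of u t] True by simp
          then have "k * c \<le> k * (a \<bullet> u)" using that by (intro mult_left_mono) auto
          moreover have "u \<bullet> v0 - c0 \<le> t" using v0 real unfolding conjugate_le_iff by (metis ereal_less_eq(3))
          ultimately show ?thesis using real by (simp add: inner_diff_right inner_commute)
        next
          case MInf
          then show ?thesis using proper unfolding proper_def by simp
        qed simp
      qed
      define m where "m = c - a \<bullet> x"
      have "m > 0" using abc(2) True unfolding m_def by simp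
      define k where "k = (\<bar>r - x \<bullet> v0 + c0\<bar> + 1) / m"
      have "k \<ge> 0" unfolding k_def using \<open>m > 0\<close> by simp
      then have "x \<bullet> (v0 - k *\<^sub>R a) - (c0 - k * c) \<le> r" using dual tilt by blast
      then have "k * m \<le> r - x \<bullet> v0 + c0"
        unfolding m_def by (simp add: inner_diff_right inner_commute algebra_simps)
      then show False unfolding k_def using \<open>m > 0\<close> by simp
    qed
  qed
qed

lemma convex_conjugate:
  assumes "proper f"
  shows "convex_ereal (conjugate f)" "conjugate f y \<noteq> -\<infinity>"
proof -
  obtain u0 t0 where u0: "f u0 \<le> ereal t0"
  proof -
    obtain u0 where "f u0 < \<infinity>" using assms unfolding proper_def edom_def by auto
    then have "\<exists>t0. f u0 \<le> ereal t0" by (cases "f u0") auto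
    then show ?thesis using that by blast
  qed
  show notMInf: "conjugate f y \<noteq> -\<infinity>" for y
    using conjugate_ge[of f, OF u0, of y] by auto
  show "convex_ereal (conjugate f)"
    unfolding convex_ereal_def
  proof (intro allI ballI)
    fix y z and t :: real assume t: "t \<in> {0..1}"
    show "conjugate f ((1 - t) *\<^sub>R y + t *\<^sub>R z) \<le> ereal (1 - t) * conjugate f y + ereal t * conjugate f z"
    \<comment> \<open>At the endpoints an infinite value is cancelled by
      \<open>0 * \<infinity> = 0\<close>; strictly between them it makes the right-hand side
      infinite.\<close>
    proof (cases "t = 0 \<or> t = 1")
      case True
      then show ?thesis by (auto simp flip: zero_ereal_def)
    next
      case False
      then have t': "0 < t" "t < 1" using t by auto
      show ?thesis
      proof (cases "conjugate f y = \<infinity> \<or> conjugate f z = \<infinity>")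
        case True
        then have *: "ereal (1 - t) * conjugate f y + ereal t * conjugate f z = \<infinity>"
          using t' notMInf[of y] notMInf[of z] by (cases "conjugate f y"; cases "conjugate f z") auto
        show ?thesis unfolding * by simp
      next
        case False
        then obtain a b where ab: "conjugate f y = ereal a" "conjugate f z = ereal b"
          using notMInf[of y] notMInf[of z] by (cases "conjugate f y"; cases "conjugate f z") auto
        have "conjugate f ((1 - t) *\<^sub>R y + t *\<^sub>R z) \<le> ereal ((1 - t) * a + t * b)"
          unfolding conjugate_le_iff
        proof
          fix u
          have le: "ereal (u \<bullet> y - a) \<le> f u" "ereal (u \<bullet> z - b) \<le> f u"
            using ab conjugate_le_iff[of f y a] conjugate_le_iff[of f z b] by auto
          show "ereal (u \<bullet> ((1 - t) *\<^sub>R y + t *\<^sub>R z) - ((1 - t) * a + t * b)) \<le> f u"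
          proof (cases "f u")
            case (real s)
            have "(1 - t) * (u \<bullet> y - a) + t * (u \<bullet> z - b) \<le> s"
              using le t' unfolding real by (intro convex_bound_le) auto
            then show ?thesis using real by (simp add: inner_add_right algebra_simps)
          qed (use le in auto)
        qed
        then show ?thesis unfolding ab by simp
      qed
    qed
  qed
qed

text \<open>Equality in the inequality of Fenchel and Young.\<close>

lemma subgrad_conjugate_value:
  assumes "subgrad f x y" "f x = ereal a"
  shows "conjugate f y = ereal (x \<bullet> y - a)"
proof (rule antisym)
  have "ereal (u \<bullet> y - (x \<bullet> y - a)) \<le> f u" for u
    using assms unfolding subgrad_def by (auto simp: inner_diff_right inner_commute algebra_simps)
  then show "conjugate f y \<le> ereal (x \<bullet> y - a)" unfolding conjugate_le_iff ..
  show "ereal (x \<bullet> y - a) \<le> conjugate f y" using assms(2) by (intro conjugate_ge) simp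
qed

text \<open>The passage back to \<open>f\<close> is the one that rests on the theorem of Fenchel and
  Moreau: it gives \<open>f x \<le> x \<bullet> y - c\<close>, and the reverse inequality is that of
  Fenchel and Young.\<close>

lemma subgrad_conjugate_iff:
  fixes f :: "'a::euclidean_space \<Rightarrow> ereal"
  assumes "proper f" "convex_ereal f" "closed {z. f (fst z) \<le> ereal (snd z)}"
  shows "subgrad (conjugate f) y x \<longleftrightarrow> subgrad f x y"
proof
  assume sub: "subgrad f x y"
  obtain a where a: "f x = ereal a" using subgrad_real[OF sub] by blast
  show "subgrad (conjugate f) y x"
  proof (rule subgradI[of "conjugate f", OF subgrad_conjugate_value[OF sub a]])
    fix v
    have eq: "x \<bullet> y - a + x \<bullet> (v - y) = x \<bullet> v - a" by (simp add: inner_diff_right)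
    show "ereal (x \<bullet> y - a + x \<bullet> (v - y)) \<le> conjugate f v"
      unfolding eq using a by (intro conjugate_ge) simp
  qed
next
  assume sub: "subgrad (conjugate f) y x"
  obtain c where c: "conjugate f y = ereal c" "\<And>v. ereal (c + x \<bullet> (v - y)) \<le> conjugate f v"
    using subgrad_real[OF sub] by blast
  have "f x \<le> ereal (x \<bullet> y - c)"
  proof (rule fenchel_moreau_le(2)[OF assms])
    fix v d assume "conjugate f v \<le> ereal d"
    then have "c + x \<bullet> (v - y) \<le> d" using c(2)[of v] order_trans by fastforce
    then show "x \<bullet> v - d \<le> x \<bullet> y - c" by (simp add: inner_diff_right)
  qed
  moreover have le: "ereal (u \<bullet> y - c) \<le> f u" for u
    using c(1) conjugate_le_iff[of f y c] by simp
  ultimately have "f x = ereal (x \<bullet> y - c)" by (simp add: antisym)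
  then show "subgrad f x y"
  proof (rule subgradI)
    show "ereal (x \<bullet> y - c + y \<bullet> (u - x)) \<le> f u" for u
      using le[of u] by (simp add: inner_diff_right inner_commute)
  qed
qed

lemma closest_point_decomposition:
  fixes S :: "'a::euclidean_space set"
  assumes "convex S" "closed S" "S \<noteq> {}"
  obtains p where "p \<in> S" "norm (u - p) = infdist u S" "\<And>s. s \<in> S \<Longrightarrow> (s - p) \<bullet> (u - p) \<le> 0"
proof
  show "closest_point S u \<in> S" using assms by (intro closest_point_in_set)
  show "norm (u - closest_point S u) = infdist u S"
    using infdist_eq_setdist[of u S] setdist_closest_point[OF assms(2,3), of u] by (simp add: dist_norm)
  show "(s - closest_point S u) \<bullet> (u - closest_point S u) \<le> 0" if "s \<in> S" for s
    using closest_point_dot[OF assms(1,2) that, of u] by (simp add: inner_commute)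
qed

text \<open>In the supremum defining \<open>conjugate f (y + e)\<close>, the growth of
  \<open>f\<close> in the distance \<open>r\<close> to the fibre competes with
  \<open>r * norm e\<close>. For \<open>r \<le> 1\<close> Young's inequality leaves
  \<open>(norm e)\<^sup>2 / (4 * c)\<close>; for \<open>r > 1\<close> the linear growth wins as long
  as \<open>norm e \<le> c\<close>. These are the two constants of the upper bound.\<close>

lemma quad_growth_imp_conjugate_upper:
  fixes f :: "'a::euclidean_space \<Rightarrow> ereal"
  assumes "quad_growth f x y" and sub: "subgrad f x y"
    and "convex {u. subgrad f u y}" "closed {u. subgrad f u y}"
  shows "quad_upper (conjugate f) y {u. subgrad f u y}"
proof -
  let ?U = "{u. subgrad f u y}"
  have "?U \<noteq> {}" using sub by auto
  obtain a where a: "f x = ereal a" using subgrad_real[OF sub] by blast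
  obtain c where "c > 0" and c: "\<And>u. ereal (a + y \<bullet> (u - x) + c * huber (infdist u ?U)) \<le> f u"
    using assms(1) unfolding quad_growth_def a by (auto simp: add.assoc)
  have "conjugate f (y + e) \<le> conjugate f y + ereal (s \<bullet> e + 1 / (4 * c) * (norm e)\<^sup>2)"
    if s: "s \<in> ?U" and e: "norm e \<le> c" "\<forall>s'\<in>?U. (s' - s) \<bullet> e \<le> 0" for s e
  proof -
    have "conjugate f (y + e) \<le> ereal (x \<bullet> y - a + (s \<bullet> e + 1 / (4 * c) * (norm e)\<^sup>2))"
      unfolding conjugate_le_iff
    proof
      fix u
      obtain p where p: "p \<in> ?U" "norm (u - p) = infdist u ?U"
        using closest_point_decomposition[OF assms(3,4) \<open>?U \<noteq> {}\<close>, of u] by blast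
      define r where "r = infdist u ?U"
      have "r \<ge> 0" unfolding r_def by (rule infdist_nonneg)
      \<comment> \<open>Split \<open>u \<bullet> e\<close> at the projection \<open>p\<close>;
        normality of \<open>e\<close> at \<open>s\<close> gives
        \<open>p \<bullet> e \<le> s \<bullet> e\<close>.\<close>
      have "(u - p) \<bullet> e \<le> norm (u - p) * norm e" by (rule norm_cauchy_schwarz)
      then have ue: "u \<bullet> e \<le> s \<bullet> e + r * norm e"
        using bspec[OF e(2) p(1)] p(2) unfolding r_def by (simp add: inner_diff_left)
      have young: "r * norm e - c * huber r \<le> 1 / (4 * c) * (norm e)\<^sup>2"
      proof (cases "r \<le> 1")
        case True
        then have g: "huber r = r\<^sup>2" using \<open>r \<ge> 0\<close> unfolding huber_def
          by (simp add: power2_eq_square mult_left_le)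
        have "0 \<le> (2 * c * r - norm e)\<^sup>2 / (4 * c)" using \<open>c > 0\<close> by simp
        also have "\<dots> = c * r\<^sup>2 - r * norm e + 1 / (4 * c) * (norm e)\<^sup>2"
          using \<open>c > 0\<close> by (simp add: power2_eq_square field_simps)
        finally show ?thesis unfolding g by linarith
      next
        case False
        then have "huber r = r" unfolding huber_def by (simp add: power2_eq_square)
        moreover have "r * norm e \<le> r * c" using e(1) \<open>r \<ge> 0\<close> by (rule mult_left_mono)
        moreover have "1 / (4 * c) * (norm e)\<^sup>2 \<ge> 0" using \<open>c > 0\<close> by simp
        ultimately show ?thesis by (simp add: mult.commute)
      qed
      have "u \<bullet> (y + e) - (x \<bullet> y - a + (s \<bullet> e + 1 / (4 * c) * (norm e)\<^sup>2)) \<le>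
          a + y \<bullet> (u - x) + c * huber r"
        using ue young by (simp add: inner_add_right inner_diff_right inner_commute)
      then show "ereal (u \<bullet> (y + e) - (x \<bullet> y - a + (s \<bullet> e + 1 / (4 * c) * (norm e)\<^sup>2))) \<le> f u"
        using c[of u] unfolding r_def by (meson ereal_less_eq(3) order_trans)
    qed
    then show ?thesis unfolding subgrad_conjugate_value[OF sub a] by simp
  qed
  then show ?thesis
    unfolding quad_upper_def using \<open>c > 0\<close>
    by (intro exI[of _ "1 / (4 * c)"] conjI exI[of _ c]) auto
qed

text \<open>Test the upper bound with a short step from \<open>x\<close> in the direction of the residual of the
  projection of \<open>w\<close> onto \<open>S\<close>.\<close>

lemma quad_upper_imp_growth:
  fixes h :: "'a::euclidean_space \<Rightarrow> ereal"
  assumes upper: "quad_upper h x S" and S: "convex S" "closed S" "S \<noteq> {}" and "\<beta> \<ge> 0"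
  shows "\<exists>c>0. \<forall>w. \<exists>e. h (x + e) + ereal (c * huber (infdist w S) + \<beta> * (norm e)\<^sup>2) \<le> h x + ereal (w \<bullet> e)"
proof -
  obtain C \<epsilon> where "C \<ge> 0" "\<epsilon> > 0" and bound: "\<And>s e. s \<in> S \<Longrightarrow> norm e \<le> \<epsilon> \<Longrightarrow>
      (\<forall>s'\<in>S. (s' - s) \<bullet> e \<le> 0) \<Longrightarrow> h (x + e) \<le> h x + ereal (s \<bullet> e + C * (norm e)\<^sup>2)"
    using upper unfolding quad_upper_def by blast
  \<comment> \<open>A step of length \<open>t * r\<close> gains \<open>t * r\<^sup>2\<close> and
    costs \<open>(C + \<beta>) * (t * r)\<^sup>2\<close>; for \<open>t \<le> t0\<close> the cost is
    at most half of the gain. The part with \<beta> is room for the penalty of the smoothed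
    gap.\<close>
  define t0 where "t0 = 1 / (2 * (C + \<beta> + 1))"
  have "t0 > 0" unfolding t0_def using \<open>C \<ge> 0\<close> \<open>\<beta> \<ge> 0\<close> by simp
  have t0: "(C + \<beta>) * t0 \<le> 1 / 2"
    unfolding t0_def using \<open>C \<ge> 0\<close> \<open>\<beta> \<ge> 0\<close> by (simp add: field_simps)
  define c where "c = min t0 \<epsilon> / 2"
  have "c > 0" unfolding c_def using \<open>t0 > 0\<close> \<open>\<epsilon> > 0\<close> by simp
  have "\<exists>e. h (x + e) + ereal (c * huber (infdist w S) + \<beta> * (norm e)\<^sup>2) \<le> h x + ereal (w \<bullet> e)" for w
  proof -
    obtain s where s: "s \<in> S" "norm (w - s) = infdist w S" "\<And>s'. s' \<in> S \<Longrightarrow> (s' - s) \<bullet> (w - s) \<le> 0"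
      using closest_point_decomposition[OF S, of w] by blast
    define r where "r = infdist w S"
    have "r \<ge> 0" unfolding r_def by (rule infdist_nonneg)
    \<comment> \<open>The bound \<open>\<epsilon> / r\<close> keeps \<open>norm e = t * r\<close>
      within \<epsilon>. When it is the smaller one, the gain is linear in \<open>r\<close>, which
      is the linear branch of \<open>huber\<close>.\<close>
    define t where "t = (if r = 0 then 0 else min t0 (\<epsilon> / r))"
    have "t \<ge> 0" unfolding t_def using \<open>t0 > 0\<close> \<open>\<epsilon> > 0\<close> \<open>r \<ge> 0\<close> by simp
    have "t \<le> t0" unfolding t_def using \<open>t0 > 0\<close> by simp
    define e where "e = t *\<^sub>R (w - s)"
    have "t * r \<le> \<epsilon>"
    proof (cases "r = 0")
      case False
      then have "t * r \<le> \<epsilon> / r * r" unfolding t_def using \<open>r \<ge> 0\<close> by (intro mult_right_mono) auto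
      then show ?thesis using False by simp
    qed (use \<open>\<epsilon> > 0\<close> in simp)
    have ne: "norm e = t * r" unfolding e_def r_def s(2)[symmetric] using \<open>t \<ge> 0\<close> by simp
    have "\<forall>s'\<in>S. (s' - s) \<bullet> e \<le> 0"
      using s(3) \<open>t \<ge> 0\<close> unfolding e_def by (simp add: mult_nonneg_nonpos)
    then have he: "h (x + e) \<le> h x + ereal (s \<bullet> e + C * (norm e)\<^sup>2)"
      using bound[OF s(1), of e] ne \<open>t * r \<le> \<epsilon>\<close> by simp
    have gain: "c * huber r + (C + \<beta>) * (t * r)\<^sup>2 \<le> t * r\<^sup>2"
    proof (cases "r = 0")
      case True
      then show ?thesis unfolding huber_def by simp
    next
      case False
      then have "r > 0" using \<open>r \<ge> 0\<close> by simp
      have "(C + \<beta>) * t \<le> (C + \<beta>) * t0"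
        using \<open>t \<le> t0\<close> \<open>C \<ge> 0\<close> \<open>\<beta> \<ge> 0\<close> by (intro mult_left_mono) auto
      then have "(C + \<beta>) * t \<le> 1 / 2" using t0 by linarith
      then have "(C + \<beta>) * t * (t * r\<^sup>2) \<le> 1 / 2 * (t * r\<^sup>2)"
        using \<open>t \<ge> 0\<close> by (intro mult_right_mono) auto
      moreover have "c * huber r \<le> 1 / 2 * (t * r\<^sup>2)"
      proof (cases "t0 \<le> \<epsilon> / r")
        case True
        have "c * huber r \<le> t0 / 2 * r\<^sup>2"
          using \<open>t0 > 0\<close> huber_le(2)[of r] huber_nonneg[OF \<open>r \<ge> 0\<close>] unfolding c_def
          by (intro mult_mono) auto
        then show ?thesis using True False unfolding t_def by simp
      next
        case F: False
        have "c * huber r \<le> \<epsilon> / 2 * r"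
          using \<open>\<epsilon> > 0\<close> huber_le(1)[of r] huber_nonneg[OF \<open>r \<ge> 0\<close>] unfolding c_def
          by (intro mult_mono) auto
        then show ?thesis using F False unfolding t_def by (simp add: power2_eq_square)
      qed
      ultimately show ?thesis by (simp add: power_mult_distrib power2_eq_square algebra_simps)
    qed
    have "(w - s) \<bullet> e = t * r\<^sup>2"
      unfolding e_def r_def s(2)[symmetric] by (simp add: power2_norm_eq_inner)
    then have "s \<bullet> e + C * (norm e)\<^sup>2 + (c * huber r + \<beta> * (norm e)\<^sup>2) \<le> w \<bullet> e"
      using gain unfolding ne by (simp add: inner_diff_left algebra_simps)
    then have "h x + ereal (s \<bullet> e + C * (norm e)\<^sup>2) + ereal (c * huber r + \<beta> * (norm e)\<^sup>2) \<le> h x + ereal (w \<bullet> e)"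
      by (simp add: add.assoc add_left_mono)
    with he show ?thesis unfolding r_def by (meson add_right_mono order_trans)
  qed
  with \<open>c > 0\<close> show ?thesis by blast
qed

text \<open>The step \<open>e\<close> provides the test point \<open>x + e\<close> in the supremum
  defining \<open>conjugate f v\<close>. No penalty has to be paid here, so \<beta> is taken as
  0.\<close>

lemma quad_upper_imp_conjugate_growth:
  fixes f :: "'a::euclidean_space \<Rightarrow> ereal"
  assumes "quad_upper f x {s. subgrad f x s}" and sub: "subgrad f x y"
    and "convex {s. subgrad f x s}" "closed {s. subgrad f x s}"
    and conj: "\<And>v. subgrad (conjugate f) v x \<longleftrightarrow> subgrad f x v"
  shows "quad_growth (conjugate f) y x"
proof -
  let ?S = "{s. subgrad f x s}"
  obtain a where a: "f x = ereal a" using subgrad_real[OF sub] by blast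
  obtain c where "c > 0" and c: "\<And>v. \<exists>e. f (x + e) + ereal (c * huber (infdist v ?S) + 0 * (norm e)\<^sup>2) \<le>
      f x + ereal (v \<bullet> e)"
    using quad_upper_imp_growth[OF assms(1,3,4) _ order_refl] sub by blast
  have "ereal (x \<bullet> y - a + (x \<bullet> (v - y) + c * huber (infdist v ?S))) \<le> conjugate f v" for v
  proof -
    obtain e where "f (x + e) + ereal (c * huber (infdist v ?S)) \<le> f x + ereal (v \<bullet> e)"
      using c[of v] by auto
    then have "f (x + e) \<le> ereal (a + v \<bullet> e - c * huber (infdist v ?S))"
      unfolding a by (cases "f (x + e)") auto
    from conjugate_ge[of f, OF this, of v] show ?thesis
      by (simp add: inner_diff_right inner_add_left inner_commute algebra_simps)
  qed
  then show ?thesis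
    unfolding quad_growth_def conj subgrad_conjugate_value[OF sub a]
    using \<open>c > 0\<close> by (intro exI[of _ c]) simp
qed

lemma convex_subgrad_set: "convex {s. subgrad h x s}"
  unfolding convex_alt
proof (intro ballI allI impI CollectI)
  fix s s' and t :: real
  assume s: "s \<in> {s. subgrad h x s}" "s' \<in> {s. subgrad h x s}" "0 \<le> t \<and> t \<le> 1"
  obtain a where a: "h x = ereal a" using subgrad_real s by blast
  show "subgrad h x ((1 - t) *\<^sub>R s + t *\<^sub>R s')"
  proof (rule subgradI[of h, OF a])
    fix u
    have le: "ereal (a + s \<bullet> (u - x)) \<le> h u" "ereal (a + s' \<bullet> (u - x)) \<le> h u"
      using s(1,2) a unfolding subgrad_def by auto
    show "ereal (a + ((1 - t) *\<^sub>R s + t *\<^sub>R s') \<bullet> (u - x)) \<le> h u"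
    proof (cases "h u")
      case (real b)
      have "(1 - t) * (a + s \<bullet> (u - x)) + t * (a + s' \<bullet> (u - x)) \<le> b"
        using le s(3) unfolding real by (intro convex_bound_le) auto
      then show ?thesis using real by (simp add: inner_add_left algebra_simps)
    qed (use le in auto)
  qed
qed

lemma plq_like_conjugate:
  fixes f :: "'a::euclidean_space \<Rightarrow> ereal"
  assumes f: "proper_lsc_convex f" "piecewise_linear_quadratic f"
  shows "plq_like (conjugate f)"
proof -
  have f': "proper f" "convex_ereal f" "closed {z. f (fst z) \<le> ereal (snd z)}"
    using f plq_epigraph_closed unfolding proper_lsc_convex_def by auto
  note conj = subgrad_conjugate_iff[OF f']
  have "polyhedron {u. subgrad f x u} \<and> polyhedron {s. subgrad f s y} \<and>
      quad_growth (conjugate f) y x \<and> quad_upper (conjugate f) y {s. subgrad f s y}"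
    if sub: "subgrad f x y" for x y
  proof (intro conjI)
    show poly: "polyhedron {u. subgrad f x u}" "polyhedron {s. subgrad f s y}"
      using plq_upper[OF f sub] plq_growth[OF f sub] by auto
    show "quad_growth (conjugate f) y x"
      using quad_upper_imp_conjugate_growth[OF plq_upper(2)[OF f sub] sub convex_subgrad_set _ conj]
        polyhedron_imp_closed[OF poly(1)] by blast
    show "quad_upper (conjugate f) y {s. subgrad f s y}"
      using quad_growth_imp_conjugate_upper[OF plq_growth(2)[OF f sub] sub]
        polyhedron_imp_closed[OF poly(2)] polyhedron_imp_convex[OF poly(2)] by blast
  qed
  then show ?thesis
    unfolding plq_like_def conj using convex_conjugate[OF f'(1)] by blast
qed

section \<open>Saddle points and the smoothed gap\<close>

text \<open>A sum rule for subdifferentials, in the form in which the differentiability of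
  \<open>f2\<close> and of the conjugate of \<open>g2\<close> is used. The uniqueness of
  \<open>r\<close> lets one fixed vector serve all subgradients of the sum at
  \<open>x\<close>.\<close>

definition subgrad_splits :: "('a::real_inner \<Rightarrow> ereal) \<Rightarrow> ('a \<Rightarrow> ereal) \<Rightarrow> bool" where
  "subgrad_splits h1 h2 \<longleftrightarrow> (\<forall>x p. subgrad (\<lambda>u. h1 u + h2 u) x p \<longrightarrow>
    (\<exists>r. {s. subgrad h2 x s} = {r} \<and> subgrad h1 x (p - r)))"

section \<open>Sum rules for subgradients\<close>

lemma gderiv_directional:
  fixes F :: "'a::real_inner \<Rightarrow> real"
  assumes "GDERIV F x :> G"
  shows "((\<lambda>t. (F (x + t *\<^sub>R d) - F x) / t) \<longlongrightarrow> G \<bullet> d) (at_right 0)"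
proof -
  have F: "(F has_derivative (\<lambda>v. v \<bullet> G)) (at (x + 0 *\<^sub>R d))"
    using assms unfolding gderiv_def by simp
  have "((\<lambda>t. x + t *\<^sub>R d) has_derivative (\<lambda>t. t *\<^sub>R d)) (at 0)"
    by (auto intro!: derivative_eq_intros)
  from has_derivative_compose[OF this F]
  have "((\<lambda>t. F (x + t *\<^sub>R d)) has_derivative (\<lambda>t. (d \<bullet> G) * t)) (at 0)"
    by (simp add: mult.commute)
  then have "DERIV (\<lambda>t. F (x + t *\<^sub>R d)) 0 :> d \<bullet> G"
    unfolding has_field_derivative_def .
  then have "((\<lambda>t. (F (x + t *\<^sub>R d) - F x) / t) \<longlongrightarrow> G \<bullet> d) (at 0)"
    unfolding DERIV_def by (simp add: inner_commute)
  then show ?thesis by (rule filterlim_at_split[THEN iffD1, THEN conjunct2])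
qed

text \<open>Divide the subgradient inequality of the sum on the segment from \<open>x\<close> to
  \<open>u\<close> by \<open>t\<close> and let \<open>t\<close> tend to 0: by convexity the
  contribution of \<open>h1\<close> is at most the slope of its chord, and that of \<open>h2\<close>
  tends to the directional derivative.\<close>

lemma lipschitz_gradient_splits:
  fixes h1 h2 :: "'a::real_inner \<Rightarrow> ereal"
  assumes h1: "convex_ereal h1" "\<And>x. h1 x \<noteq> -\<infinity>" and h2: "convex_ereal h2" "lipschitz_gradient h2"
  shows "subgrad_splits h1 h2"
proof -
  define F where "F x = real_of_ereal (h2 x)" for x
  have h2F: "h2 x = ereal (F x)" for x
    using h2(2) unfolding lipschitz_gradient_def F_def by (simp add: ereal_real)
  obtain G where G: "\<And>x. GDERIV F x :> G x"
    using h2(2) unfolding lipschitz_gradient_def F_def by blast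
  note lim = gderiv_directional[OF G]
  have pos: "\<forall>\<^sub>F t in at_right (0::real). 0 < t \<and> t < 1"
    using eventually_at_right_real[of "0::real" 1] by simp
  have "{s. subgrad h2 x s} = {G x}" for x
  proof (intro equalityI subsetI)
    fix s assume "s \<in> {s. subgrad h2 x s}"
    then have s: "F x + s \<bullet> (u - x) \<le> F u" for u unfolding subgrad_def h2F by simp
    \<comment> \<open>Testing in the direction \<open>s - G x\<close> itself shows that this vector
      is 0.\<close>
    let ?d = "s - G x"
    have "\<forall>\<^sub>F t in at_right (0::real). s \<bullet> ?d \<le> (F (x + t *\<^sub>R ?d) - F x) / t"
      using pos
    proof eventually_elim
      case (elim t)
      then show ?case using s[of "x + t *\<^sub>R ?d"] by (simp add: le_divide_eq mult.commute)
    qed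
    then have "s \<bullet> ?d \<le> G x \<bullet> ?d" using lim by (intro tendsto_lowerbound) auto
    then have "?d \<bullet> ?d \<le> 0" by (simp add: inner_diff_left)
    then have "?d \<bullet> ?d = 0" using inner_ge_zero[of ?d] by linarith
    then show "s \<in> {G x}" by simp
  next
    have "F x + G x \<bullet> (u - x) \<le> F u" for u
    proof -
      have "\<forall>\<^sub>F t in at_right (0::real). (F (x + t *\<^sub>R (u - x)) - F x) / t \<le> F u - F x"
        using pos
      proof eventually_elim
        case (elim t)
        have "h2 ((1 - t) *\<^sub>R x + t *\<^sub>R u) \<le> ereal ((1 - t) * F x + t * F u)"
          using elim h2F by (intro convex_erealD[OF h2(1)]) auto
        then have "F (x + t *\<^sub>R (u - x)) - F x \<le> t * (F u - F x)"
          unfolding h2F by (simp add: algebra_simps)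
        then show ?case using elim by (simp add: divide_le_eq mult.commute)
      qed
      then have "G x \<bullet> (u - x) \<le> F u - F x" using lim by (intro tendsto_upperbound) auto
      then show ?thesis by simp
    qed
    then show "s \<in> {s. subgrad h2 x s}" if "s \<in> {G x}" for s
      using that subgradI[of h2, OF h2F] h2F by simp
  qed
  moreover have "subgrad h1 x (p - G x)" if sub: "subgrad (\<lambda>u. h1 u + h2 u) x p" for x p
  proof -
    obtain a where a: "h1 x = ereal a"
      using sub h1(2)[of x] unfolding subgrad_def h2F by (cases "h1 x") auto
    show ?thesis
    proof (rule subgradI[of h1, OF a])
      fix u
      show "ereal (a + (p - G x) \<bullet> (u - x)) \<le> h1 u"
      proof (cases "h1 u")
        case (real b)
        have "\<forall>\<^sub>F t in at_right (0::real). p \<bullet> (u - x) - (b - a) \<le> (F (x + t *\<^sub>R (u - x)) - F x) / t"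
          using pos
        proof eventually_elim
          case (elim t)
          let ?z = "x + t *\<^sub>R (u - x)"
          have "h1 ((1 - t) *\<^sub>R x + t *\<^sub>R u) \<le> ereal ((1 - t) * a + t * b)"
            using elim a real by (intro convex_erealD[OF h1(1)]) auto
          then have "h1 ?z \<le> ereal ((1 - t) * a + t * b)" by (simp add: algebra_simps)
          moreover have "\<forall>u. ereal (a + F x + p \<bullet> (u - x)) \<le> h1 u + ereal (F u)"
            using sub unfolding subgrad_def h2F a by simp
          then have "ereal (a + F x + p \<bullet> (?z - x)) \<le> h1 ?z + ereal (F ?z)" by (rule spec)
          ultimately have "a + F x + t * (p \<bullet> (u - x)) \<le> (1 - t) * a + t * b + F ?z"
            by (cases "h1 ?z") auto
          then have "(p \<bullet> (u - x) - (b - a)) * t \<le> F ?z - F x" by (simp add: algebra_simps)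
          then show ?case using elim by (simp add: le_divide_eq)
        qed
        then have "p \<bullet> (u - x) - (b - a) \<le> G x \<bullet> (u - x)" using lim by (intro tendsto_lowerbound) auto
        then show ?thesis using real by (simp add: inner_diff_left)
      qed (use h1(2) in auto)
    qed
  qed
  ultimately show ?thesis unfolding subgrad_splits_def by blast
qed

lemma subgrad_add:
  assumes "subgrad h1 x p" "subgrad h2 x r"
  shows "subgrad (\<lambda>u. h1 u + h2 u) x (p + r)"
proof -
  obtain a b where a: "h1 x = ereal a" "h2 x = ereal b"
    using subgrad_real assms by metis
  show ?thesis
  proof (rule subgradI[of _ _ "a + b"])
    fix u
    have "ereal (a + p \<bullet> (u - x)) + ereal (b + r \<bullet> (u - x)) \<le> h1 u + h2 u"
      using assms a unfolding subgrad_def by (intro add_mono) auto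
    then show "ereal (a + b + (p + r) \<bullet> (u - x)) \<le> h1 u + h2 u"
      by (simp add: inner_add_left algebra_simps)
  qed (use a in simp)
qed

text \<open>If the sum of the two affine minorants touches at \<open>x\<close>, two nonnegative gaps
  add up to 0, so each minorant touches there.\<close>

lemma subgrad_add_fibre:
  assumes "subgrad h1 x0 p" "subgrad h2 x0 r"
  shows "subgrad (\<lambda>u. h1 u + h2 u) x (p + r) \<longleftrightarrow> subgrad h1 x p \<and> subgrad h2 x r"
proof
  assume sub: "subgrad (\<lambda>u. h1 u + h2 u) x (p + r)"
  obtain a b where a: "h1 x0 = ereal a" "h2 x0 = ereal b"
    using subgrad_real assms by metis
  have le: "h1 x + h2 x \<le> ereal (a + b + (p + r) \<bullet> (x - x0))"
    using sub unfolding subgrad_iff_le[OF subgrad_add[OF assms], of x] a by simp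
  have ge: "ereal (a + p \<bullet> (x - x0)) \<le> h1 x" "ereal (b + r \<bullet> (x - x0)) \<le> h2 x"
    using assms a unfolding subgrad_def by auto
  obtain c d where cd: "h1 x = ereal c" "h2 x = ereal d"
    using le ge by (cases "h1 x"; cases "h2 x") auto
  show "subgrad h1 x p \<and> subgrad h2 x r"
    using le ge unfolding subgrad_iff_le[OF assms(1), of x] subgrad_iff_le[OF assms(2), of x] a cd
    by (simp add: inner_add_left)
qed (use subgrad_add in blast)

lemma huber_scale: "0 < k \<Longrightarrow> 0 \<le> r \<Longrightarrow> min k (k\<^sup>2) * huber r \<le> huber (k * r)"
  unfolding huber_def
  by (intro min.boundedI, simp_all add: mult_mono power_mult_distrib)

text \<open>The four subgradient inequalities between two saddle points add up to
  \<open>0 \<le> 0\<close>, so all are equalities. This gives the interchangeability of saddle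
  points and the uniqueness of the saddle value; \<open>B\<close> is minus the adjoint of
  \<open>A\<close>.\<close>

lemma saddle_exchange:
  assumes AB: "\<And>x y. B y \<bullet> x = - (A x \<bullet> y)"
    and "subgrad H x0 (B y0)" "subgrad K y0 (A x0)" "subgrad H x1 (B y1)" "subgrad K y1 (A x1)"
  shows "subgrad H x0 (B y1)" "subgrad K y1 (A x0)"
    "\<And>a b c. H x0 = ereal a \<Longrightarrow> K y0 = ereal b \<Longrightarrow> K y1 = ereal c \<Longrightarrow> A x0 \<bullet> y1 - c = A x0 \<bullet> y0 - b"
proof -
  obtain a0 where a0: "H x0 = ereal a0" "\<And>u. ereal (a0 + B y0 \<bullet> (u - x0)) \<le> H u"
    using subgrad_real[OF assms(2)] by blast
  obtain b0 where b0: "K y0 = ereal b0" "\<And>u. ereal (b0 + A x0 \<bullet> (u - y0)) \<le> K u"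
    using subgrad_real[OF assms(3)] by blast
  obtain a1 where a1: "H x1 = ereal a1" "\<And>u. ereal (a1 + B y1 \<bullet> (u - x1)) \<le> H u"
    using subgrad_real[OF assms(4)] by blast
  obtain b1 where b1: "K y1 = ereal b1" "\<And>u. ereal (b1 + A x1 \<bullet> (u - y1)) \<le> K u"
    using subgrad_real[OF assms(5)] by blast
  have ineqs: "a0 + B y0 \<bullet> (x1 - x0) \<le> a1" "b0 + A x0 \<bullet> (y1 - y0) \<le> b1"
      "a1 + B y1 \<bullet> (x0 - x1) \<le> a0" "b1 + A x1 \<bullet> (y0 - y1) \<le> b0"
    using a0(2)[of x1] b0(2)[of y1] a1(2)[of x0] b1(2)[of y0] a0(1) b0(1) a1(1) b1(1) by auto
  then have eqs: "a0 = a1 + B y1 \<bullet> (x0 - x1)" "b1 = b0 + A x0 \<bullet> (y1 - y0)"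
    unfolding inner_diff_right AB by linarith+
  show "subgrad H x0 (B y1)"
    unfolding subgrad_iff_le[OF assms(4), of x0] a0(1) a1(1) using eqs(1) by simp
  show "subgrad K y1 (A x0)"
    unfolding subgrad_iff_le[OF assms(3), of y1] b0(1) b1(1) using eqs(2) by simp
  show "A x0 \<bullet> y1 - c = A x0 \<bullet> y0 - b" if "H x0 = ereal a" "K y0 = ereal b" "K y1 = ereal c" for a b c
    using that eqs(2) b0(1) b1(1) by (simp add: inner_diff_right)
qed

text \<open>The test point is \<open>y0 + e\<close>, with \<open>e\<close> from
  \<open>quad_upper_imp_growth\<close> for \<open>K\<close> at \<open>y0\<close>: it accounts for
  the distance of \<open>A x\<close> to \<open>C3\<close>, while the distances of \<open>x\<close>
  to \<open>C1\<close> and \<open>C2\<close> come from the growth of \<open>h1\<close> and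
  \<open>h2\<close>. Linear regularity combines the three. The other half of the gap is the instance
  with primal and dual exchanged.\<close>

lemma partial_gap_growth:
  fixes A :: "'a::euclidean_space \<Rightarrow> 'b::euclidean_space" and B :: "'b \<Rightarrow> 'a"
    and h1 h2 :: "'a \<Rightarrow> ereal" and k1 k2 :: "'b \<Rightarrow> ereal"
  defines "H \<equiv> \<lambda>u. h1 u + h2 u" and "K \<equiv> \<lambda>v. k1 v + k2 v"
  assumes A: "linear A" and AB: "\<And>x y. B y \<bullet> x = - (A x \<bullet> y)"
    and h: "plq_like h1" "plq_like h2" "subgrad_splits h1 h2"
    and k: "plq_like k1" "plq_like k2" "subgrad_splits k1 k2"
    and saddle: "subgrad H x0 (B y0)" "subgrad K y0 (A x0)" and "\<beta> \<ge> 0"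
  defines "X \<equiv> {x. subgrad H x (B y0) \<and> subgrad K y0 (A x)}"
  shows "polyhedron X"
    and "\<exists>c>0. \<forall>x \<xi> a b. H x \<le> ereal \<xi> \<longrightarrow> H x0 = ereal a \<longrightarrow> K y0 = ereal b \<longrightarrow>
      (\<exists>y' \<kappa>. K y' \<le> ereal \<kappa> \<and>
        a + A x0 \<bullet> y0 - b + c * huber (infdist x X) + \<beta> * (norm (y' - y0))\<^sup>2 \<le> \<xi> + A x \<bullet> y' - \<kappa>)"
proof -
  obtain r0 where r0: "{s. subgrad h2 x0 s} = {r0}" "subgrad h1 x0 (B y0 - r0)"
    using h(3) saddle(1) unfolding subgrad_splits_def H_def by blast
  obtain s0 where s0: "{s. subgrad k2 y0 s} = {s0}" "subgrad k1 y0 (A x0 - s0)"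
    using k(3) saddle(2) unfolding subgrad_splits_def K_def by blast
  have r0': "subgrad h2 x0 r0" and s0': "subgrad k2 y0 s0" using r0(1) s0(1) by auto
  define p0 where "p0 = B y0 - r0"
  define C1 where "C1 = {u. subgrad h1 u p0}"
  define C2 where "C2 = {u. subgrad h2 u r0}"
  define C3 where "C3 = {w. subgrad k1 y0 (w - s0)}"
  have K_iff: "subgrad K y0 w \<longleftrightarrow> w \<in> C3" for w
  proof
    assume "subgrad K y0 w"
    then obtain s where "{s. subgrad k2 y0 s} = {s}" "subgrad k1 y0 (w - s)"
      using k(3) unfolding subgrad_splits_def K_def by blast
    then show "w \<in> C3" using s0(1) unfolding C3_def by simp
  next
    assume "w \<in> C3"
    then show "subgrad K y0 w"
      using subgrad_add[OF _ s0', of k1 "w - s0"] unfolding C3_def K_def by simp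
  qed
  have X: "X = C1 \<inter> C2 \<inter> {x. A x + 0 \<in> C3}"
    using subgrad_add_fibre[OF r0(2) r0'] K_iff unfolding X_def C1_def C2_def H_def p0_def by auto
  have "x0 \<in> X" using saddle unfolding X_def by simp
  have h1x0: "subgrad h1 x0 p0" using r0(2) unfolding p0_def .
  have C1: "polyhedron C1" "quad_growth h1 x0 p0" using h(1) h1x0 unfolding plq_like_def C1_def by blast+
  have C2: "polyhedron C2" "quad_growth h2 x0 r0" using h(2) r0' unfolding plq_like_def C2_def by blast+
  have "polyhedron {s. subgrad k1 y0 s}" using k(1) s0(2) unfolding plq_like_def by blast
  from polyhedron_affine_preimage[OF this linear_id, of "- s0"]
  have C3: "polyhedron C3" unfolding C3_def by simp
  have pre: "polyhedron {x. A x + 0 \<in> C3}" using polyhedron_affine_preimage[OF C3 A] .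
  show "polyhedron X" unfolding X using C1(1) C2(1) pre by simp
  obtain \<kappa>1 where \<kappa>1: "\<kappa>1 > 0" "\<And>x. infdist x X \<le> \<kappa>1 * (infdist x (C1 \<inter> C2) + infdist x {x. A x + 0 \<in> C3})"
    using polyhedron_Int_infdist[OF polyhedron_Int[OF C1(1) C2(1)] pre] \<open>x0 \<in> X\<close> unfolding X by blast
  obtain \<kappa>2 where \<kappa>2: "\<kappa>2 > 0" "\<And>x. infdist x (C1 \<inter> C2) \<le> \<kappa>2 * (infdist x C1 + infdist x C2)"
    using polyhedron_Int_infdist[OF C1(1) C2(1)] \<open>x0 \<in> X\<close> unfolding X by blast
  obtain \<kappa>3 where \<kappa>3: "\<kappa>3 > 0" "\<And>x. infdist x {x. A x + 0 \<in> C3} \<le> \<kappa>3 * infdist (A x + 0) C3"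
    using polyhedron_preimage_infdist[OF C3 A, of 0] \<open>x0 \<in> X\<close> unfolding X by blast
  define M where "M = \<kappa>1 * (\<kappa>2 + \<kappa>3)"
  have "M > 0" unfolding M_def using \<kappa>1(1) \<kappa>2(1) \<kappa>3(1) by simp
  have regular: "infdist x X \<le> M * (infdist x C1 + infdist x C2 + infdist (A x) C3)" for x
  proof -
    have "infdist x (C1 \<inter> C2) + infdist x {x. A x + 0 \<in> C3} \<le>
        \<kappa>2 * (infdist x C1 + infdist x C2) + \<kappa>3 * infdist (A x) C3"
      using \<kappa>2(2)[of x] \<kappa>3(2)[of x] by simp
    also have "\<dots> \<le> (\<kappa>2 + \<kappa>3) * (infdist x C1 + infdist x C2 + infdist (A x) C3)"
      using \<kappa>2(1) \<kappa>3(1) infdist_nonneg[of x C1] infdist_nonneg[of x C2] infdist_nonneg[of "A x" C3]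
      by (simp add: algebra_simps)
    finally show ?thesis
      using \<kappa>1 unfolding M_def mult.assoc by (meson less_imp_le mult_left_mono order_trans)
  qed
  \<comment> \<open>\<open>C3\<close> is the translate by \<open>s0\<close> of the subdifferential
    of \<open>k1\<close> at \<open>y0\<close>. For \<open>k2\<close> the subdifferential is a
    singleton, where the normality condition is void, so its bound holds for every short
    \<open>e\<close>.\<close>
  have upper: "quad_upper K y0 C3"
  proof -
    obtain C \<epsilon> where 1: "C \<ge> 0" "\<epsilon> > 0" "\<And>s e. subgrad k1 y0 s \<Longrightarrow> norm e \<le> \<epsilon> \<Longrightarrow>
        (\<forall>s'. subgrad k1 y0 s' \<longrightarrow> (s' - s) \<bullet> e \<le> 0) \<Longrightarrow>
        k1 (y0 + e) \<le> k1 y0 + ereal (s \<bullet> e + C * (norm e)\<^sup>2)"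
    proof -
      have "quad_upper k1 y0 {s. subgrad k1 y0 s}" using k(1) s0(2) unfolding plq_like_def by blast
      then show ?thesis unfolding quad_upper_def using that by blast
    qed
    have "quad_upper k2 y0 {s0}" using k(2) s0' s0(1) unfolding plq_like_def by metis
    then obtain C' \<epsilon>' where 2: "C' \<ge> 0" "\<epsilon>' > 0" "\<And>e. norm e \<le> \<epsilon>' \<Longrightarrow>
        k2 (y0 + e) \<le> k2 y0 + ereal (s0 \<bullet> e + C' * (norm e)\<^sup>2)"
      unfolding quad_upper_def by auto
    obtain b1 b2 where b: "k1 y0 = ereal b1" "k2 y0 = ereal b2"
      using subgrad_real s0(2) s0' by metis
    have "K (y0 + e) \<le> K y0 + ereal (s \<bullet> e + (C + C') * (norm e)\<^sup>2)"
      if "s \<in> C3" "norm e \<le> min \<epsilon> \<epsilon>'" "\<forall>s'\<in>C3. (s' - s) \<bullet> e \<le> 0" for s e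
    proof -
      have "(s' - (s - s0)) \<bullet> e \<le> 0" if "subgrad k1 y0 s'" for s'
        using \<open>\<forall>s'\<in>C3. (s' - s) \<bullet> e \<le> 0\<close>[rule_format, of "s' + s0"] that unfolding C3_def
        by (simp add: algebra_simps)
      then have "k1 (y0 + e) + k2 (y0 + e) \<le>
          (k1 y0 + ereal ((s - s0) \<bullet> e + C * (norm e)\<^sup>2)) + (k2 y0 + ereal (s0 \<bullet> e + C' * (norm e)\<^sup>2))"
        using that by (intro add_mono 1(3) 2(3)) (auto simp: C3_def)
      then show ?thesis unfolding K_def b by (simp add: inner_diff_left algebra_simps)
    qed
    then show ?thesis
      unfolding quad_upper_def using 1(1,2) 2(1,2)
      by (intro exI[of _ "C + C'"] conjI exI[of _ "min \<epsilon> \<epsilon>'"]) auto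
  qed
  have "C3 \<noteq> {}" using saddle(2) K_iff by blast
  obtain c3 where c3: "c3 > 0" "\<And>w. \<exists>e. K (y0 + e) + ereal (c3 * huber (infdist w C3) + \<beta> * (norm e)\<^sup>2) \<le>
      K y0 + ereal (w \<bullet> e)"
    using quad_upper_imp_growth[OF upper polyhedron_imp_convex[OF C3] polyhedron_imp_closed[OF C3]
        \<open>C3 \<noteq> {}\<close> \<open>\<beta> \<ge> 0\<close>] by blast
  have "\<exists>c>0. \<forall>u. h1 x0 + ereal (p0 \<bullet> (u - x0) + c * huber (infdist u C1)) \<le> h1 u"
    using C1(2) unfolding quad_growth_def C1_def .
  then obtain c1 where c1: "c1 > 0" "\<And>u. h1 x0 + ereal (p0 \<bullet> (u - x0) + c1 * huber (infdist u C1)) \<le> h1 u"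
    by blast
  have "\<exists>c>0. \<forall>u. h2 x0 + ereal (r0 \<bullet> (u - x0) + c * huber (infdist u C2)) \<le> h2 u"
    using C2(2) unfolding quad_growth_def C2_def .
  then obtain c2 where c2: "c2 > 0" "\<And>u. h2 x0 + ereal (r0 \<bullet> (u - x0) + c2 * huber (infdist u C2)) \<le> h2 u"
    by blast
  \<comment> \<open>At least one of the three distances in \<open>regular\<close> is at least
    \<open>infdist x X / (3 * M)\<close>; \<open>min k (k\<^sup>2)\<close> is the loss when this
    factor is taken out of \<open>huber\<close>.\<close>
  define k where "k = 1 / (3 * M)"
  have "k > 0" unfolding k_def using \<open>M > 0\<close> by simp
  define c where "c = min c1 (min c2 c3) * min k (k\<^sup>2)"
  have "c > 0" unfolding c_def using c1(1) c2(1) c3(1) \<open>k > 0\<close> by simp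
  have total: "c * huber (infdist x X) \<le>
      c1 * huber (infdist x C1) + c2 * huber (infdist x C2) + c3 * huber (infdist (A x) C3)" for x
  proof -
    let ?d1 = "infdist x C1" and ?d2 = "infdist x C2" and ?d3 = "infdist (A x) C3"
    define m where "m = min c1 (min c2 c3)"
    have m: "m > 0" "m \<le> c1" "m \<le> c2" "m \<le> c3" unfolding m_def using c1(1) c2(1) c3(1) by auto
    have nn: "?d1 \<ge> 0" "?d2 \<ge> 0" "?d3 \<ge> 0" by (rule infdist_nonneg)+
    have g: "0 \<le> c1 * huber ?d1" "0 \<le> c2 * huber ?d2" "0 \<le> c3 * huber ?d3"
      using nn c1(1) c2(1) c3(1) by (auto intro!: mult_nonneg_nonneg huber_nonneg)
    have bound: "m * huber (k * infdist x X) \<le> ci * huber d" if "k * infdist x X \<le> d" "m \<le> ci" for d ci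
      using that m(1) \<open>k > 0\<close>
      by (intro mult_mono huber_mono huber_nonneg mult_nonneg_nonneg) (auto simp: infdist_nonneg)
    have scaled: "c * huber (infdist x X) \<le> m * huber (k * infdist x X)"
      using mult_left_mono[OF huber_scale[OF \<open>k > 0\<close> infdist_nonneg[of x X]], of m] m(1)
      unfolding c_def m_def by (simp add: mult.assoc)
    have average: "r \<le> a \<or> r \<le> b \<or> r \<le> d" if "r \<le> (a + b + d) / 3" for r a b d :: real
    proof (rule ccontr)
      assume "\<not> (r \<le> a \<or> r \<le> b \<or> r \<le> d)"
      then have "a < r" "b < r" "d < r" by auto
      then show False using that by simp
    qed
    have "k * infdist x X \<le> (?d1 + ?d2 + ?d3) / 3"
      using regular[of x] \<open>M > 0\<close> unfolding k_def by (simp add: field_simps)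
    then have "k * infdist x X \<le> ?d1 \<or> k * infdist x X \<le> ?d2 \<or> k * infdist x X \<le> ?d3"
      using average[of "k * infdist x X" ?d1 ?d2 ?d3] by blast
    then consider "k * infdist x X \<le> ?d1" | "k * infdist x X \<le> ?d2" | "k * infdist x X \<le> ?d3"
      by blast
    then have "m * huber (k * infdist x X) \<le> c1 * huber ?d1 + c2 * huber ?d2 + c3 * huber ?d3"
    proof cases
      case 1
      show ?thesis using bound[OF 1 m(2)] g by linarith
    next
      case 2
      show ?thesis using bound[OF 2 m(3)] g by linarith
    next
      case 3
      show ?thesis using bound[OF 3 m(4)] g by linarith
    qed
    with scaled show ?thesis by linarith
  qed
  have "\<exists>y' \<kappa>. K y' \<le> ereal \<kappa> \<and>
      a + A x0 \<bullet> y0 - b + c * huber (infdist x X) + \<beta> * (norm (y' - y0))\<^sup>2 \<le> \<xi> + A x \<bullet> y' - \<kappa>"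
    if "H x \<le> ereal \<xi>" "H x0 = ereal a" "K y0 = ereal b" for x \<xi> a b
  proof -
    obtain e where e: "K (y0 + e) + ereal (c3 * huber (infdist (A x) C3) + \<beta> * (norm e)\<^sup>2) \<le>
        K y0 + ereal (A x \<bullet> e)" using c3(2) by blast
    define \<kappa> where "\<kappa> = b + A x \<bullet> e - c3 * huber (infdist (A x) C3) - \<beta> * (norm e)\<^sup>2"
    have "K (y0 + e) \<le> ereal \<kappa>"
      using e unfolding that(3) \<kappa>_def by (cases "K (y0 + e)") auto
    moreover obtain a1 a2 where a12: "h1 x0 = ereal a1" "h2 x0 = ereal a2"
      using subgrad_real h1x0 r0' by metis
    have "(h1 x0 + ereal (p0 \<bullet> (x - x0) + c1 * huber (infdist x C1))) +
        (h2 x0 + ereal (r0 \<bullet> (x - x0) + c2 * huber (infdist x C2))) \<le> h1 x + h2 x"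
      by (intro add_mono c1(2) c2(2))
    then have "a + (p0 + r0) \<bullet> (x - x0) + c1 * huber (infdist x C1) + c2 * huber (infdist x C2) \<le> \<xi>"
      using that(1,2) unfolding a12 H_def by (cases "h1 x + h2 x") (auto simp: inner_add_left)
    then have "a + (A x0 \<bullet> y0 - A x \<bullet> y0) + c1 * huber (infdist x C1) + c2 * huber (infdist x C2) \<le> \<xi>"
      unfolding p0_def by (simp add: inner_diff_right AB)
    then have "a + A x0 \<bullet> y0 - b + c * huber (infdist x X) + \<beta> * (norm (y0 + e - y0))\<^sup>2 \<le> \<xi> + A x \<bullet> (y0 + e) - \<kappa>"
      using total[of x] unfolding \<kappa>_def by (simp add: inner_add_right)
    ultimately show ?thesis by blast
  qed
  with \<open>c > 0\<close> show "\<exists>c>0. \<forall>x \<xi> a b. H x \<le> ereal \<xi> \<longrightarrow> H x0 = ereal a \<longrightarrow> K y0 = ereal b \<longrightarrow>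
      (\<exists>y' \<kappa>. K y' \<le> ereal \<kappa> \<and>
        a + A x0 \<bullet> y0 - b + c * huber (infdist x X) + \<beta> * (norm (y' - y0))\<^sup>2 \<le> \<xi> + A x \<bullet> y' - \<kappa>)"
    by blast
qed

section \<open>Uniformity over the reference points\<close>

lemma convex_ereal_addD:
  assumes k: "convex_ereal k1" "convex_ereal k2" "\<And>x. k1 x \<noteq> -\<infinity>" "\<And>x. k2 x \<noteq> -\<infinity>"
    and "k1 u + k2 u \<le> ereal a" "k1 v + k2 v \<le> ereal b" "0 \<le> t" "t \<le> 1"
  shows "k1 ((1 - t) *\<^sub>R u + t *\<^sub>R v) + k2 ((1 - t) *\<^sub>R u + t *\<^sub>R v) \<le> ereal ((1 - t) * a + t * b)"
proof -
  obtain a1 a2 where u: "k1 u = ereal a1" "k2 u = ereal a2" "a1 + a2 \<le> a"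
    using assms(5) k(3,4)[of u] by (cases "k1 u"; cases "k2 u") auto
  obtain b1 b2 where v: "k1 v = ereal b1" "k2 v = ereal b2" "b1 + b2 \<le> b"
    using assms(6) k(3,4)[of v] by (cases "k1 v"; cases "k2 v") auto
  have "k1 ((1 - t) *\<^sub>R u + t *\<^sub>R v) + k2 ((1 - t) *\<^sub>R u + t *\<^sub>R v) \<le>
      ereal ((1 - t) * a1 + t * b1) + ereal ((1 - t) * a2 + t * b2)"
    using u v assms(7,8) k(1,2) by (intro add_mono convex_erealD) auto
  also have "\<dots> = ereal ((1 - t) * (a1 + a2) + t * (b1 + b2))" by (simp add: algebra_simps)
  also have "\<dots> \<le> ereal ((1 - t) * a + t * b)"
    using u(3) v(3) assms(7,8) by (simp add: add_mono mult_left_mono)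
  finally show ?thesis .
qed

lemma norm_convex_comb_squared_le:
  fixes a b :: "'a::real_inner"
  assumes "0 \<le> t" "t \<le> 1"
  shows "(norm ((1 - t) *\<^sub>R a + t *\<^sub>R b))\<^sup>2 \<le> (1 - t) * (norm a)\<^sup>2 + t * (norm b)\<^sup>2"
proof -
  have "(1 - t) * (norm a)\<^sup>2 + t * (norm b)\<^sup>2 - (norm ((1 - t) *\<^sub>R a + t *\<^sub>R b))\<^sup>2 =
      (1 - t) * t * (norm (a - b))\<^sup>2"
    unfolding power2_norm_eq_inner
    by (simp add: inner_add_left inner_add_right inner_diff_left inner_diff_right inner_commute algebra_simps)
  also have "\<dots> \<ge> 0" using assms by simp
  finally show ?thesis by linarith
qed

text \<open>For fixed \<open>x\<close> the partial gap is concave and nonnegative as a function of the second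
  component \<open>y1\<close> of the reference saddle point, so it is nondecreasing along recession directions
  and its infimum is attained at one of finitely many points that do not depend on \<open>x\<close>.\<close>

lemma partial_gap_growth_uniform:
  fixes A :: "'a::euclidean_space \<Rightarrow> 'b::euclidean_space" and B :: "'b \<Rightarrow> 'a"
    and h1 h2 :: "'a \<Rightarrow> ereal" and k1 k2 :: "'b \<Rightarrow> ereal"
  defines "H \<equiv> \<lambda>u. h1 u + h2 u" and "K \<equiv> \<lambda>v. k1 v + k2 v"
  assumes A: "linear A" and B: "linear B" and AB: "\<And>x y. B y \<bullet> x = - (A x \<bullet> y)"
    and h: "plq_like h1" "plq_like h2" "subgrad_splits h1 h2"
    and k: "plq_like k1" "plq_like k2" "subgrad_splits k1 k2"
    and saddle: "subgrad H x0 (B y0)" "subgrad K y0 (A x0)" and "\<beta> \<ge> 0"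
    and val: "H x0 = ereal a" "K y0 = ereal b"
  defines "X \<equiv> {x. subgrad H x (B y0) \<and> subgrad K y0 (A x)}"
    and "Y \<equiv> {y. subgrad H x0 (B y) \<and> subgrad K y (A x0)}"
  shows "\<exists>c>0. \<forall>y1\<in>Y. \<forall>x \<xi>. H x \<le> ereal \<xi> \<longrightarrow> (\<exists>y' \<kappa>. K y' \<le> ereal \<kappa> \<and>
    a + A x0 \<bullet> y0 - b + c * huber (infdist x X) + \<beta> * (norm (y' - y1))\<^sup>2 \<le> \<xi> + A x \<bullet> y' - \<kappa>)"
proof -
  define L where "L = a + A x0 \<bullet> y0 - b"
  have BA: "A x \<bullet> y = - (B y \<bullet> x)" for x y using AB by simp
  have Kconv: "K ((1 - t) *\<^sub>R u + t *\<^sub>R v) \<le> ereal ((1 - t) * p + t * q)"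
    if "K u \<le> ereal p" "K v \<le> ereal q" "0 \<le> t" "t \<le> 1" for u v p q t
    using that k(1,2) unfolding K_def plq_like_def by (intro convex_ereal_addD) auto
  have polyY: "polyhedron Y"
    using partial_gap_growth(1)[OF B BA k h, of y0 x0 0] saddle unfolding Y_def H_def K_def
    by (simp add: conj_commute)
  have Y: "subgrad H x0 (B y1)" "subgrad K y1 (A x0)"
      "X = {x. subgrad H x (B y1) \<and> subgrad K y1 (A x)}"
      "\<exists>b1. K y1 = ereal b1 \<and> a + A x0 \<bullet> y1 - b1 = L" if "y1 \<in> Y" for y1
  proof -
    show y1: "subgrad H x0 (B y1)" "subgrad K y1 (A x0)" using that unfolding Y_def by auto
    show "X = {x. subgrad H x (B y1) \<and> subgrad K y1 (A x)}"
      using saddle_exchange(1,2)[of B A H, OF AB _ _ y1] saddle_exchange(1,2)[of B A H, OF AB _ _ saddle]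
      unfolding X_def by blast
    obtain b1 where b1: "K y1 = ereal b1" using subgrad_real[OF y1(2)] by blast
    then show "\<exists>b1. K y1 = ereal b1 \<and> a + A x0 \<bullet> y1 - b1 = L"
      using saddle_exchange(3)[of B A H, OF AB saddle y1 val b1] unfolding L_def by simp
  qed
  \<comment> \<open>The choice \<open>y' = y1\<close> incurs no penalty and shows that the partial
    gap is nonnegative.\<close>
  have base: "\<exists>\<kappa>. K y1 = ereal \<kappa> \<and> L \<le> \<xi> + A x \<bullet> y1 - \<kappa>" if "y1 \<in> Y" "H x \<le> ereal \<xi>" for y1 x \<xi>
  proof -
    obtain b1 where b1: "K y1 = ereal b1" "a + A x0 \<bullet> y1 - b1 = L" using Y(4)[OF \<open>y1 \<in> Y\<close>] by blast
    have "ereal (a + B y1 \<bullet> (x - x0)) \<le> H x" using Y(1)[OF that(1)] val(1) unfolding subgrad_def by simp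
    with that(2) have "a + B y1 \<bullet> (x - x0) \<le> \<xi>" by (metis ereal_less_eq(3) order_trans)
    then show ?thesis using b1 by (simp add: inner_diff_right AB)
  qed
  obtain V where V: "finite V" "V \<subseteq> Y" "\<And>W. V \<subseteq> W \<Longrightarrow> convex W \<Longrightarrow>
      (\<forall>p\<in>W \<inter> Y. \<forall>d. (\<forall>t\<ge>0. p + t *\<^sub>R d \<in> Y) \<longrightarrow> p + d \<in> W) \<Longrightarrow> Y \<subseteq> W"
    using polyhedron_generated[OF polyY] by blast
  define good where "good c y1 \<longleftrightarrow> (\<forall>x \<xi>. H x \<le> ereal \<xi> \<longrightarrow> (\<exists>y' \<kappa>. K y' \<le> ereal \<kappa> \<and>
    L + c * huber (infdist x X) + \<beta> * (norm (y' - y1))\<^sup>2 \<le> \<xi> + A x \<bullet> y' - \<kappa>))" for c y1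
  have "\<exists>c>0. \<forall>v\<in>V. good c v"
  proof (rule finite_uniform_pos[OF V(1)])
    fix v assume "v \<in> V"
    then have v: "v \<in> Y" using V(2) by blast
    obtain b1 where b1: "K v = ereal b1" "a + A x0 \<bullet> v - b1 = L" using Y(4)[OF v] by blast
    have "\<exists>c>0. \<forall>x \<xi> a b. H x \<le> ereal \<xi> \<longrightarrow> H x0 = ereal a \<longrightarrow> K v = ereal b \<longrightarrow>
      (\<exists>y' \<kappa>. K y' \<le> ereal \<kappa> \<and>
        a + A x0 \<bullet> v - b + c * huber (infdist x X) + \<beta> * (norm (y' - v))\<^sup>2 \<le> \<xi> + A x \<bullet> y' - \<kappa>)"
      using partial_gap_growth(2)[OF A AB h k Y(1)[OF v, unfolded H_def] Y(2)[OF v, unfolded K_def] \<open>\<beta> \<ge> 0\<close>]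
      unfolding Y(3)[OF v] H_def K_def .
    then obtain c where "c > 0" and c: "\<And>x \<xi> a b. H x \<le> ereal \<xi> \<Longrightarrow> H x0 = ereal a \<Longrightarrow> K v = ereal b \<Longrightarrow>
      (\<exists>y' \<kappa>. K y' \<le> ereal \<kappa> \<and>
        a + A x0 \<bullet> v - b + c * huber (infdist x X) + \<beta> * (norm (y' - v))\<^sup>2 \<le> \<xi> + A x \<bullet> y' - \<kappa>)"
      by blast
    have "good c v"
      unfolding good_def b1(2)[symmetric] using c[OF _ val(1) b1(1)] by blast
    with \<open>c > 0\<close> show "\<exists>c>0. good c v" by blast
  next
    fix v and c c' :: real assume *: "good c v" "c' \<le> c"
    have le: "c' * huber (infdist x X) \<le> c * huber (infdist x X)" for x
      using *(2) by (intro mult_right_mono huber_nonneg infdist_nonneg)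
    show "good c' v"
      unfolding good_def
    proof (intro allI impI)
      fix x \<xi> assume "H x \<le> ereal \<xi>"
      then obtain y' \<kappa> where "K y' \<le> ereal \<kappa>"
          "L + c * huber (infdist x X) + \<beta> * (norm (y' - v))\<^sup>2 \<le> \<xi> + A x \<bullet> y' - \<kappa>"
        using *(1) unfolding good_def by blast
      then show "\<exists>y' \<kappa>. K y' \<le> ereal \<kappa> \<and>
          L + c' * huber (infdist x X) + \<beta> * (norm (y' - v))\<^sup>2 \<le> \<xi> + A x \<bullet> y' - \<kappa>"
        using le[of x] by (intro exI[of _ y'] exI[of _ \<kappa>]) linarith
    qed
  qed
  then obtain c where "c > 0" and c: "\<And>v. v \<in> V \<Longrightarrow> good c v" by blast
  \<comment> \<open>On the finite set \<open>V\<close> the constant is \<open>c\<close>; on all of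
    \<open>Y\<close> only values \<open>m' < m\<close> are reached, and \<open>m / 2\<close> is
    taken among them.\<close>
  have "good (c / 2) y1" if "y1 \<in> Y" for y1
    unfolding good_def
  proof (intro allI impI)
    fix x \<xi> assume x: "H x \<le> ereal \<xi>"
    define m where "m = c * huber (infdist x X)"
    have "m \<ge> 0" unfolding m_def using \<open>c > 0\<close> by (simp add: huber_nonneg infdist_nonneg)
    show "\<exists>y' \<kappa>. K y' \<le> ereal \<kappa> \<and>
        L + c / 2 * huber (infdist x X) + \<beta> * (norm (y' - y1))\<^sup>2 \<le> \<xi> + A x \<bullet> y' - \<kappa>"
    proof (cases "m = 0")
      case True
      obtain \<kappa> where "K y1 = ereal \<kappa>" "L \<le> \<xi> + A x \<bullet> y1 - \<kappa>" using base[OF \<open>y1 \<in> Y\<close> x] by blast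
      then show ?thesis using True \<open>c > 0\<close> unfolding m_def by (intro exI[of _ y1] exI[of _ \<kappa>]) auto
    next
      case False
      then have "m > 0" using \<open>m \<ge> 0\<close> by simp
      \<comment> \<open>The partial gap with reference \<open>y\<close> is at least
        \<open>m'\<close>, with a witness. The supremum behind it need not be attained, so the
        superlevel set \<open>W\<close> at \<open>m\<close> asks for every
        \<open>m' < m\<close>.\<close>
      define slack where "slack y m' \<longleftrightarrow> (\<exists>y' \<kappa>. K y' \<le> ereal \<kappa> \<and>
          L + m' + \<beta> * (norm (y' - y))\<^sup>2 \<le> \<xi> + A x \<bullet> y' - \<kappa>)" for y m'
      define W where "W = {y. \<forall>m'<m. slack y m'}"
      have "Y \<subseteq> W"
      proof (rule V(3))
        show "V \<subseteq> W"
        proof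
          fix v assume "v \<in> V"
          then obtain y' \<kappa> where *: "K y' \<le> ereal \<kappa>" "L + m + \<beta> * (norm (y' - v))\<^sup>2 \<le> \<xi> + A x \<bullet> y' - \<kappa>"
            using c x unfolding good_def m_def by blast
          then show "v \<in> W" unfolding W_def slack_def by (auto intro!: exI[of _ y'] exI[of _ \<kappa>])
        qed
        show "convex W"
          unfolding convex_alt
        proof (intro ballI allI impI)
          fix y z and t :: real assume yz: "y \<in> W" "z \<in> W" and t: "0 \<le> t \<and> t \<le> 1"
          have "slack ((1 - t) *\<^sub>R y + t *\<^sub>R z) m'" if "m' < m" for m'
          proof -
            obtain y' \<kappa> where y': "K y' \<le> ereal \<kappa>" "L + m' + \<beta> * (norm (y' - y))\<^sup>2 \<le> \<xi> + A x \<bullet> y' - \<kappa>"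
              using yz(1) \<open>m' < m\<close> unfolding W_def slack_def by blast
            obtain z' \<mu> where z': "K z' \<le> ereal \<mu>" "L + m' + \<beta> * (norm (z' - z))\<^sup>2 \<le> \<xi> + A x \<bullet> z' - \<mu>"
              using yz(2) \<open>m' < m\<close> unfolding W_def slack_def by blast
            let ?w = "(1 - t) *\<^sub>R y' + t *\<^sub>R z'" and ?\<nu> = "(1 - t) * \<kappa> + t * \<mu>"
            have "?w - ((1 - t) *\<^sub>R y + t *\<^sub>R z) = (1 - t) *\<^sub>R (y' - y) + t *\<^sub>R (z' - z)"
              by (simp add: algebra_simps)
            then have "\<beta> * (norm (?w - ((1 - t) *\<^sub>R y + t *\<^sub>R z)))\<^sup>2 \<le>
                \<beta> * ((1 - t) * (norm (y' - y))\<^sup>2 + t * (norm (z' - z))\<^sup>2)"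
              using norm_convex_comb_squared_le[of t "y' - y" "z' - z"] t \<open>\<beta> \<ge> 0\<close> by (simp add: mult_left_mono)
            moreover have "(1 - t) * (L + m' + \<beta> * (norm (y' - y))\<^sup>2) + t * (L + m' + \<beta> * (norm (z' - z))\<^sup>2) \<le>
                (1 - t) * (\<xi> + A x \<bullet> y' - \<kappa>) + t * (\<xi> + A x \<bullet> z' - \<mu>)"
              using y'(2) z'(2) t by (intro add_mono mult_left_mono) auto
            ultimately have "L + m' + \<beta> * (norm (?w - ((1 - t) *\<^sub>R y + t *\<^sub>R z)))\<^sup>2 \<le> \<xi> + A x \<bullet> ?w - ?\<nu>"
              by (simp add: inner_add_right algebra_simps)
            moreover have "K ?w \<le> ereal ?\<nu>" using Kconv[OF y'(1) z'(1)] t by simp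
            ultimately show ?thesis unfolding slack_def by blast
          qed
          then show "(1 - t) *\<^sub>R y + t *\<^sub>R z \<in> W" unfolding W_def by blast
        qed
        show "\<forall>p\<in>W \<inter> Y. \<forall>d. (\<forall>t\<ge>0. p + t *\<^sub>R d \<in> Y) \<longrightarrow> p + d \<in> W"
        proof (intro ballI allI impI)
          fix p d assume p: "p \<in> W \<inter> Y" and d: "\<forall>t\<ge>0. p + t *\<^sub>R d \<in> Y"
          have "slack (p + d) m'" if "m' < m" for m'
          proof -
            define n where "n = max m' 0"
            have n: "0 \<le> n" "n < m" "m' \<le> n" unfolding n_def using that \<open>m > 0\<close> by auto
            define m'' where "m'' = (n + m) / 2"
            have m'': "n < m''" "m'' < m" "0 < m''" unfolding m''_def using n by auto
            obtain y' \<kappa> where y': "K y' \<le> ereal \<kappa>" "L + m'' + \<beta> * (norm (y' - p))\<^sup>2 \<le> \<xi> + A x \<bullet> y' - \<kappa>"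
              using p m''(2) unfolding W_def slack_def by blast
            \<comment> \<open>\<open>p + d\<close> is the convex combination of \<open>p\<close> and
              the distant point \<open>q\<close> of \<open>Y\<close> with weights
              \<open>1 - r\<close> and \<open>r\<close>. The partial gap is at least
              \<open>m''\<close> at \<open>p\<close> and at least 0 at \<open>q\<close>, so
              concavity leaves \<open>(1 - r) * m'' = n\<close>.\<close>
            define r where "r = (m'' - n) / m''"
            have r: "0 < r" "r \<le> 1" "(1 - r) * m'' = n"
              using m'' n unfolding r_def by (auto simp: field_simps)
            define q where "q = p + (1 / r) *\<^sub>R d"
            have "q \<in> Y" unfolding q_def using d r(1) by simp
            then obtain \<mu> where q: "K q \<le> ereal \<mu>" "L \<le> \<xi> + A x \<bullet> q - \<mu>" using base[OF _ x] by force
            let ?w = "(1 - r) *\<^sub>R y' + r *\<^sub>R q" and ?\<nu> = "(1 - r) * \<kappa> + r * \<mu>"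
            have "?w - (p + d) = (1 - r) *\<^sub>R (y' - p)"
              unfolding q_def using r(1) by (simp add: algebra_simps)
            then have "(norm (?w - (p + d)))\<^sup>2 = (1 - r) * ((1 - r) * (norm (y' - p))\<^sup>2)"
              using r by (simp add: power_mult_distrib power2_eq_square)
            also have "\<dots> \<le> (1 - r) * (norm (y' - p))\<^sup>2"
              using r by (intro mult_left_mono) (auto simp: mult_left_le_one_le)
            finally have "\<beta> * (norm (?w - (p + d)))\<^sup>2 \<le> \<beta> * ((1 - r) * (norm (y' - p))\<^sup>2)"
              using \<open>\<beta> \<ge> 0\<close> by (rule mult_left_mono)
            moreover have "(1 - r) * (L + m'' + \<beta> * (norm (y' - p))\<^sup>2) + r * L \<le>
                (1 - r) * (\<xi> + A x \<bullet> y' - \<kappa>) + r * (\<xi> + A x \<bullet> q - \<mu>)"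
              using y'(2) q(2) r by (intro add_mono mult_left_mono) auto
            moreover have "(1 - r) * (L + m'' + \<beta> * (norm (y' - p))\<^sup>2) + r * L =
                L + n + \<beta> * ((1 - r) * (norm (y' - p))\<^sup>2)"
              unfolding r(3)[symmetric] by (simp add: algebra_simps)
            moreover have "(1 - r) * (\<xi> + A x \<bullet> y' - \<kappa>) + r * (\<xi> + A x \<bullet> q - \<mu>) = \<xi> + A x \<bullet> ?w - ?\<nu>"
              by (simp add: inner_add_right algebra_simps)
            ultimately have "L + m' + \<beta> * (norm (?w - (p + d)))\<^sup>2 \<le> \<xi> + A x \<bullet> ?w - ?\<nu>"
              using n(3) by linarith
            moreover have "K ?w \<le> ereal ?\<nu>" using Kconv[OF y'(1) q(1)] r by simp
            ultimately show ?thesis unfolding slack_def by blast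
          qed
          then show "p + d \<in> W" unfolding W_def by blast
        qed
      qed
      then have "slack y1 (m / 2)" using \<open>y1 \<in> Y\<close> \<open>m > 0\<close> unfolding W_def by auto
      then show ?thesis unfolding slack_def m_def by simp
    qed
  qed
  then show ?thesis
    unfolding good_def L_def using \<open>c > 0\<close> by (intro exI[of _ "c / 2"]) auto
qed

section \<open>The Lagrangian, the weighted distance and the conclusion\<close>

lemma ereal_diff_add_eq:
  fixes a b c :: ereal
  assumes "b \<noteq> -\<infinity>" "c \<noteq> -\<infinity>"
  shows "a - b - c = a - (b + c)"
  using assms by (cases a; cases b; cases c) auto

text \<open>The substance is finiteness at a saddle point, under the convention
  \<open>\<infinity> - \<infinity> = \<infinity>\<close>: comparison with a point where
  \<open>f + f2\<close> is finite excludes \<open>H x = \<infinity>\<close>, and after that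
  comparison with a point where both conjugates are finite excludes
  \<open>K y = \<infinity>\<close>. For finite values, the two optimality conditions are the
  subgradient inclusions.\<close>

lemma saddle_points_lagrangian:
  fixes A :: "'a::euclidean_space \<Rightarrow> 'b::euclidean_space"
  assumes AB: "\<And>x y. B y \<bullet> x = - (A x \<bullet> y)"
    and f: "\<And>x. f x + f2 x \<noteq> -\<infinity>" "\<exists>x. f x + f2 x < \<infinity>"
    and g: "\<And>y. conjugate g y \<noteq> -\<infinity>" "\<And>y. conjugate g2 y \<noteq> -\<infinity>" "\<exists>y. conjugate g y + conjugate g2 y < \<infinity>"
  shows "saddle_points (lagrangian A f f2 g g2) =
    {(x, y). subgrad (\<lambda>u. f u + f2 u) x (B y) \<and> subgrad (\<lambda>v. conjugate g v + conjugate g2 v) y (A x)}"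
proof -
  define H where "H u = f u + f2 u" for u
  define K where "K v = conjugate g v + conjugate g2 v" for v
  have L: "lagrangian A f f2 g g2 x y = H x + ereal (A x \<bullet> y) - K y" for x y
    unfolding lagrangian_def H_def K_def by (rule ereal_diff_add_eq[OF g(1,2)])
  have H: "H x \<noteq> -\<infinity>" for x using f(1) unfolding H_def .
  have K: "K y \<noteq> -\<infinity>" for y 
    using g(1,2)[of y] unfolding K_def by (cases "conjugate g y"; cases "conjugate g2 y") auto
  have "(\<forall>y'. H x + ereal (A x \<bullet> y') - K y' \<le> H x + ereal (A x \<bullet> y) - K y) \<and>
      (\<forall>x'. H x + ereal (A x \<bullet> y) - K y \<le> H x' + ereal (A x' \<bullet> y) - K y) \<longleftrightarrow>
      subgrad H x (B y) \<and> subgrad K y (A x)" (is "?l \<longleftrightarrow> ?r") for x y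
  proof
    assume l: ?l
    obtain x1 where "H x1 < \<infinity>" using f(2) unfolding H_def by blast
    then obtain a1 where "H x1 = ereal a1" using H[of x1] by (cases "H x1") auto
    then have "H x + ereal (A x \<bullet> y) - K y < \<infinity>"
      using l[THEN conjunct2, rule_format, of x1] K[of y] by (cases "K y") auto
    then obtain a where a: "H x = ereal a" using H[of x] by (cases "H x") auto
    obtain y1 where "K y1 < \<infinity>" using g(3) unfolding K_def by blast
    then obtain b1 where "K y1 = ereal b1" using K[of y1] by (cases "K y1") auto
    then obtain b where b: "K y = ereal b"
      using l[THEN conjunct1, rule_format, of y1] a K[of y] by (cases "K y") auto
    have "subgrad H x (B y)"
    proof (rule subgradI[of H, OF a])
      fix u
      show "ereal (a + B y \<bullet> (u - x)) \<le> H u"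
        using l[THEN conjunct2, rule_format, of u] a b H[of u]
        by (cases "H u") (auto simp: inner_diff_right AB)
    qed
    moreover have "subgrad K y (A x)"
    proof (rule subgradI[of K, OF b])
      fix u
      show "ereal (b + A x \<bullet> (u - y)) \<le> K u"
        using l[THEN conjunct1, rule_format, of u] a b K[of u]
        by (cases "K u") (auto simp: inner_diff_right)
    qed
    ultimately show ?r by blast
  next
    assume r: ?r
    obtain a where a: "H x = ereal a" "\<And>u. ereal (a + B y \<bullet> (u - x)) \<le> H u"
      using subgrad_real[of H x "B y"] r by blast
    obtain b where b: "K y = ereal b" "\<And>u. ereal (b + A x \<bullet> (u - y)) \<le> K u"
      using subgrad_real[of K y "A x"] r by blast
    show ?l
    proof (intro conjI allI)
      show "H x + ereal (A x \<bullet> y') - K y' \<le> H x + ereal (A x \<bullet> y) - K y" for y'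
        using b(2)[of y'] unfolding a(1) b(1) by (cases "K y'") (auto simp: inner_diff_right)
      show "H x + ereal (A x \<bullet> y) - K y \<le> H x' + ereal (A x' \<bullet> y) - K y" for x'
        using a(2)[of x'] unfolding a(1) b(1) by (cases "H x'") (auto simp: inner_diff_right AB)
    qed
  qed
  then show ?thesis unfolding saddle_points_def L H_def K_def by auto
qed


lemma dist_V_squared_le:
  fixes X :: "'a::euclidean_space set" and Y :: "'b::euclidean_space set"
  assumes "\<tau> > 0" "\<sigma> > 0" "closed X" "closed Y" "X \<noteq> {}" "Y \<noteq> {}"
  shows "(dist_V \<tau> \<sigma> (x, y) (X \<times> Y))\<^sup>2 \<le> 1/\<tau> * (infdist x X)\<^sup>2 + 1/\<sigma> * (infdist y Y)\<^sup>2"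
proof -
  obtain p where p: "p \<in> X" "infdist x X = dist x p" using infdist_attains_inf assms(3,5) by blast
  obtain q where q: "q \<in> Y" "infdist y Y = dist y q" using infdist_attains_inf assms(4,6) by blast
  let ?R = "1/\<tau> * (infdist x X)\<^sup>2 + 1/\<sigma> * (infdist y Y)\<^sup>2"
  have nonneg: "norm_V \<tau> \<sigma> w \<ge> 0" for w :: "'a \<times> 'b"
    unfolding norm_V_def using assms(1,2) by simp
  have "dist_V \<tau> \<sigma> (x, y) (X \<times> Y) \<le> norm_V \<tau> \<sigma> ((x, y) - (p, q))"
    unfolding dist_V_def using p(1) q(1) nonneg by (intro cINF_lower bdd_belowI2[of _ 0]) auto
  also have "\<dots> = sqrt ?R" unfolding norm_V_def p(2) q(2) by (simp add: dist_norm)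
  finally have le: "dist_V \<tau> \<sigma> (x, y) (X \<times> Y) \<le> sqrt ?R" .
  have "dist_V \<tau> \<sigma> (x, y) (X \<times> Y) \<ge> 0"
    unfolding dist_V_def using assms(5,6) nonneg by (intro cINF_greatest) auto
  with le have "(dist_V \<tau> \<sigma> (x, y) (X \<times> Y))\<^sup>2 \<le> (sqrt ?R)\<^sup>2" by (intro power_mono)
  also have "\<dots> = ?R" using assms(1,2) by (intro real_sqrt_pow2) simp
  finally show ?thesis .
qed

theorem proposition12:
  fixes f f2 :: "'a::euclidean_space \<Rightarrow> ereal"
    and g g2 :: "'b::euclidean_space \<Rightarrow> ereal"
    and A :: "'a \<Rightarrow> 'b"
    and \<tau> \<sigma> :: real
    and Zs :: "('a \<times> 'b) set"
  assumes "proper_lsc_convex f" and "proper_lsc_convex f2"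
    and "proper_lsc_convex g" and "proper_lsc_convex g2"
    and "linear A"
    and "lipschitz_gradient f2" and "lipschitz_gradient (conjugate g2)"
    and "\<tau> > 0" and "\<sigma> > 0"
    and Zs_def: "Zs = saddle_points (lagrangian A f f2 g g2)"
    and "Zs \<noteq> {}"
    and "piecewise_linear_quadratic f" and "piecewise_linear_quadratic f2"
    and "piecewise_linear_quadratic g" and "piecewise_linear_quadratic g2"
  shows "\<forall>\<beta> \<in> {0..} \<times> {0..}. \<exists>\<eta>::real. \<exists>R. \<eta> > 0 \<and> open R \<and> Zs \<subseteq> R \<and>
           (\<forall>z\<in>R. \<forall>zs\<in>Zs.
              smoothed_gap A f f2 g g2 \<tau> \<sigma> \<beta> z zs \<ge> ereal (\<eta> / 2 * (dist_V \<tau> \<sigma> z Zs)\<^sup>2))"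
proof
  fix \<beta> :: "real \<times> real" assume "\<beta> \<in> {0..} \<times> {0..}"
  then obtain \<beta>x \<beta>y where \<beta>: "\<beta> = (\<beta>x, \<beta>y)" "\<beta>x \<ge> 0" "\<beta>y \<ge> 0" by auto
  \<comment> \<open>With minus the adjoint as \<open>B\<close>, the problem is symmetric under
    exchanging \<open>H\<close> with \<open>K\<close> and \<open>A\<close> with \<open>B\<close>, so
    each half of the gap is an instance of the same lemma.\<close>
  define B where "B y = - adjoint A y" for y
  have "linear B"
    unfolding B_def using adjoint_linear[OF \<open>linear A\<close>] by (intro linear_compose_neg)
  have AB: "B y \<bullet> x = - (A x \<bullet> y)" for x y
    unfolding B_def using adjoint_works[OF \<open>linear A\<close>, of x y] by (simp add: inner_commute)
  have BA: "A x \<bullet> y = - (B y \<bullet> x)" for x y using AB by simp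
  define H where "H u = f u + f2 u" for u
  define K where "K v = conjugate g v + conjugate g2 v" for v
  have plq: "plq_like f" "plq_like f2" "plq_like (conjugate g)" "plq_like (conjugate g2)"
    using assms by (auto intro: plq_imp_plq_like plq_like_conjugate)
  have splits: "subgrad_splits f f2" "subgrad_splits (conjugate g) (conjugate g2)"
    using plq assms unfolding plq_like_def by (auto intro!: lipschitz_gradient_splits)
  have H_MInf: "H x \<noteq> -\<infinity>" for x
  proof -
    have "f x \<noteq> -\<infinity>" "f2 x \<noteq> -\<infinity>" using plq(1,2) unfolding plq_like_def by auto
    then show ?thesis unfolding H_def by (cases "f x"; cases "f2 x") auto
  qed
  have K_MInf: "K y \<noteq> -\<infinity>" for y
  proof -
    have "conjugate g y \<noteq> -\<infinity>" "conjugate g2 y \<noteq> -\<infinity>" using plq(3,4) unfolding plq_like_def by auto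
    then show ?thesis unfolding K_def by (cases "conjugate g y"; cases "conjugate g2 y") auto
  qed
  have lag: "lagrangian A f f2 g g2 x y = H x + ereal (A x \<bullet> y) - K y" for x y
    unfolding lagrangian_def H_def K_def using plq(3,4) unfolding plq_like_def
    by (intro ereal_diff_add_eq) auto
  have f2_fin: "\<bar>f2 x\<bar> \<noteq> \<infinity>" and g2_fin: "\<bar>conjugate g2 y\<bar> \<noteq> \<infinity>" for x y
    using assms(6,7) unfolding lipschitz_gradient_def by auto
  have Z: "Zs = {(x, y). subgrad H x (B y) \<and> subgrad K y (A x)}"
    unfolding Zs_def H_def K_def
  proof (rule saddle_points_lagrangian[OF AB])
    obtain x where "f x < \<infinity>" using assms(1) unfolding proper_lsc_convex_def proper_def edom_def by auto
    then show "\<exists>x. f x + f2 x < \<infinity>" using f2_fin[of x] by (intro exI[of _ x]) (cases "f2 x"; auto)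
    \<comment> \<open>A proper convex function with closed epigraph has an affine minorant, so its
      conjugate is finite somewhere.\<close>
    have "\<exists>v c. conjugate g v \<le> ereal c"
      using fenchel_moreau_le(1)[of g] assms(3,14) plq_epigraph_closed unfolding proper_lsc_convex_def by blast
    then obtain v c where "conjugate g v \<le> ereal c" by blast
    then show "\<exists>y. conjugate g y + conjugate g2 y < \<infinity>"
      using g2_fin[of v] by (intro exI[of _ v]) (cases "conjugate g v"; cases "conjugate g2 v"; auto)
  qed (use H_MInf plq in \<open>auto simp: H_def plq_like_def\<close>)
  obtain x0 y0 where saddle: "subgrad H x0 (B y0)" "subgrad K y0 (A x0)"
    using \<open>Zs \<noteq> {}\<close> unfolding Z by auto
  obtain a where a: "H x0 = ereal a" using subgrad_real[OF saddle(1)] by blast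
  obtain b where b: "K y0 = ereal b" using subgrad_real[OF saddle(2)] by blast
  define X where "X = {x. subgrad H x (B y0) \<and> subgrad K y0 (A x)}"
  define Y where "Y = {y. subgrad H x0 (B y) \<and> subgrad K y (A x0)}"
  have ZXY: "Zs = X \<times> Y"
  proof (intro equalityI subsetI)
    fix z assume "z \<in> Zs"
    then obtain x y where z: "z = (x, y)" "subgrad H x (B y)" "subgrad K y (A x)" unfolding Z by auto
    show "z \<in> X \<times> Y"
      using saddle_exchange(1,2)[of B A H, OF AB z(2,3) saddle]
        saddle_exchange(1,2)[of B A H, OF AB saddle z(2,3)] unfolding z X_def Y_def by simp
  next
    fix z assume "z \<in> X \<times> Y"
    then obtain x y where z: "z = (x, y)" "subgrad H x (B y0)" "subgrad K y0 (A x)"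
        "subgrad H x0 (B y)" "subgrad K y (A x0)" unfolding X_def Y_def by auto
    show "z \<in> Zs"
      using saddle_exchange(1,2)[of B A H, OF AB z(2-5)] unfolding Z z(1) by simp
  qed
  have "polyhedron X"
    using partial_gap_growth(1)[OF \<open>linear A\<close> AB plq(1,2) splits(1) plq(3,4) splits(2), of x0 y0 0] saddle
    unfolding X_def H_def K_def by simp
  have "polyhedron Y"
    using partial_gap_growth(1)[OF \<open>linear B\<close> BA plq(3,4) splits(2) plq(1,2) splits(1), of y0 x0 0] saddle
    unfolding Y_def H_def K_def by (simp add: conj_commute)
  have "x0 \<in> X" "y0 \<in> Y" using saddle unfolding X_def Y_def by auto
  define cx where "cx = \<beta>x / (2 * \<tau>)"
  define cy where "cy = \<beta>y / (2 * \<sigma>)"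
  have "cx \<ge> 0" "cy \<ge> 0" unfolding cx_def cy_def using \<beta> \<open>\<tau> > 0\<close> \<open>\<sigma> > 0\<close> by auto
  define L where "L = a + A x0 \<bullet> y0 - b"
  \<comment> \<open>The exchange of roles reverses the sign of the saddle value, which therefore
    cancels when the two halves are added.\<close>
  have L': "b + B y0 \<bullet> x0 - a = - L" unfolding L_def AB by simp
  have "\<exists>c>0. \<forall>ys\<in>Y. \<forall>x \<xi>. H x \<le> ereal \<xi> \<longrightarrow> (\<exists>y' \<kappa>. K y' \<le> ereal \<kappa> \<and>
      L + c * huber (infdist x X) + cy * (norm (y' - ys))\<^sup>2 \<le> \<xi> + A x \<bullet> y' - \<kappa>)"
    using partial_gap_growth_uniform[OF \<open>linear A\<close> \<open>linear B\<close> AB plq(1,2) splits(1) plq(3,4) splits(2),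
        of x0 y0 cy a b] saddle \<open>cy \<ge> 0\<close> a b
    unfolding X_def Y_def H_def K_def L_def by blast
  then obtain c1 where "c1 > 0" and c1: "\<And>ys x \<xi>. ys \<in> Y \<Longrightarrow> H x \<le> ereal \<xi> \<Longrightarrow>
      \<exists>y' \<kappa>. K y' \<le> ereal \<kappa> \<and> L + c1 * huber (infdist x X) + cy * (norm (y' - ys))\<^sup>2 \<le> \<xi> + A x \<bullet> y' - \<kappa>"
    by blast
  have "\<exists>c>0. \<forall>xs\<in>X. \<forall>y \<xi>. K y \<le> ereal \<xi> \<longrightarrow> (\<exists>x' \<kappa>. H x' \<le> ereal \<kappa> \<and>
      b + B y0 \<bullet> x0 - a + c * huber (infdist y Y) + cx * (norm (x' - xs))\<^sup>2 \<le> \<xi> + B y \<bullet> x' - \<kappa>)"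
    using partial_gap_growth_uniform[OF \<open>linear B\<close> \<open>linear A\<close> BA plq(3,4) splits(2) plq(1,2) splits(1),
        of y0 x0 cx b a] saddle \<open>cx \<ge> 0\<close> a b
    unfolding X_def Y_def H_def K_def by (simp add: conj_commute)
  then obtain c2 where "c2 > 0" and c2: "\<And>xs y \<xi>. xs \<in> X \<Longrightarrow> K y \<le> ereal \<xi> \<Longrightarrow>
      \<exists>x' \<kappa>. H x' \<le> ereal \<kappa> \<and> - L + c2 * huber (infdist y Y) + cx * (norm (x' - xs))\<^sup>2 \<le> \<xi> + B y \<bullet> x' - \<kappa>"
    unfolding L' by blast
  define R where "R = {z. infdist (fst z) X < 1 \<and> infdist (snd z) Y < 1}"
  \<comment> \<open>Chosen so that \<open>\<eta> / (2 * \<tau>) \<le> c1\<close> and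
    \<open>\<eta> / (2 * \<sigma>) \<le> c2\<close>.\<close>
  define \<eta> where "\<eta> = 2 * min (c1 * \<tau>) (c2 * \<sigma>)"
  have "\<eta> > 0" unfolding \<eta>_def using \<open>c1 > 0\<close> \<open>c2 > 0\<close> \<open>\<tau> > 0\<close> \<open>\<sigma> > 0\<close> by simp
  moreover have "open R"
    unfolding R_def by (intro open_Collect_conj open_Collect_less continuous_intros)
  moreover have "Zs \<subseteq> R" unfolding ZXY R_def by auto
  moreover have "ereal (\<eta> / 2 * (dist_V \<tau> \<sigma> z Zs)\<^sup>2) \<le> smoothed_gap A f f2 g g2 \<tau> \<sigma> \<beta> z zs"
    if "z \<in> R" "zs \<in> Zs" for z zs
  proof -
    obtain x y where z: "z = (x, y)" by (cases z)
    obtain xs ys where zs: "zs = (xs, ys)" "xs \<in> X" "ys \<in> Y" using \<open>zs \<in> Zs\<close> unfolding ZXY by auto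
    let ?S = "\<lambda>(x', y'). lagrangian A f f2 g g2 x y' - lagrangian A f f2 g g2 x' y
        - ereal (\<beta>x / (2 * \<tau>) * (norm (x' - xs))\<^sup>2) - ereal (\<beta>y / (2 * \<sigma>) * (norm (y' - ys))\<^sup>2)"
    have gap: "smoothed_gap A f f2 g g2 \<tau> \<sigma> \<beta> z zs =
        (if H x < \<infinity> \<and> K y < \<infinity> then SUP p\<in>UNIV. ?S p else \<infinity>)"
      unfolding smoothed_gap_def \<beta> z zs(1) edom_def H_def K_def by simp
    show ?thesis
    proof (cases "H x < \<infinity> \<and> K y < \<infinity>")
      case False
      then show ?thesis unfolding gap if_not_P[OF False] by simp
    next
      case True
      obtain \<xi> where \<xi>: "H x = ereal \<xi>" using True H_MInf[of x] by (cases "H x") auto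
      obtain \<upsilon> where \<upsilon>: "K y = ereal \<upsilon>" using True K_MInf[of y] by (cases "K y") auto
      obtain y' \<kappa> where y': "K y' \<le> ereal \<kappa>"
          "L + c1 * huber (infdist x X) + cy * (norm (y' - ys))\<^sup>2 \<le> \<xi> + A x \<bullet> y' - \<kappa>"
        using c1[OF zs(3), of x \<xi>] \<xi> by auto
      obtain x' \<mu> where x': "H x' \<le> ereal \<mu>"
          "- L + c2 * huber (infdist y Y) + cx * (norm (x' - xs))\<^sup>2 \<le> \<upsilon> + B y \<bullet> x' - \<mu>"
        using c2[OF zs(2), of y \<upsilon>] \<upsilon> by auto
      obtain \<kappa>' where \<kappa>': "K y' = ereal \<kappa>'" "\<kappa>' \<le> \<kappa>" using y'(1) K_MInf[of y'] by (cases "K y'") auto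
      obtain \<mu>' where \<mu>': "H x' = ereal \<mu>'" "\<mu>' \<le> \<mu>" using x'(1) H_MInf[of x'] by (cases "H x'") auto
      have near: "infdist x X < 1" "infdist y Y < 1" using \<open>z \<in> R\<close> unfolding R_def z by auto
      have sq: "huber (infdist x X) = (infdist x X)\<^sup>2" "huber (infdist y Y) = (infdist y Y)\<^sup>2"
        using near infdist_nonneg[of x X] infdist_nonneg[of y Y] unfolding huber_def
        by (simp_all add: power2_eq_square mult_left_le)
      have "\<eta> / 2 * (dist_V \<tau> \<sigma> z Zs)\<^sup>2 \<le>
          \<eta> / 2 * (1/\<tau> * (infdist x X)\<^sup>2 + 1/\<sigma> * (infdist y Y)\<^sup>2)"
        unfolding ZXY z using \<open>\<eta> > 0\<close> \<open>\<tau> > 0\<close> \<open>\<sigma> > 0\<close> \<open>x0 \<in> X\<close> \<open>y0 \<in> Y\<close>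
          polyhedron_imp_closed[OF \<open>polyhedron X\<close>] polyhedron_imp_closed[OF \<open>polyhedron Y\<close>]
        by (intro mult_left_mono dist_V_squared_le) auto
      also have "\<dots> = \<eta> / (2 * \<tau>) * (infdist x X)\<^sup>2 + \<eta> / (2 * \<sigma>) * (infdist y Y)\<^sup>2"
        by (simp add: distrib_left)
      also have "\<dots> \<le> c1 * (infdist x X)\<^sup>2 + c2 * (infdist y Y)\<^sup>2"
        unfolding \<eta>_def using \<open>\<tau> > 0\<close> \<open>\<sigma> > 0\<close>
        by (intro add_mono mult_right_mono) (auto simp: divide_le_eq)
      also have "\<dots> \<le> (\<xi> + A x \<bullet> y' - \<kappa>') - (\<mu>' + A x' \<bullet> y - \<upsilon>)
          - cx * (norm (x' - xs))\<^sup>2 - cy * (norm (y' - ys))\<^sup>2"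
        using y'(2) x'(2) \<kappa>'(2) \<mu>'(2) unfolding sq AB by linarith
      finally have "ereal (\<eta> / 2 * (dist_V \<tau> \<sigma> z Zs)\<^sup>2) \<le> ?S (x', y')"
        unfolding lag \<xi> \<upsilon> \<kappa>' \<mu>' cx_def cy_def by (simp add: \<xi> \<upsilon> \<kappa>' \<mu>')
      also have "\<dots> \<le> (SUP p\<in>UNIV. ?S p)" by (rule SUP_upper) simp
      finally show ?thesis unfolding gap using True by simp
    qed
  qed
  ultimately show "\<exists>\<eta>::real. \<exists>R. \<eta> > 0 \<and> open R \<and> Zs \<subseteq> R \<and> (\<forall>z\<in>R. \<forall>zs\<in>Zs.
      smoothed_gap A f f2 g g2 \<tau> \<sigma> \<beta> z zs \<ge> ereal (\<eta> / 2 * (dist_V \<tau> \<sigma> z Zs)\<^sup>2))"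
    by (intro exI[of _ \<eta>] exI[of _ R]) blast
qed

end
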